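(* Let $a,b,c\in\mathbb{R}$ and $1\le p,q,r<\infty$ with $q<r$ and $r\ge p$. Then $W^{1,(q,p)}_{\{a,b\}}(\mathbb{R}^N_* )$ is continuously embedded into $L^r(\mathbb{R}^N;|x|^cdx)$ (and hence into $W^{1,(r,p)}_{\{c,b\}}(\mathbb{R}^N_* )$) in each of the following cases: (i) $a$ and $b-p$ are on the same side of $-N$ (including $-N$), $\frac{a+N}q\ne\frac{b-p+N}p$, $c$ lies in the open interval with endpoints $c^0$ and $c^1$, and $\theta_c\left(\frac1p-\frac1N-\frac1q\right)\le\frac1r-\frac1q$; (ii) $a$ and $b-p$ are strictly on opposite sides of $-N$, $c$ lies in the open interval with endpoints $c^0$ and $-N$, and $\theta_c\left(\frac1p-\frac1N-\frac1q\right)\le\frac1r-\frac1q$; (iii) $r\le p^*$, either ($a\le-N$ and $b-p<-N$) or ($a\ge-N$ and $b-p>-N$), and $c=c^1$; (iv) $a=-N$, $b=p-N$, $q<r\le p^*$ and $c=-N$.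
   Context: $N\ge1$, $\mathbb{R}^N_*:=\mathbb{R}^N\setminus\{0\}$. For $d\in\mathbb{R}$, $0<s<\infty$, $\|u\|_{d,s}:=(\int_{\mathbb{R}^N}|x|^d|u|^s dx)^{1/s}$ ($\{0\}$ of measure $0$; Euclidean norm for vector-valued $u$), $L^s(\mathbb{R}^N;|x|^ddx)$ the measurable $u$ with $\|u\|_{d,s}<\infty$. $W^{1,(q,p)}_{\{a,b\}}(\mathbb{R}^N_* )$ is the set of $u\in L^1_{loc}(\mathbb{R}^N_* )$ with $\|u\|_{a,q},\|\nabla u\|_{b,p}<\infty$ (distributional gradient on $\mathbb{R}^N_*$), normed by $\|u\|_{a,q}+\|\nabla u\|_{b,p}$. $p^*:=\infty$ if $p\ge N$, $Np/(N-p)$ if $p<N$. $c^0:=\frac{r(a+N)}{q}-N$, $c^1:=\frac{r(b-p+N)}{p}-N$, $\theta_c:=\frac{c-c^0}{c^1-c^0}$ when $c^0\ne c^1$. *)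

theory Defs
  imports "HOL-Analysis.Analysis"
begin

definition partial_dir :: "('a::euclidean_space \<Rightarrow> real) \<Rightarrow> 'a \<Rightarrow> 'a \<Rightarrow> real" where
  "partial_dir f v x = frechet_derivative f (at x) v"

coinductive smooth_fun :: "('a::euclidean_space \<Rightarrow> real) \<Rightarrow> bool" where
  "(\<forall>x. f differentiable (at x)) \<Longrightarrow> (\<forall>i\<in>Basis. smooth_fun (partial_dir f i)) \<Longrightarrow> smooth_fun f"

definition test_fun_punct :: "('a::euclidean_space \<Rightarrow> real) \<Rightarrow> bool" where
  "test_fun_punct \<phi> \<longleftrightarrow> smooth_fun \<phi> \<and> compact (closure {x. \<phi> x \<noteq> 0})
      \<and> 0 \<notin> closure {x. \<phi> x \<noteq> 0}"

definition loc_int_punct :: "('a::euclidean_space \<Rightarrow> 'b::{banach,second_countable_topology}) \<Rightarrow> bool" where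
  "loc_int_punct u \<longleftrightarrow> (\<forall>K. compact K \<and> 0 \<notin> K \<longrightarrow> set_integrable lebesgue K u)"

definition weak_grad_punct :: "('a::euclidean_space \<Rightarrow> real) \<Rightarrow> ('a \<Rightarrow> 'a) \<Rightarrow> bool" where
  "weak_grad_punct u g \<longleftrightarrow> loc_int_punct u \<and> loc_int_punct g \<and>
     (\<forall>\<phi>. test_fun_punct \<phi> \<longrightarrow> (\<forall>i\<in>Basis.
        (LINT x|lebesgue. u x * partial_dir \<phi> i x) = - (LINT x|lebesgue. (g x \<bullet> i) * \<phi> x)))"

definition wint :: "real \<Rightarrow> real \<Rightarrow> ('a::euclidean_space \<Rightarrow> 'b::real_normed_vector) \<Rightarrow> ennreal" where
  "wint d s u = (\<integral>\<^sup>+ x. ennreal (norm x powr d * norm (u x) powr s) \<partial>lebesgue)"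

text \<open>The weighted norm  (int |x|^d |u|^s dx)^(1/s)  (meaningful when wint is finite).\<close>
definition wnorm :: "real \<Rightarrow> real \<Rightarrow> ('a::euclidean_space \<Rightarrow> 'b::real_normed_vector) \<Rightarrow> real" where
  "wnorm d s u = enn2real (wint d s u) powr (1 / s)"

definition pstar :: "real \<Rightarrow> real \<Rightarrow> ereal" where
  "pstar N p = (if p \<ge> N then \<infinity> else ereal (N * p / (N - p)))"

definition c0 :: "real \<Rightarrow> real \<Rightarrow> real \<Rightarrow> real \<Rightarrow> real" where
  "c0 N r a q = r * (a + N) / q - N"

definition c1 :: "real \<Rightarrow> real \<Rightarrow> real \<Rightarrow> real \<Rightarrow> real" where
  "c1 N r b p = r * (b - p + N) / p - N"

definition theta :: "real \<Rightarrow> real \<Rightarrow> real \<Rightarrow> real \<Rightarrow> real \<Rightarrow> real \<Rightarrow> real \<Rightarrow> real" where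
  "theta N r a b p q c = (c - c0 N r a q) / (c1 N r b p - c0 N r a q)"

end

theory Submission
  imports Defs
begin

text \<open>Cover the punctured space by the cells \<open>2\<^sup>k B(e, 1)\<close>, where \<open>e\<close> ranges over a finite subset of the
  sphere of radius 2 and \<open>k\<close> over the integers. On each cell subtract a median of \<open>u\<close>. The oscillation
  satisfies a scale-invariant Gagliardo--Nirenberg inequality, and because \<open>r \<ge> max p q\<close> its weighted
  powers can be summed over \<open>k\<close>. What is left is the sequence of medians along each ray:
  its size is controlled by \<open>u\<close>, its increments by the gradient (consecutive cells overlap, so
  nothing has to be compared across rays, and dimension one is not special). For this sequence the
  claim is an elementary weighted inequality, and the sign conditions on the exponents enter only there.

  The local inequality is obtained by Maz'ya's truncation method: an isoperimetric inequality for the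
  truncation of a \<open>C\<^sup>1\<close> function between the levels \<open>\<lambda>\<close> and \<open>2\<lambda>\<close> is applied on all dyadic levels at once,
  which treats all admissible exponents uniformly, including the endpoint \<open>r = p\<^sup>*\<close> and \<open>p \<ge> N\<close>. Mollification
  and Fatou's lemma pass to weakly differentiable functions.\<close>

subsection \<open>Weighted embeddings for sequences\<close>

text \<open>The natural variables are the scaling exponents (a+N)/q, (b-p+N)/p and (c+N)/r. When the
  third is the convex combination of the first two with parameter \<theta>, all powers of the scale
  cancel from the cell estimate. What remains is the exponent \<kappa> = r(\<theta>(1/p-1/N) +
  (1-\<theta>)/q). The condition on \<open>theta\<close> says \<kappa> <= 1, and for \<theta> = 1 so
  does r <= p*. Functions concentrating at a point inside one cell show that \<kappa> > 1 is
  impossible. The obstacle is that constants have no gradient, so the constant part of u on a cell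
  has to be tracked separately. A median serves better than a mean: the positive and negative parts
  of the difference each vanish on half of the ball, as the isoperimetric inequality requires, and
  the median is still bounded by the L^q norm of u on that ball. For the medians -N turns into the
  exponent 0, the threshold between weights that favour large scales and weights that favour small
  ones. At the end of the ray where the weight of u gives no control, a nonzero constant tail is
  excluded or made harmless only on the correct side of this threshold.\<close>

lemma power_sum_le_power_sum:
  fixes x :: "'i \<Rightarrow> real"
  assumes p: "0 < p" "p \<le> r" and x: "\<And>k. 0 \<le> x k" and M: "0 \<le> M"
    and S: "\<And>F. finite F \<Longrightarrow> (\<Sum>k\<in>F. x k powr p) \<le> M powr p" and F: "finite F"
  shows "(\<Sum>k\<in>F. x k powr r) \<le> M powr r"
proof -
  have le: "x k \<le> M" for k
  proof -
    have "x k powr p \<le> M powr p" using S[of "{k}"] by simp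
    then show ?thesis using p x M by (meson powr_less_mono2 not_le)
  qed
  have "x k powr r \<le> x k powr p * M powr (r - p)" for k
  proof -
    have "x k powr r = x k powr p * x k powr (r - p)"
      by (simp flip: powr_add)
    also have "\<dots> \<le> x k powr p * M powr (r - p)"
      using p x le by (intro mult_left_mono powr_mono2) auto
    finally show ?thesis .
  qed
  then have "(\<Sum>k\<in>F. x k powr r) \<le> (\<Sum>k\<in>F. x k powr p) * M powr (r - p)"
    by (simp add: sum_distrib_right sum_mono)
  also have "\<dots> \<le> M powr p * M powr (r - p)"
    using S[OF F] by (intro mult_right_mono) auto
  also have "\<dots> = M powr r" by (simp flip: powr_add)
  finally show ?thesis .
qed

lemma sum_powr_int_le:
  fixes s :: real
  assumes s: "0 < s" and F: "finite F" "\<And>k. k \<in> F \<Longrightarrow> (0::int) \<le> k"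
  shows "(\<Sum>k\<in>F. 2 powr (- s * real_of_int k)) \<le> 1 / (1 - 2 powr (- s))"
proof -
  define t where "t = (2::real) powr (- s)"
  have t: "0 < t" "t < 1" using s by (auto simp: t_def powr_less_one)
  have "(\<Sum>k\<in>F. 2 powr (- s * real_of_int k)) = (\<Sum>n\<in>nat ` F. t ^ n)"
  proof (subst sum.reindex)
    show "inj_on nat F" using F by (auto simp: inj_on_def eq_nat_nat_iff)
    show "(\<Sum>k\<in>F. 2 powr (- s * real_of_int k)) = sum ((\<lambda>n. t ^ n) \<circ> nat) F"
      using F t by (intro sum.cong) (auto simp: t_def powr_powr simp flip: powr_realpow)
  qed
  also have "\<dots> \<le> (\<Sum>n. t ^ n)"
    using t F by (intro sum_le_suminf summable_geometric) auto
  also have "\<dots> = 1 / (1 - t)" using t by (intro suminf_geometric) auto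
  finally show ?thesis by (simp add: t_def)
qed

text \<open>Model problem on one ray: \<open>m k\<close> is the median at scale 2^k, and A, B, C are
  the scaling exponents of the three weights, with the cell volume 2^(Nk) absorbed into them.
  Bounding all finite partial sums expresses the l^q, l^p and l^r norms with no summability side
  condition. A single M bounds both given norms, so the conclusion is homogeneous of degree r in
  M.\<close>

definition seq_embed :: "real \<Rightarrow> real \<Rightarrow> real \<Rightarrow> real \<Rightarrow> real \<Rightarrow> real \<Rightarrow> bool" where
  "seq_embed q p r A B C \<longleftrightarrow> (\<exists>K\<ge>0. \<forall>(m::int \<Rightarrow> real) M. 0 \<le> M \<longrightarrow>
     (\<forall>F. finite F \<longrightarrow> (\<Sum>k\<in>F. (2 powr (A * real_of_int k) * \<bar>m k\<bar>) powr q) \<le> M powr q) \<longrightarrow>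
     (\<forall>F. finite F \<longrightarrow> (\<Sum>k\<in>F. (2 powr (B * real_of_int k) * \<bar>m k - m (k + 1)\<bar>) powr p) \<le> M powr p) \<longrightarrow>
     (\<forall>F. finite F \<longrightarrow> (\<Sum>k\<in>F. (2 powr (C * real_of_int k) * \<bar>m k\<bar>) powr r) \<le> K * M powr r))"

text \<open>Reversing the order of the scales, the discrete counterpart of an inversion of space,
  changes the sign of all three exponents. Half of the sign cases thus follow from the other
  half.\<close>

lemma seq_embed_mirror:
  assumes q: "1 \<le> q" and p: "1 \<le> p" and h: "seq_embed q p r A B C"
  shows "seq_embed q p r (- A) (- B) (- C)"
proof -
  from h obtain K where K: "K \<ge> 0" and
    H': "\<forall>(m::int \<Rightarrow> real) M. 0 \<le> M \<longrightarrow>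
     (\<forall>F. finite F \<longrightarrow> (\<Sum>k\<in>F. (2 powr (A * real_of_int k) * \<bar>m k\<bar>) powr q) \<le> M powr q) \<longrightarrow>
     (\<forall>F. finite F \<longrightarrow> (\<Sum>k\<in>F. (2 powr (B * real_of_int k) * \<bar>m k - m (k + 1)\<bar>) powr p) \<le> M powr p) \<longrightarrow>
     (\<forall>F. finite F \<longrightarrow> (\<Sum>k\<in>F. (2 powr (C * real_of_int k) * \<bar>m k\<bar>) powr r) \<le> K * M powr r)"
    unfolding seq_embed_def by (elim exE conjE)
  note H = H'[THEN spec, THEN spec, THEN mp, THEN mp, THEN mp, THEN spec, THEN mp]
  \<comment> \<open>At index k the reversed sequence has the increment of m at -k-1, so the
    increment bound changes by the factor 2^(-B). T pays for it, and the 1 keeps T M above M in the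
    size bound.\<close>
  define T where "T = max 1 (2 powr (- B))"
  have T: "T \<ge> 1" "T \<ge> 2 powr (- B)" by (auto simp: T_def)
  show ?thesis unfolding seq_embed_def
  proof (intro exI conjI allI impI)
    show "0 \<le> K * T powr r" using K by simp
    fix m :: "int \<Rightarrow> real" and M and F :: "int set"
    assume M: "0 \<le> M" and F: "finite F"
     and X: "\<forall>F. finite F \<longrightarrow> (\<Sum>k\<in>F. (2 powr (- A * real_of_int k) * \<bar>m k\<bar>) powr q) \<le> M powr q"
     and Y: "\<forall>F. finite F \<longrightarrow> (\<Sum>k\<in>F. (2 powr (- B * real_of_int k) * \<bar>m k - m (k + 1)\<bar>) powr p) \<le> M powr p"
    have MT: "M \<le> T * M" using T M by (simp add: mult_le_cancel_right1)
    have "(\<Sum>k\<in>uminus ` F. (2 powr (C * real_of_int k) * \<bar>m (- k)\<bar>) powr r) \<le> K * (T * M) powr r"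
    proof (rule H)
      show "0 \<le> T * M" "finite (uminus ` F)" using T M F by auto
      show "\<forall>F. finite F \<longrightarrow> (\<Sum>k\<in>F. (2 powr (A * real_of_int k) * \<bar>m (- k)\<bar>) powr q) \<le> (T * M) powr q"
      proof (intro allI impI)
        fix F :: "int set" assume F: "finite F"
        have "(\<Sum>k\<in>F. (2 powr (A * real_of_int k) * \<bar>m (- k)\<bar>) powr q)
           = (\<Sum>k\<in>uminus ` F. (2 powr (- A * real_of_int k) * \<bar>m k\<bar>) powr q)"
          by (simp add: sum.reindex)
        also have "\<dots> \<le> M powr q" using X F by blast
        also have "\<dots> \<le> (T * M) powr q" using MT M q by (intro powr_mono2) auto
        finally show "(\<Sum>k\<in>F. (2 powr (A * real_of_int k) * \<bar>m (- k)\<bar>) powr q) \<le> (T * M) powr q" .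
      qed
      show "\<forall>F. finite F \<longrightarrow> (\<Sum>k\<in>F. (2 powr (B * real_of_int k) * \<bar>m (- k) - m (- (k + 1))\<bar>) powr p) \<le> (T * M) powr p"
      proof (intro allI impI)
        fix F :: "int set" assume F: "finite F"
        let ?h = "\<lambda>k::int. - k - 1"
        have inj: "inj_on ?h F" by (auto simp: inj_on_def)
        have "(\<Sum>k\<in>F. (2 powr (B * real_of_int k) * \<bar>m (- k) - m (- (k + 1))\<bar>) powr p)
           = (\<Sum>k\<in>F. 2 powr (- B * p) * (2 powr (- B * real_of_int (?h k)) * \<bar>m (?h k) - m (?h k + 1)\<bar>) powr p)"
        proof (intro sum.cong refl)
          fix k assume "k \<in> F"
          have "2 powr (B * real_of_int k) = 2 powr (- B) * 2 powr (- B * real_of_int (?h k))"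
            by (simp flip: powr_add add: algebra_simps)
          moreover have "\<bar>m (- k) - m (- (k + 1))\<bar> = \<bar>m (?h k) - m (?h k + 1)\<bar>" 
            by (simp add: abs_minus_commute)
          ultimately show "(2 powr (B * real_of_int k) * \<bar>m (- k) - m (- (k + 1))\<bar>) powr p
              = 2 powr (- B * p) * (2 powr (- B * real_of_int (?h k)) * \<bar>m (?h k) - m (?h k + 1)\<bar>) powr p"
            by (simp add: powr_mult powr_powr mult.assoc)
        qed
        also have "\<dots> = 2 powr (- B * p) * (\<Sum>k\<in>?h ` F. (2 powr (- B * real_of_int k) * \<bar>m k - m (k + 1)\<bar>) powr p)"
          by (subst sum.reindex[OF inj]) (simp add: sum_distrib_left)
        also have "\<dots> \<le> 2 powr (- B * p) * M powr p" using Y F by (intro mult_left_mono) auto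
        also have "\<dots> = (2 powr (- B) * M) powr p" using M by (simp add: powr_mult powr_powr)
        also have "\<dots> \<le> (T * M) powr p" using T M p by (intro powr_mono2 mult_right_mono) auto
        finally show "(\<Sum>k\<in>F. (2 powr (B * real_of_int k) * \<bar>m (- k) - m (- (k + 1))\<bar>) powr p) \<le> (T * M) powr p" .
      qed
    qed
    then show "(\<Sum>k\<in>F. (2 powr (- C * real_of_int k) * \<bar>m k\<bar>) powr r) \<le> K * T powr r * M powr r"
      using T M by (simp add: sum.reindex powr_mult mult_ac)
  qed
qed

text \<open>The inclusion of l^q in l^r with the weight kept. It settles a = -N, b = p-N, c = -N,
  where all three exponents are 0.\<close>

lemma seq_embed_same:
  assumes "1 \<le> q" "q \<le> r" shows "seq_embed q p r A B A"
  unfolding seq_embed_def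
proof (intro exI[of _ 1] conjI allI impI)
  fix m :: "int \<Rightarrow> real" and M and F :: "int set"
  assume M: "0 \<le> M" and F: "finite F"
     and X: "\<forall>F. finite F \<longrightarrow> (\<Sum>k\<in>F. (2 powr (A * real_of_int k) * \<bar>m k\<bar>) powr q) \<le> M powr q"
  have "(\<Sum>k\<in>F. (2 powr (A * real_of_int k) * \<bar>m k\<bar>) powr r) \<le> M powr r"
    by (rule power_sum_le_power_sum[where p=q]) (use assms M X F in auto)
  then show "(\<Sum>k\<in>F. (2 powr (A * real_of_int k) * \<bar>m k\<bar>) powr r) \<le> 1 * M powr r" by simp
qed simp

lemma powr_le_of_sum_powr_le:
  fixes x :: "int \<Rightarrow> real"
  assumes "1 \<le> q" "\<And>k. 0 \<le> x k" "0 \<le> M" "\<forall>F. finite F \<longrightarrow> (\<Sum>k\<in>F. x k powr q) \<le> M powr q"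
  shows "x k \<le> M"
proof -
  have "x k powr q \<le> M powr q" using assms(4)[rule_format, of "{k}"] by simp
  then show ?thesis using assms by (meson powr_less_mono2 not_le less_le_trans zero_less_one)
qed

text \<open>The part of the sum over the side on which the weight with exponent \<open>A\<close> dominates is
  trivial; the other side is summed geometrically from a pointwise bound.\<close>
lemma seq_embed_split:
  fixes P :: "int \<Rightarrow> bool"
  assumes q: "1 \<le> q" "q \<le> r" and s: "0 < s" and D: "0 \<le> D"
    and P: "\<And>k. P k \<Longrightarrow> C * real_of_int k \<le> A * real_of_int k"
    and j: "inj_on j {k. \<not> P k}" "\<And>k. \<not> P k \<Longrightarrow> (0::int) \<le> j k"
    and B: "\<And>(m::int \<Rightarrow> real) M k. \<lbrakk>0 \<le> M;
     \<forall>F. finite F \<longrightarrow> (\<Sum>k\<in>F. (2 powr (A * real_of_int k) * \<bar>m k\<bar>) powr q) \<le> M powr q;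
     \<forall>F. finite F \<longrightarrow> (\<Sum>k\<in>F. (2 powr (B * real_of_int k) * \<bar>m k - m (k + 1)\<bar>) powr p) \<le> M powr p;
     \<not> P k\<rbrakk> \<Longrightarrow> 2 powr (C * real_of_int k) * \<bar>m k\<bar> \<le> D * M * 2 powr (- s * real_of_int (j k))"
  shows "seq_embed q p r A B C"
  unfolding seq_embed_def
proof (intro exI conjI allI impI)
  let ?G = "D powr r * (1 / (1 - 2 powr (- (s * r))))"
  have sr: "s * r > 0" using s q by simp
  then have t: "2 powr (- (s * r)) < 1" by (auto intro: powr_less_one)
  then show "0 \<le> 1 + ?G" by simp
  fix m :: "int \<Rightarrow> real" and M and F :: "int set"
  assume M: "0 \<le> M" and F: "finite F"
     and X: "\<forall>F. finite F \<longrightarrow> (\<Sum>k\<in>F. (2 powr (A * real_of_int k) * \<bar>m k\<bar>) powr q) \<le> M powr q"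
     and Y: "\<forall>F. finite F \<longrightarrow> (\<Sum>k\<in>F. (2 powr (B * real_of_int k) * \<bar>m k - m (k + 1)\<bar>) powr p) \<le> M powr p"
  let ?f = "\<lambda>k. (2 powr (C * real_of_int k) * \<bar>m k\<bar>) powr r"
  have "sum ?f F = sum ?f (F \<inter> {k. P k}) + sum ?f (F \<inter> {k. \<not> P k})"
    using F by (subst sum.union_disjoint[symmetric]) (auto intro!: sum.cong)
  also have "sum ?f (F \<inter> {k. P k}) \<le> (\<Sum>k\<in>F \<inter> {k. P k}. (2 powr (A * real_of_int k) * \<bar>m k\<bar>) powr r)"
    using P q by (intro sum_mono powr_mono2 mult_right_mono) auto
  also have "\<dots> \<le> M powr r"
    by (rule power_sum_le_power_sum[where p=q]) (use q M X F in auto)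
  also have "sum ?f (F \<inter> {k. \<not> P k}) \<le> (\<Sum>k\<in>F \<inter> {k. \<not> P k}. (D * M) powr r * 2 powr (- (s * r) * real_of_int (j k)))"
  proof (intro sum_mono)
    fix k assume "k \<in> F \<inter> {k. \<not> P k}"
    then have "2 powr (C * real_of_int k) * \<bar>m k\<bar> \<le> D * M * 2 powr (- s * real_of_int (j k))"
      using B[OF M X Y] by auto
    then have "?f k \<le> (D * M * 2 powr (- s * real_of_int (j k))) powr r"
      using q by (intro powr_mono2) auto
    also have "\<dots> = (D * M) powr r * 2 powr (- (s * r) * real_of_int (j k))"
      using D M by (simp add: powr_mult powr_powr mult_ac)
    finally show "?f k \<le> (D * M) powr r * 2 powr (- (s * r) * real_of_int (j k))" .
  qed
  also have "\<dots> = (D * M) powr r * (\<Sum>k\<in>j ` (F \<inter> {k. \<not> P k}). 2 powr (- (s * r) * real_of_int k))"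
    using j by (subst sum.reindex) (auto simp: sum_distrib_left intro: inj_on_subset)
  also have "\<dots> \<le> (D * M) powr r * (1 / (1 - 2 powr (- (s * r))))"
    using F j sr by (intro mult_left_mono sum_powr_int_le) auto
  finally show "sum ?f F \<le> (1 + ?G) * M powr r"
    using D M by (simp add: powr_mult algebra_simps)
qed

text \<open>For k >= 0 the weight with exponent A dominates. For k < 0 the increments are added up
  downwards from \<open>m 0\<close>, and since C exceeds both B and 0 the weight 2^(Ck) beats the
  accumulated sum.\<close>

lemma seq_embed_below:
  assumes q: "1 \<le> q" "q \<le> r" and p: "1 \<le> p" and C: "max B 0 < C" "C < A"
  shows "seq_embed q p r A B C"
proof -
  \<comment> \<open>For B <= 0 the sum of the increments down to index -n is not comparable to its
    last term. A positive B' strictly between max(B,0) and C restores geometric growth and leaves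
    the margin C - B'.\<close>
  define B' where "B' = (max B 0 + C) / 2"
  have B': "0 < B'" "B < B'" "B' < C" using C by (auto simp: B'_def max_def split: if_splits)
  \<comment> \<open>The sum of the geometric series of ratio 2^(-B'), hence the fixed point of D
    2^(-B') + 1 = D. This lets the induction below reproduce its own bound.\<close>
  define D where "D = 1 / (1 - 2 powr (- B'))"
  have lt1: "2 powr (- B') < 1" using B' by (auto intro: powr_less_one)
  have "D * (1 - 2 powr (- B')) = 1" using lt1 B' by (simp add: D_def)
  then have D: "D \<ge> 1" "D * 2 powr (- B') + 1 = D"
    using lt1 by (auto simp: D_def divide_simps algebra_simps)
  show ?thesis
  proof (rule seq_embed_split[where P = "\<lambda>k. k \<ge> 0" and j = "\<lambda>k. - k" and D = D and s = "C - B'"])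
    fix m :: "int \<Rightarrow> real" and M and k :: int
    assume M: "0 \<le> M" and k: "\<not> 0 \<le> k"
      and X: "\<forall>F. finite F \<longrightarrow> (\<Sum>k\<in>F. (2 powr (A * real_of_int k) * \<bar>m k\<bar>) powr q) \<le> M powr q"
      and Y: "\<forall>F. finite F \<longrightarrow> (\<Sum>k\<in>F. (2 powr (B * real_of_int k) * \<bar>m k - m (k + 1)\<bar>) powr p) \<le> M powr p"
    have x: "2 powr (A * real_of_int k) * \<bar>m k\<bar> \<le> M" for k
      by (rule powr_le_of_sum_powr_le[where x="\<lambda>k. 2 powr (A * real_of_int k) * \<bar>m k\<bar>", OF q(1) _ M X]) auto
    have y: "2 powr (B * real_of_int k) * \<bar>m k - m (k + 1)\<bar> \<le> M" for k
      by (rule powr_le_of_sum_powr_le[where x="\<lambda>k. 2 powr (B * real_of_int k) * \<bar>m k - m (k + 1)\<bar>", OF p _ M Y]) auto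
    have bd: "\<bar>m (- int n)\<bar> \<le> D * M * 2 powr (B' * real n)" for n
    proof (induction n)
      case 0
      have "\<bar>m 0\<bar> \<le> M" using x[of 0] by simp
      also have "\<dots> \<le> D * M" using D M by (simp add: mult_le_cancel_right1)
      finally show ?case by simp
    next
      case (Suc n)
      let ?k = "- int (Suc n)"
      have e: "?k + 1 = - int n" by simp
      have "\<bar>m ?k\<bar> \<le> \<bar>m ?k - m (?k + 1)\<bar> + \<bar>m (?k + 1)\<bar>" by linarith
      also have "\<bar>m ?k - m (?k + 1)\<bar> \<le> M * 2 powr (B * real (Suc n))"
      proof -
        have "\<bar>m ?k - m (?k + 1)\<bar> = 2 powr (B * real (Suc n)) * (2 powr (B * real_of_int ?k) * \<bar>m ?k - m (?k + 1)\<bar>)"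
          by (simp flip: powr_add mult.assoc add: algebra_simps)
        also have "\<dots> \<le> 2 powr (B * real (Suc n)) * M" by (intro mult_left_mono y) auto
        finally show ?thesis by (simp add: mult_ac)
      qed
      also have "\<dots> \<le> M * 2 powr (B' * real (Suc n))"
        using B' M by (intro mult_left_mono powr_mono mult_right_mono) auto
      also have "\<bar>m (?k + 1)\<bar> \<le> D * M * 2 powr (B' * real n)" using Suc e by simp
      also have "\<dots> = (D * 2 powr (- B')) * M * 2 powr (B' * real (Suc n))"
        by (simp flip: powr_add add: algebra_simps mult.assoc)
      also have "M * 2 powr (B' * real (Suc n)) + \<dots> = (D * 2 powr (- B') + 1) * M * 2 powr (B' * real (Suc n))"
        by (simp add: algebra_simps)
      finally show ?case using D by simp
    qed
    have "\<bar>m k\<bar> \<le> D * M * 2 powr (- B' * real_of_int k)" using bd[of "nat (- k)"] k by simp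
    then have "2 powr (C * real_of_int k) * \<bar>m k\<bar> \<le> 2 powr (C * real_of_int k) * (D * M * 2 powr (- B' * real_of_int k))"
      by (intro mult_left_mono) auto
    also have "\<dots> = D * M * 2 powr (- (C - B') * real_of_int (- k))"
      by (simp flip: powr_add add: algebra_simps)
    finally show "2 powr (C * real_of_int k) * \<bar>m k\<bar> \<le> D * M * 2 powr (- (C - B') * real_of_int (- k))" .
  qed (use q B' D C in \<open>auto intro!: mult_right_mono simp: inj_on_def\<close>)
qed

text \<open>The size bound with A >= 0 forces m to vanish at +infinity, so \<open>m k\<close> is the
  sum of all increments from k on. For B > 0 this is a geometric series dominated by its first
  term.\<close>

lemma seq_decay:
  fixes m :: "int \<Rightarrow> real"
  assumes q: "1 \<le> q" and p: "1 \<le> p" and A: "0 \<le> A" and B: "0 < B" and M: "0 \<le> M"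
    and X: "\<forall>F. finite F \<longrightarrow> (\<Sum>k\<in>F. (2 powr (A * real_of_int k) * \<bar>m k\<bar>) powr q) \<le> M powr q"
    and Y: "\<forall>F. finite F \<longrightarrow> (\<Sum>k\<in>F. (2 powr (B * real_of_int k) * \<bar>m k - m (k + 1)\<bar>) powr p) \<le> M powr p"
  shows "2 powr (B * real_of_int k) * \<bar>m k\<bar> \<le> 1 / (1 - 2 powr (- B)) * M"
proof -
  define D where "D = 1 / (1 - 2 powr (- B))"
  have lt1: "2 powr (- B) < 1" using B by (auto intro: powr_less_one)
  have "D * (1 - 2 powr (- B)) = 1" using lt1 B by (simp add: D_def)
  then have D: "D \<ge> 1" "D * 2 powr (- B) + 1 = D"
    using lt1 by (auto simp: D_def divide_simps algebra_simps)
  have y: "2 powr (B * real_of_int k) * \<bar>m k - m (k + 1)\<bar> \<le> M" for k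
    by (rule powr_le_of_sum_powr_le[where x="\<lambda>k. 2 powr (B * real_of_int k) * \<bar>m k - m (k + 1)\<bar>", OF p _ M Y]) auto
  \<comment> \<open>Telescoping over n indices with a constant independent of n, because n tends to
    infinity afterwards.\<close>
  have step: "\<bar>m k\<bar> \<le> \<bar>m (k + int n)\<bar> + D * M * 2 powr (- B * real_of_int k)" for n k
  proof (induction n arbitrary: k)
    case 0 show ?case using D M by simp
  next
    case (Suc n)
    have "\<bar>m k\<bar> \<le> \<bar>m k - m (k + 1)\<bar> + \<bar>m (k + 1)\<bar>" by linarith
    also have "\<bar>m k - m (k + 1)\<bar> \<le> M * 2 powr (- B * real_of_int k)"
    proof -
      have "\<bar>m k - m (k + 1)\<bar> = 2 powr (- B * real_of_int k) * (2 powr (B * real_of_int k) * \<bar>m k - m (k + 1)\<bar>)"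
        by (simp flip: powr_add mult.assoc)
      also have "\<dots> \<le> 2 powr (- B * real_of_int k) * M" by (intro mult_left_mono y) auto
      finally show ?thesis by (simp add: mult_ac)
    qed
    also have "\<bar>m (k + 1)\<bar> \<le> \<bar>m (k + 1 + int n)\<bar> + D * M * 2 powr (- B * real_of_int (k + 1))"
      by (rule Suc)
    also have "D * M * 2 powr (- B * real_of_int (k + 1)) = (D * 2 powr (- B)) * M * 2 powr (- B * real_of_int k)"
      by (simp flip: powr_add add: algebra_simps mult.assoc)
    also have "M * 2 powr (- B * real_of_int k) + (\<bar>m (k + 1 + int n)\<bar> + \<dots>)
        = \<bar>m (k + int (Suc n))\<bar> + (D * 2 powr (- B) + 1) * M * 2 powr (- B * real_of_int k)"
      by (simp add: algebra_simps)
    finally show ?case using D by simp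
  qed
  \<comment> \<open>For A >= 0 the weights at the indices j >= k are bounded below by the one at k,
    so |m j|^q is summable there.\<close>
  have "(\<lambda>n. \<bar>m (k + int n)\<bar> powr q) \<longlonglongrightarrow> 0"
  proof (rule summable_LIMSEQ_zero, rule summableI_nonneg_bounded)
    let ?t = "2 powr (- (A * q) * real_of_int k)"
    fix n
    have "(\<Sum>i<n. \<bar>m (k + int i)\<bar> powr q) = (\<Sum>j\<in>(\<lambda>i. k + int i) ` {..<n}. \<bar>m j\<bar> powr q)"
      by (subst sum.reindex) (auto simp: inj_on_def)
    also have "\<dots> \<le> (\<Sum>j\<in>(\<lambda>i. k + int i) ` {..<n}. ?t * (2 powr (A * real_of_int j) * \<bar>m j\<bar>) powr q)"
    proof (intro sum_mono)
      fix j assume "j \<in> (\<lambda>i. k + int i) ` {..<n}"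
      then have "j \<ge> k" by auto
      then have "1 \<le> 2 powr (A * q * (real_of_int j - real_of_int k))" using A q by (intro ge_one_powr_ge_zero) auto
      also have "\<dots> = ?t * 2 powr (A * real_of_int j * q)" by (simp flip: powr_add add: algebra_simps)
      finally have "\<bar>m j\<bar> powr q \<le> ?t * 2 powr (A * real_of_int j * q) * \<bar>m j\<bar> powr q"
        by (simp add: mult_le_cancel_right1)
      also have "\<dots> = ?t * (2 powr (A * real_of_int j) * \<bar>m j\<bar>) powr q"
        by (simp add: powr_mult powr_powr)
      finally show "\<bar>m j\<bar> powr q \<le> ?t * (2 powr (A * real_of_int j) * \<bar>m j\<bar>) powr q" .
    qed
    also have "\<dots> \<le> ?t * M powr q"
      unfolding sum_distrib_left[symmetric] using X by (intro mult_left_mono) auto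
    finally show "(\<Sum>i<n. \<bar>m (k + int i)\<bar> powr q) \<le> ?t * M powr q" .
  qed auto
  then have "(\<lambda>n. (\<bar>m (k + int n)\<bar> powr q) powr (1 / q)) \<longlonglongrightarrow> 0 powr (1 / q)"
    using q by (intro tendsto_powr') auto
  then have "(\<lambda>n. \<bar>m (k + int n)\<bar>) \<longlonglongrightarrow> 0"
    using q by (simp add: powr_powr)
  then have "(\<lambda>n. \<bar>m (k + int n)\<bar> + D * M * 2 powr (- B * real_of_int k)) \<longlonglongrightarrow> 0 + D * M * 2 powr (- B * real_of_int k)"
    by (intro tendsto_intros)
  then have "\<bar>m k\<bar> \<le> 0 + D * M * 2 powr (- B * real_of_int k)"
    by (rule LIMSEQ_le_const) (use step in auto)
  then have "2 powr (B * real_of_int k) * \<bar>m k\<bar> \<le> 2 powr (B * real_of_int k) * (D * M * 2 powr (- B * real_of_int k))"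
    by (intro mult_left_mono) auto
  also have "\<dots> = D * M" by (simp flip: powr_add)
  finally show ?thesis by (simp add: D_def)
qed

text \<open>For k <= 0 the weight with exponent A dominates; for k > 0 the decay 2^(-Bk) forced by
  the increments beats 2^(Ck). The value A = 0 is allowed: a plain l^q bound already excludes a
  nonzero limit.\<close>

lemma seq_embed_above:
  assumes q: "1 \<le> q" "q \<le> r" and p: "1 \<le> p" and C: "0 \<le> A" "A < C" "C < B"
  shows "seq_embed q p r A B C"
proof (rule seq_embed_split[where P = "\<lambda>k. k \<le> 0" and j = "\<lambda>k. k" and D = "1 / (1 - 2 powr (- B))" and s = "B - C"])
  have "2 powr (- B) < 1" using C by (auto intro: powr_less_one)
  then show "0 \<le> 1 / (1 - 2 powr (- B))" by simp
  fix m :: "int \<Rightarrow> real" and M and k :: int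
  assume M: "0 \<le> M" and k: "\<not> k \<le> 0"
      and X: "\<forall>F. finite F \<longrightarrow> (\<Sum>k\<in>F. (2 powr (A * real_of_int k) * \<bar>m k\<bar>) powr q) \<le> M powr q"
      and Y: "\<forall>F. finite F \<longrightarrow> (\<Sum>k\<in>F. (2 powr (B * real_of_int k) * \<bar>m k - m (k + 1)\<bar>) powr p) \<le> M powr p"
  have "2 powr (C * real_of_int k) * \<bar>m k\<bar> = 2 powr (- (B - C) * real_of_int k) * (2 powr (B * real_of_int k) * \<bar>m k\<bar>)"
    by (simp flip: powr_add mult.assoc add: algebra_simps)
  also have "\<dots> \<le> 2 powr (- (B - C) * real_of_int k) * (1 / (1 - 2 powr (- B)) * M)"
    using seq_decay[OF q(1) p C(1) _ M X Y] C by (intro mult_left_mono) auto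
  finally show "2 powr (C * real_of_int k) * \<bar>m k\<bar> \<le> 1 / (1 - 2 powr (- B)) * M * 2 powr (- (B - C) * real_of_int k)"
    by (simp add: mult_ac)
qed (use q C in \<open>auto intro!: mult_right_mono_neg\<close>)

text \<open>Convexity of the r-th power at t x + (1-t)(y/(1-t)). The point is the coefficient t < 1
  in front of x^r, which makes absorption possible in the Hardy inequality below.\<close>

lemma powr_convex_comb:
  fixes x y t r :: real
  assumes "0 \<le> x" "0 \<le> y" "0 < t" "t < 1" "1 \<le> r"
  shows "(t * x + y) powr r \<le> t * x powr r + (1 - t) powr (1 - r) * y powr r"
proof -
  define z where "z = y / (1 - t)"
  have le: "s powr r \<le> s" if "0 < s" "s < 1" for s
    using powr_mono'[of 1 r s] that assms by simp
  have "(t * x + (1 - t) * z) powr r \<le> t * x powr r + (1 - t) * z powr r"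
  proof -
    \<comment> \<open>If one of the two terms vanishes, the claim reduces to s^r <= s for the
      remaining coefficient s in (0,1).\<close>
    consider "x = 0" | "y = 0" | "x > 0" "y > 0" using assms by linarith
    then show ?thesis
    proof cases
      assume 1: "x = 0"
      have "z \<ge> 0" using assms by (simp add: z_def)
      then have "((1 - t) * z) powr r \<le> (1 - t) * z powr r"
        using le[of "1 - t"] assms by (simp add: powr_mult mult_right_mono)
      then show ?thesis using 1 by simp
    next
      assume 2: "y = 0"
      show ?thesis using 2 le[of t] assms by (simp add: powr_mult z_def mult_right_mono)
    next
      assume 3: "x > 0" "y > 0"
      from 3 show ?thesis
        using convex_onD[OF powr_convex[of r], of "1 - t" x z] assms by (simp add: z_def)
    qed
  qed
  then have "(t * x + (1 - t) * (y / (1 - t))) powr r \<le> t * x powr r + (1 - t) * (y / (1 - t)) powr r"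
    by (simp add: z_def)
  also have "(1 - t) * (y / (1 - t)) powr r = (1 - t) powr (1 - r) * y powr r"
    using assms by (simp add: powr_divide powr_diff)
  finally show ?thesis using assms by simp
qed

text \<open>A discrete Hardy inequality for the endpoint C = B. With s k = 2^(Bk)|m k| the triangle
  inequality reads s k <= t s(k+1) + y k, where t = 2^(-B) < 1; after convexity and summation the
  shifted sum is absorbed on the left. The pointwise decay bound alone leaves no spare power for
  convergence of the series.\<close>

lemma seq_embed_Hardy:
  assumes q: "1 \<le> q" "q \<le> r" and p: "1 \<le> p" "p \<le> r" and A: "0 \<le> A" and B: "0 < B"
  shows "seq_embed q p r A B B"
  unfolding seq_embed_def
proof (intro exI conjI allI impI)
  define t where "t = 2 powr (- B)"
  have t: "0 < t" "t < 1" using B by (auto simp: t_def powr_less_one)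
  define D where "D = 1 / (1 - t)"
  have D: "D \<ge> 0" using t by (auto simp: D_def)
  define K where "K = (t * D powr r + (1 - t) powr (1 - r)) / (1 - t)"
  show "0 \<le> K" using t by (simp add: K_def)
  fix m :: "int \<Rightarrow> real" and M and F :: "int set"
  assume M: "0 \<le> M" and F: "finite F"
     and X: "\<forall>F. finite F \<longrightarrow> (\<Sum>k\<in>F. (2 powr (A * real_of_int k) * \<bar>m k\<bar>) powr q) \<le> M powr q"
     and Y: "\<forall>F. finite F \<longrightarrow> (\<Sum>k\<in>F. (2 powr (B * real_of_int k) * \<bar>m k - m (k + 1)\<bar>) powr p) \<le> M powr p"
  define s where "s k = 2 powr (B * real_of_int k) * \<bar>m k\<bar>" for k
  define y where "y k = 2 powr (B * real_of_int k) * \<bar>m k - m (k + 1)\<bar>" for k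
  have s0: "s k \<ge> 0" "y k \<ge> 0" for k by (auto simp: s_def y_def)
  have sD: "s k \<le> D * M" for k
    using seq_decay[OF q(1) p(1) A B M X Y] by (simp add: s_def D_def t_def)
  have rec: "s k powr r \<le> t * s (k + 1) powr r + (1 - t) powr (1 - r) * y k powr r" for k
  proof -
    have "s k \<le> 2 powr (B * real_of_int k) * (\<bar>m (k + 1)\<bar> + \<bar>m k - m (k + 1)\<bar>)"
      unfolding s_def by (intro mult_left_mono) auto
    also have "\<dots> = t * s (k + 1) + y k"
      by (simp add: s_def y_def t_def algebra_simps flip: powr_add mult.assoc)
    finally have "s k powr r \<le> (t * s (k + 1) + y k) powr r" using s0 q by (intro powr_mono2) auto
    also have "\<dots> \<le> t * s (k + 1) powr r + (1 - t) powr (1 - r) * y k powr r"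
      using s0 t q by (intro powr_convex_comb) auto
    finally show ?thesis .
  qed
  \<comment> \<open>A symmetric window containing F, so that the shift by one leaves it at one end
    only.\<close>
  obtain n where n: "F \<subseteq> {- int n..int n}"
  proof -
    have "finite (abs ` F)" using F by simp
    then obtain N where N: "\<And>k. k \<in> F \<Longrightarrow> \<bar>k\<bar> \<le> N"
      by (metis bdd_above_finite bdd_above.E imageI)
    then have "F \<subseteq> {- int (nat N)..int (nat N)}" by force
    then show ?thesis using that by blast
  qed
  let ?I = "{- int n..int n}"
  let ?S = "\<Sum>k\<in>?I. s k powr r"
  have "?S \<le> (\<Sum>k\<in>?I. t * s (k + 1) powr r + (1 - t) powr (1 - r) * y k powr r)"
    by (intro sum_mono rec)
  also have "\<dots> = t * (\<Sum>k\<in>?I. s (k + 1) powr r) + (1 - t) powr (1 - r) * (\<Sum>k\<in>?I. y k powr r)"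
    by (simp add: sum.distrib sum_distrib_left)
  \<comment> \<open>The shifted window gains one index at the top. Its term is covered by the
    uniform decay bound, independently of n.\<close>
  also have "(\<Sum>k\<in>?I. s (k + 1) powr r) \<le> ?S + (D * M) powr r"
  proof -
    have "(\<Sum>k\<in>?I. s (k + 1) powr r) = (\<Sum>k\<in>{- int n + 1..int n + 1}. s k powr r)"
      by (rule sum.reindex_bij_witness[where i = "\<lambda>k. k - 1" and j = "\<lambda>k. k + 1"]) auto
    also have "\<dots> \<le> (\<Sum>k\<in>insert (int n + 1) ?I. s k powr r)"
      by (intro sum_mono2) auto
    also have "\<dots> = ?S + s (int n + 1) powr r" by simp
    also have "\<dots> \<le> ?S + (D * M) powr r" using sD s0 q by (intro add_left_mono powr_mono2) auto
    finally show ?thesis .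
  qed
  also have "(\<Sum>k\<in>?I. y k powr r) \<le> M powr r"
    by (rule power_sum_le_power_sum[where p=p]) (use p M Y s0 in \<open>auto simp: y_def\<close>)
  finally have "?S \<le> t * (?S + (D * M) powr r) + (1 - t) powr (1 - r) * M powr r"
    using t by (simp add: mult_left_mono)
  then have "(1 - t) * ?S \<le> (t * D powr r + (1 - t) powr (1 - r)) * M powr r"
    using D M by (simp add: powr_mult algebra_simps)
  then have "?S \<le> K * M powr r" using t by (simp add: K_def field_simps)
  moreover have "(\<Sum>k\<in>F. s k powr r) \<le> ?S" using n by (intro sum_mono2) auto
  ultimately show "(\<Sum>k\<in>F. (2 powr (B * real_of_int k) * \<bar>m k\<bar>) powr r) \<le> K * M powr r"
    by (simp add: s_def)
qed

subsection \<open>A smooth bump function\<close>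

text \<open>The whole family exp(-1/t)/t^n is introduced because derivatives stay in its linear
  span; n = 0 is the classical flat function.\<close>

definition flat :: "nat \<Rightarrow> real \<Rightarrow> real" where
  "flat n t = (if t > 0 then exp (- 1 / t) / t ^ n else 0)"

lemma flat_nonneg: "0 \<le> flat n t"
  by (simp add: flat_def)

lemma flat_0_le_1: "flat 0 t \<le> 1"
  by (simp add: flat_def)

text \<open>The exponential series of 1/t exceeds its term of order n+2, which leaves two spare
  powers of t. Quadratic vanishing at 0 makes the difference quotient there tend to 0.\<close>

lemma flat_abs_le: "\<bar>flat n t\<bar> \<le> fact (n + 2) * t\<^sup>2"
proof (cases "t > 0")
  case True
  define c :: real where "c = fact (n + 2)"
  have c: "c > 0" by (simp add: c_def)
  have "(1 / t) ^ (n + 2) / c \<le> exp (1 / t)"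
    unfolding c_def
  proof -
    have "(\<Sum>k\<in>{n + 2}. (1 / t) ^ k /\<^sub>R fact k) \<le> (\<Sum>k. (1 / t) ^ k /\<^sub>R fact k)"
      using True by (intro sum_le_suminf summable_exp_generic) auto
    then show "(1 / t) ^ (n + 2) / fact (n + 2) \<le> exp (1 / t)"
      by (simp add: exp_def divide_inverse mult_ac)
  qed
  then have "1 \<le> c * t ^ (n + 2) * exp (1 / t)"
    using True c by (simp add: divide_simps mult_ac)
  then have "exp (- 1 / t) \<le> c * t ^ (n + 2)"
    using True c by (simp add: exp_minus field_simps)
  then show ?thesis unfolding c_def[symmetric]
    using True c by (simp add: flat_def field_simps power_add power2_eq_square)
qed (simp add: flat_def)

lemma DERIV_flat:
  "(flat n has_real_derivative - real n * flat (n + 1) t + flat (n + 2) t) (at t)"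
proof -
  consider "t > 0" | "t < 0" | "t = 0" by linarith
  then show ?thesis
  proof cases
    case 1
    have "((\<lambda>t. exp (- 1 / t) * (1 / t) ^ n) has_real_derivative
        exp (- 1 / t) * (1 / t\<^sup>2) * (1 / t) ^ n + real n * (1 / t) ^ (n - 1) * (- 1 / t\<^sup>2) * exp (- 1 / t)) (at t)"
      using 1 by (auto intro!: derivative_eq_intros simp: power2_eq_square)
    moreover have "exp (- 1 / t) * (1 / t\<^sup>2) * (1 / t) ^ n + real n * (1 / t) ^ (n - 1) * (- 1 / t\<^sup>2) * exp (- 1 / t)
      = - real n * flat (n + 1) t + flat (n + 2) t"
      using 1 by (cases n) (auto simp: flat_def power2_eq_square field_simps)
    ultimately have "((\<lambda>t. exp (- 1 / t) * (1 / t) ^ n) has_real_derivative - real n * flat (n + 1) t + flat (n + 2) t) (at t)"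
      by simp
    then show ?thesis
      by (rule has_field_derivative_transform_within_open[where S="{0<..}"]) (use 1 in \<open>auto simp: flat_def power_divide\<close>)
  next
    case 2
    have "((\<lambda>t. 0) has_real_derivative - real n * flat (n + 1) t + flat (n + 2) t) (at t)"
      using 2 by (simp add: flat_def)
    then show ?thesis
      by (rule has_field_derivative_transform_within_open[where S="{..<0}"]) (use 2 in \<open>auto simp: flat_def\<close>)
  next
    case 3
    have "(\<lambda>h. (flat n h - flat n 0) / (h - 0)) \<midarrow>0\<rightarrow> 0"
    proof (rule Lim_null_comparison[where g="\<lambda>h. fact (n + 2) * \<bar>h\<bar>"])
      show "\<forall>\<^sub>F h in at 0. norm ((flat n h - flat n 0) / (h - 0)) \<le> fact (n + 2) * \<bar>h\<bar>"
      proof (rule always_eventually, rule allI)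
        fix h :: real
        show "norm ((flat n h - flat n 0) / (h - 0)) \<le> fact (n + 2) * \<bar>h\<bar>"
        proof (cases "h = 0")
          case False
          have "\<bar>flat n h\<bar> \<le> fact (n + 2) * \<bar>h\<bar> * \<bar>h\<bar>"
            using flat_abs_le[of n h] by (simp add: power2_eq_square mult.assoc)
          then show ?thesis using False by (simp add: flat_def[of n 0] field_simps)
        qed simp
      qed
      show "((\<lambda>h. fact (n + 2) * \<bar>h\<bar>) \<longlongrightarrow> 0) (at (0::real))"
        by (auto intro!: tendsto_eq_intros)
    qed
    then show ?thesis using 3 by (simp add: has_field_derivative_iff flat_def)
  qed
qed

lemma flat_has_derivative:
  "(flat n has_derivative (\<lambda>h. (- real n * flat (n + 1) t + flat (n + 2) t) * h)) (at t)"
  using DERIV_flat[of n t] by (simp add: has_field_derivative_def)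

lemma isCont_flat: "isCont (flat n) t"
  using DERIV_flat DERIV_isCont by blast

lemma continuous_on_flat: "continuous_on S (flat n)"
  using isCont_flat by (simp add: continuous_at_imp_continuous_on)

text \<open>Smoothness is coinductive, so its proof needs a class that contains the bump and is
  stable under all partial derivatives. The free index n of \<open>flat\<close> keeps derivatives
  inside. The parameter \<open>e\<close> is a squared radius here.\<close>

inductive_set flat_alg :: "'a::euclidean_space \<Rightarrow> real \<Rightarrow> ('a \<Rightarrow> real) set" for z e where
  flat_alg_const: "(\<lambda>x. c) \<in> flat_alg z e"
| flat_alg_coord: "(\<lambda>x. x \<bullet> i) \<in> flat_alg z e"
| flat_alg_add: "f \<in> flat_alg z e \<Longrightarrow> g \<in> flat_alg z e \<Longrightarrow> (\<lambda>x. f x + g x) \<in> flat_alg z e"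
| flat_alg_mult: "f \<in> flat_alg z e \<Longrightarrow> g \<in> flat_alg z e \<Longrightarrow> (\<lambda>x. f x * g x) \<in> flat_alg z e"
| flat_alg_flat: "(\<lambda>x. flat n (e - (x - z) \<bullet> (x - z))) \<in> flat_alg z e"

lemma flat_radial_has_derivative:
  "((\<lambda>x. flat n (e - (x - z) \<bullet> (x - z))) has_derivative
     (\<lambda>h. (- real n * flat (n + 1) (e - (x - z) \<bullet> (x - z)) + flat (n + 2) (e - (x - z) \<bullet> (x - z)))
        * (- 2 * ((x - z) \<bullet> h)))) (at x)"
proof -
  have "((\<lambda>x. e - (x - z) \<bullet> (x - z)) has_derivative (\<lambda>h. - 2 * ((x - z) \<bullet> h))) (at x)"
    by (auto intro!: derivative_eq_intros simp: inner_commute)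
  from has_derivative_compose[OF this flat_has_derivative] show ?thesis .
qed

lemma flat_alg_deriv:
  "f \<in> flat_alg z e \<Longrightarrow> \<exists>f'. (\<forall>x. (f has_derivative f' x) (at x)) \<and> (\<forall>i. (\<lambda>x. f' x i) \<in> flat_alg z e)"
proof (induction rule: flat_alg.induct)
  case (flat_alg_const c)
  show ?case by (intro exI[of _ "\<lambda>x h. 0"]) (auto intro: flat_alg.intros)
next
  case (flat_alg_coord i)
  show ?case by (intro exI[of _ "\<lambda>x h. h \<bullet> i"]) (auto intro: flat_alg.intros intro!: derivative_eq_intros)
next
  case (flat_alg_add f g)
  then obtain f' g' where "\<forall>x. (f has_derivative f' x) (at x)" "\<forall>i. (\<lambda>x. f' x i) \<in> flat_alg z e"
    "\<forall>x. (g has_derivative g' x) (at x)" "\<forall>i. (\<lambda>x. g' x i) \<in> flat_alg z e" by blast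
  then show ?case
    by (intro exI[of _ "\<lambda>x h. f' x h + g' x h"]) (auto intro: flat_alg.intros has_derivative_add)
next
  case (flat_alg_mult f g)
  then obtain f' g' where "\<forall>x. (f has_derivative f' x) (at x)" "\<forall>i. (\<lambda>x. f' x i) \<in> flat_alg z e"
    "\<forall>x. (g has_derivative g' x) (at x)" "\<forall>i. (\<lambda>x. g' x i) \<in> flat_alg z e" by blast
  then show ?case using flat_alg_mult.hyps
    by (intro exI[of _ "\<lambda>x h. f x * g' x h + f' x h * g x"])
      (auto intro!: flat_alg.intros has_derivative_mult)
next
  case (flat_alg_flat n)
  let ?F = "\<lambda>n x. flat n (e - (x - z) \<bullet> (x - z))"
  show ?case
  proof (intro exI conjI allI)
    show "(?F n has_derivative (\<lambda>h. (- real n * ?F (n + 1) x + ?F (n + 2) x) * (- 2 * ((x - z) \<bullet> h)))) (at x)" for x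
      by (rule flat_radial_has_derivative)
    fix i
    have "(\<lambda>x. (- real n * ?F (n + 1) x + ?F (n + 2) x) * (- 2 * (x \<bullet> i + - (z \<bullet> i)))) \<in> flat_alg z e"
      by (intro flat_alg.intros)
    then show "(\<lambda>x. (- real n * ?F (n + 1) x + ?F (n + 2) x) * (- 2 * ((x - z) \<bullet> i))) \<in> flat_alg z e"
      by (simp add: inner_diff_left)
  qed
qed

lemma smooth_fun_flat_alg: "f \<in> flat_alg z e \<Longrightarrow> smooth_fun f"
proof (coinduction arbitrary: f rule: smooth_fun.coinduct)
  case (smooth_fun f)
  then obtain f' where f': "\<And>x. (f has_derivative f' x) (at x)" "\<And>i. (\<lambda>x. f' x i) \<in> flat_alg z e"
    using flat_alg_deriv by blast
  then have "partial_dir f i = (\<lambda>x. f' x i)" for i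
    by (auto simp: partial_dir_def fun_eq_iff frechet_derivative_at[OF f'(1), symmetric])
  then show ?case using f' by (auto simp: differentiable_def)
qed

definition bump :: "real \<Rightarrow> 'a::euclidean_space \<Rightarrow> real" where
  "bump e x = flat 0 (e\<^sup>2 - x \<bullet> x)"

text \<open>\<open>flat 0\<close> has derivative \<open>flat 2\<close>, since the term with factor n
  drops out for n = 0; the chain rule supplies -2x.\<close>

definition bump_grad :: "real \<Rightarrow> 'a::euclidean_space \<Rightarrow> 'a" where
  "bump_grad e x = (- 2 * flat 2 (e\<^sup>2 - x \<bullet> x)) *\<^sub>R x"

lemma bump_has_derivative: "(bump e has_derivative (\<lambda>h. bump_grad e x \<bullet> h)) (at x)"
proof -
  have "(0::nat) + 2 = 2" "(0::nat) + 1 = 1" by simp_all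
  note h = flat_radial_has_derivative[of 0 "e\<^sup>2" 0 x, unfolded this]
  show ?thesis
    using h unfolding bump_def[abs_def] bump_grad_def by (simp add: mult_ac)
qed

lemma bump_nonneg: "0 \<le> bump e x" by (simp add: bump_def flat_nonneg)

lemma bump_le_1: "bump e x \<le> 1" by (simp add: bump_def flat_0_le_1)

lemma bump_pos_iff:
  assumes "e > 0" shows "bump e x \<noteq> 0 \<longleftrightarrow> norm x < e"
proof -
  have "x \<bullet> x < e\<^sup>2 \<longleftrightarrow> norm x < e"
    using assms by (metis norm_ge_zero less_imp_le power2_norm_eq_inner power_less_imp_less_base
      power_strict_mono zero_less_numeral)
  then show ?thesis by (simp add: bump_def flat_def)
qed

lemma bump_eq_0: "e > 0 \<Longrightarrow> e \<le> norm x \<Longrightarrow> bump e x = 0"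
  using bump_pos_iff[of e x] by auto

lemma bump_grad_eq_0: "e > 0 \<Longrightarrow> e \<le> norm x \<Longrightarrow> bump_grad e x = 0"
proof -
  assume "e > 0" "e \<le> norm x"
  then have "e\<^sup>2 \<le> x \<bullet> x" by (simp add: power2_norm_eq_inner[symmetric] power_mono)
  then show ?thesis by (simp add: bump_grad_def flat_def)
qed

lemma bump_minus: "bump e (- x) = bump e x" by (simp add: bump_def)

lemma continuous_on_flat_radial: "continuous_on S (\<lambda>x. flat n (e - x \<bullet> x))"
proof (rule continuous_on_compose2[OF continuous_on_flat[of UNIV]])
  show "continuous_on S (\<lambda>x. e - x \<bullet> x)" by (intro continuous_intros)
qed simp

lemma continuous_bump: "continuous_on S (bump e)"
  unfolding bump_def[abs_def] by (rule continuous_on_flat_radial)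

lemma continuous_bump_grad: "continuous_on S (bump_grad e)"
  unfolding bump_grad_def[abs_def] by (intro continuous_intros continuous_on_flat_radial)

lemma bump_grad_bounded:
  assumes "e > 0" shows "\<exists>L\<ge>0. \<forall>x::'a::euclidean_space. norm (bump_grad e x) \<le> L"
proof -
  have "compact (bump_grad e ` cball (0::'a) e)"
    by (intro compact_continuous_image continuous_bump_grad) auto
  then obtain L where L: "\<And>x::'a. x \<in> cball 0 e \<Longrightarrow> norm (bump_grad e x) \<le> L"
    using compact_imp_bounded bounded_iff by (metis imageI)
  have "norm (bump_grad e x) \<le> max 0 L" for x :: 'a
    using L[of x] bump_grad_eq_0[OF assms, of x] by (cases "norm x \<le> e") auto
  then show ?thesis by (intro exI[of _ "max 0 L"]) auto
qed

text \<open>The support is a closed ball that misses the origin. These translates are the only test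
  functions on which the weak gradient identity is evaluated.\<close>

lemma test_fun_bump:
  assumes e: "0 < e" "e < norm (z::'a::euclidean_space)"
  shows "test_fun_punct (\<lambda>x. bump e (x - z))"
proof -
  have S: "smooth_fun (\<lambda>x. bump e (x - z))"
    unfolding bump_def by (rule smooth_fun_flat_alg[OF flat_alg_flat])
  have B: "{x. bump e (x - z) \<noteq> 0} = ball z e"
    unfolding bump_pos_iff[OF e(1)] ball_def by (simp add: dist_norm norm_minus_commute)
  have "closure (ball z e) = cball z e" using e by simp
  then show ?thesis
    unfolding test_fun_punct_def B using S e by simp
qed

lemma partial_dir_bump: "partial_dir (\<lambda>x. bump e (x - z)) i x = bump_grad e (x - z) \<bullet> i"
proof -
  have "((\<lambda>x. x - z) has_derivative (\<lambda>h. h)) (at x)" by (auto intro!: derivative_eq_intros)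
  from has_derivative_compose[OF this bump_has_derivative]
  have "((\<lambda>x. bump e (x - z)) has_derivative (\<lambda>h. bump_grad e (x - z) \<bullet> h)) (at x)" .
  from frechet_derivative_at[OF this] show ?thesis
    by (simp add: partial_dir_def fun_eq_iff)
qed

subsection \<open>A relative isoperimetric inequality for truncations\<close>

text \<open>On the ball of radius \<rho>/2^n the kernel, frozen at half that radius, contributes a
  multiple of \<rho>/2^n, and these contributions form a geometric series. Dyadic balls take the
  place of polar coordinates.\<close>

lemma kernel_ball_integral:
  fixes z :: "'a::euclidean_space"
  assumes \<rho>: "0 < \<rho>"
  shows "(\<integral>\<^sup>+x. ennreal (norm (x - z) powr (1 - real DIM('a))) * indicator (ball z \<rho>) x \<partial>lborel)
    \<le> ennreal (2 ^ DIM('a) * unit_ball_vol DIM('a) * \<rho>)"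
proof -
  define N where "N = DIM('a)"
  have N: "N \<ge> 1" unfolding N_def using DIM_positive[where 'a='a] by simp
  \<comment> \<open>The kernel at the inner radius of the n-th dyadic shell, which is its maximum
    there because 1 - N <= 0.\<close>
  define c where "c n = (\<rho> * (1/2) ^ Suc n) powr (1 - real N)" for n
  have pw: "ennreal (norm (x - z) powr (1 - real N)) * indicator (ball z \<rho>) x
     \<le> (\<Sum>n. ennreal (c n) * indicator (ball z (\<rho> * (1/2) ^ n)) x)" for x
  \<comment> \<open>At x = z the left side is 0, because \<open>0 powr s = 0\<close> even for s =
    0.\<close>
  proof (cases "x \<in> ball z \<rho> \<and> x \<noteq> z")
    case True
    define s where "s = norm (x - z)"
    have s: "0 < s" "s < \<rho>" using True by (auto simp: s_def dist_norm norm_minus_commute)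
    define n where "n = (LEAST n. \<rho> * (1/2) ^ n \<le> s)"
    obtain n0 where "(1/2::real) ^ n0 < s / \<rho>"
      using real_arch_pow_inv[of "s / \<rho>" "1/2"] s \<rho> by auto
    then have "\<rho> * (1/2) ^ n0 \<le> s" using \<rho> by (simp add: field_simps)
    then have n1: "\<rho> * (1/2) ^ n \<le> s" unfolding n_def by (rule LeastI)
    have "n \<noteq> 0" using n1 s by (auto intro: ccontr)
    then obtain k where k: "n = Suc k" by (cases n) auto
    have n2: "s < \<rho> * (1/2) ^ k"
      using not_less_Least[of k "\<lambda>n. \<rho> * (1/2) ^ n \<le> s"] k unfolding n_def by auto
    have "s powr (1 - real N) \<le> c k"
      unfolding c_def using n1 k \<rho> N by (intro powr_mono2') auto
    then have "ennreal (s powr (1 - real N)) * indicator (ball z \<rho>) x \<le> ennreal (c k) * indicator (ball z (\<rho> * (1/2) ^ k)) x"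
      using True n2 by (auto simp: indicator_def s_def dist_norm norm_minus_commute intro!: ennreal_leI)
    also have "\<dots> = (\<Sum>n\<in>{k}. ennreal (c n) * indicator (ball z (\<rho> * (1/2) ^ n)) x)"
      by (subst sum.insert) simp_all
    also have "\<dots> \<le> (\<Sum>n. ennreal (c n) * indicator (ball z (\<rho> * (1/2) ^ n)) x)"
      by (intro sum_le_suminf) auto
    finally show ?thesis by (simp add: s_def)
  qed (auto simp: indicator_def)
  have half: "(\<Sum>n. ennreal ((1/2) ^ n)) = ennreal 2"
  proof (subst suminf_ennreal2)
    show "summable (\<lambda>n. (1/2::real) ^ n)" by (rule summable_geometric) simp
    show "ennreal (\<Sum>n. (1/2) ^ n) = ennreal 2" by (subst suminf_geometric) simp_all
  qed simp
  have "(\<integral>\<^sup>+x. ennreal (norm (x - z) powr (1 - real N)) * indicator (ball z \<rho>) x \<partial>lborel)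
     \<le> (\<integral>\<^sup>+x. (\<Sum>n. ennreal (c n) * indicator (ball z (\<rho> * (1/2) ^ n)) x) \<partial>lborel)"
    by (intro nn_integral_mono pw)
  also have "\<dots> = (\<Sum>n. ennreal (c n) * emeasure lborel (ball z (\<rho> * (1/2) ^ n)))"
  proof (subst nn_integral_suminf)
    have [measurable]: "ball z s \<in> sets borel" for s by simp
    show "(\<lambda>x. ennreal (c n) * indicator (ball z (\<rho> * (1/2) ^ n)) x) \<in> borel_measurable lborel" for n
      by measurable
  qed (simp add: nn_integral_cmult_indicator)
  also have "\<dots> = (\<Sum>n. ennreal (2 ^ (N - 1) * unit_ball_vol N * \<rho>) * ennreal ((1/2) ^ n))"
  proof (intro suminf_cong)
    fix n
    let ?s = "\<rho> * (1/2) ^ n"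
    have s: "?s > 0" using \<rho> by simp
    have "c n = (?s / 2) powr (1 - real N)" by (simp add: c_def)
    also have "\<dots> = ?s powr (1 - real N) * 2 powr (real N - 1)"
      using s by (simp add: powr_divide powr_diff)
    also have "2 powr (real N - 1) = (2::real) ^ (N - 1)"
      using N by (simp add: powr_realpow[symmetric] of_nat_diff)
    also have "?s powr (1 - real N) * 2 ^ (N - 1) * (unit_ball_vol N * ?s ^ N) = 2 ^ (N - 1) * unit_ball_vol N * ?s"
      using s by (simp add: powr_diff powr_realpow)
    finally have "c n * (unit_ball_vol N * ?s ^ N) = 2 ^ (N - 1) * unit_ball_vol N * \<rho> * (1/2) ^ n"
      by (simp add: algebra_simps)
    then show "ennreal (c n) * emeasure lborel (ball z ?s) = ennreal (2 ^ (N - 1) * unit_ball_vol N * \<rho>) * ennreal ((1/2) ^ n)"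
      using s \<rho> by (subst emeasure_ball) (auto simp: N_def[symmetric] c_def ennreal_mult[symmetric])
  qed
  also have "\<dots> = ennreal (2 ^ (N - 1) * unit_ball_vol N * \<rho>) * ennreal 2"
    by (subst ennreal_suminf_cmult) (simp only: half)
  also have "\<dots> = ennreal (2 ^ (N - 1) * unit_ball_vol N * \<rho> * 2)"
    using \<rho> by (intro ennreal_mult[symmetric]) auto
  also have "2 ^ (N - 1) * unit_ball_vol N * \<rho> * 2 = 2 ^ N * unit_ball_vol N * \<rho>"
    using N by (cases N) auto
  finally show ?thesis by (simp add: N_def)
qed

text \<open>The first summand comes from the ball of radius |E|^(1/N), the 1 from the part of E
  outside that ball.\<close>

definition kernel_const :: "'a::euclidean_space itself \<Rightarrow> real" where
  "kernel_const _ = 2 ^ DIM('a) * unit_ball_vol DIM('a) + 1"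

text \<open>Split at the radius \<rho> with \<rho>^N = |E|. Inside, the ball integral is of order
  \<rho>; outside, the kernel is at most \<rho>^(1-N), and \<rho>^(1-N) |E| = \<rho>.\<close>

lemma kernel_integral:
  fixes z :: "'a::euclidean_space"
  assumes E: "E \<in> sets borel" "emeasure lborel E < \<infinity>"
  shows "(\<integral>\<^sup>+x. ennreal (norm (x - z) powr (1 - real DIM('a))) * indicator E x \<partial>lborel)
    \<le> ennreal (kernel_const TYPE('a) * measure lborel E powr (1 / real DIM('a)))"
proof (cases "measure lborel E = 0")
  case True
  then have "emeasure lborel E = 0" using E by (simp add: emeasure_eq_ennreal_measure top.not_eq_extremum)
  then have "E \<in> null_sets lborel" using E by (auto simp: null_sets_def)
  then have "AE x in lborel. x \<notin> E" by (rule AE_not_in)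
  then have "(\<integral>\<^sup>+x. ennreal (norm (x - z) powr (1 - real DIM('a))) * indicator E x \<partial>lborel) = (\<integral>\<^sup>+x. 0 \<partial>(lborel :: 'a measure))"
    by (intro nn_integral_cong_AE) (auto simp: indicator_def)
  then show ?thesis by simp
next
  case False
  define N where "N = real DIM('a)"
  have N: "N \<ge> 1" unfolding N_def using DIM_positive[where 'a='a] by (metis One_nat_def Suc_leI of_nat_mono of_nat_1)
  define m where "m = measure lborel E"
  have m: "m > 0" using False by (simp add: m_def zero_less_measure_iff)
  define \<rho> where "\<rho> = m powr (1 / N)"
  have \<rho>: "\<rho> > 0" using m by (simp add: \<rho>_def)
  have [measurable]: "E \<in> sets borel" "ball z \<rho> \<in> sets borel" using E by simp_all
  have pw: "ennreal (norm (x - z) powr (1 - N)) * indicator E x \<le>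
      ennreal (norm (x - z) powr (1 - N)) * indicator (ball z \<rho>) x + ennreal (\<rho> powr (1 - N)) * indicator E x" for x
  proof (cases "x \<in> ball z \<rho>")
    case False
    then have "norm (x - z) powr (1 - N) \<le> \<rho> powr (1 - N)"
      using \<rho> N by (intro powr_mono2') (auto simp: dist_norm norm_minus_commute)
    then show ?thesis using False by (auto simp: indicator_def)
  qed (auto simp: indicator_def)
  have "(\<integral>\<^sup>+x. ennreal (norm (x - z) powr (1 - N)) * indicator E x \<partial>lborel) \<le>
    (\<integral>\<^sup>+x. ennreal (norm (x - z) powr (1 - N)) * indicator (ball z \<rho>) x + ennreal (\<rho> powr (1 - N)) * indicator E x \<partial>lborel)"
    by (intro nn_integral_mono pw)
  also have "\<dots> = (\<integral>\<^sup>+x. ennreal (norm (x - z) powr (1 - N)) * indicator (ball z \<rho>) x \<partial>lborel)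
      + ennreal (\<rho> powr (1 - N)) * emeasure lborel E"
    by (subst nn_integral_add) (measurable, simp add: nn_integral_cmult_indicator)
  also have "\<dots> \<le> ennreal (2 ^ DIM('a) * unit_ball_vol DIM('a) * \<rho>) + ennreal (\<rho> powr (1 - N)) * ennreal m"
    using kernel_ball_integral[OF \<rho>, of z] E
    by (intro add_mono) (auto simp: N_def m_def emeasure_eq_ennreal_measure top.not_eq_extremum)
  also have "\<rho> powr (1 - N) * m = \<rho>"
  proof -
    have "m = \<rho> powr N" using N m by (simp add: \<rho>_def powr_powr)
    then have "\<rho> powr (1 - N) * m = \<rho> powr (1 - N) * \<rho> powr N" by simp
    also have "\<dots> = \<rho>" using \<rho> by (simp flip: powr_add)
    finally show ?thesis .
  qed
  then have "ennreal (\<rho> powr (1 - N)) * ennreal m = ennreal \<rho>"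
    using m by (simp add: ennreal_mult[symmetric])
  also have "ennreal (2 ^ DIM('a) * unit_ball_vol DIM('a) * \<rho>) + ennreal \<rho> = ennreal (kernel_const TYPE('a) * \<rho>)"
    using \<rho> by (simp add: kernel_const_def ennreal_plus[symmetric] algebra_simps del: ennreal_plus)
  finally show ?thesis by (simp add: N_def \<rho>_def m_def)
qed

section \<open>Averages of line integrals over a ball\<close>

lemma nn_integral_lborel_affine:
  fixes t :: "'a::euclidean_space"
  assumes f: "f \<in> borel_measurable borel" and c: "c > 0"
  shows "(\<integral>\<^sup>+y. f (t + c *\<^sub>R y) \<partial>lborel) = ennreal (1 / c ^ DIM('a)) * (\<integral>\<^sup>+x. f x \<partial>lborel)"
proof -
  have "(\<integral>\<^sup>+x. f x \<partial>lborel) = (\<integral>\<^sup>+x. f x \<partial>density (distr lborel borel (\<lambda>x. t + c *\<^sub>R x)) (\<lambda>_. \<bar>c\<bar>^DIM('a)))"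
    using lborel_affine[of c t] c by simp
  also have "\<dots> = ennreal (c ^ DIM('a)) * (\<integral>\<^sup>+y. f (t + c *\<^sub>R y) \<partial>lborel)"
    using c f by (simp add: nn_integral_density nn_integral_distr nn_integral_cmult)
  finally have "ennreal (1 / c ^ DIM('a)) * (\<integral>\<^sup>+x. f x \<partial>lborel) =
     ennreal (1 / c ^ DIM('a)) * ennreal (c ^ DIM('a)) * (\<integral>\<^sup>+y. f (t + c *\<^sub>R y) \<partial>lborel)"
    by (simp add: mult.assoc)
  also have "ennreal (1 / c ^ DIM('a)) * ennreal (c ^ DIM('a)) = 1"
    using c by (simp add: ennreal_mult[symmetric])
  finally show ?thesis by simp
qed

lemma nn_integral_powr_tail:
  assumes s: "s > 0" and N: "N > (0::nat)"
  shows "(\<integral>\<^sup>+t. ennreal (1 / t ^ (N + 1)) * indicator {s..} t \<partial>lborel) = ennreal (1 / (real N * s ^ N))"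
proof -
  have "(\<integral>\<^sup>+t. ennreal (1 / t ^ (N + 1)) * indicator {s..} t \<partial>lborel) = ennreal (0 - (- 1 / (real N * s ^ N)))"
  proof (rule nn_integral_FTC_atLeast)
    fix x assume "s \<le> x"
    then have x: "x > 0" using s by simp
    have "((\<lambda>x. - (1 / real N) * inverse x ^ N) has_real_derivative
        - (1 / real N) * (real N * inverse x ^ (N - 1) * - (inverse x ^ 2))) (at x)"
      using x N by (auto intro!: derivative_eq_intros simp: numeral_2_eq_2)
    also have "- (1 / real N) * (real N * inverse x ^ (N - 1) * - (inverse x ^ 2)) = inverse x ^ (N - 1) * inverse x ^ 2"
      using N by simp
    also have "\<dots> = 1 / x ^ (N + 1)"
      using x N by (cases N) (auto simp: power2_eq_square field_simps)
    finally show "((\<lambda>x. - 1 / (real N * x ^ N)) has_real_derivative 1 / x ^ (N + 1)) (at x)"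
      by (simp add: divide_inverse power_inverse)
    show "0 \<le> 1 / x ^ (N + 1)" using x by simp
  next
    have "((\<lambda>x. - 1 / real N * inverse (x ^ N)) \<longlongrightarrow> - 1 / real N * 0) at_top"
      using N by (intro tendsto_mult tendsto_const tendsto_inverse_0_at_top filterlim_pow_at_top filterlim_ident) auto
    then show "((\<lambda>x. - 1 / (real N * x ^ N)) \<longlongrightarrow> 0) at_top"
      by (simp add: divide_inverse)
  qed auto
  then show ?thesis by simp
qed

text \<open>For fixed t substitute z = x + t(y-x), so that dy = t^(-N) dz and |y-x| = |z-x|/t. Since
  |y-x| <= 2\<rho>, only t >= |z-x|/(2\<rho>) remains for given z, and integrating t^(-N-1) over
  this range produces the Riesz kernel |z-x|^(1-N).\<close>

lemma segment_average_le:
  fixes h :: "'a::euclidean_space \<Rightarrow> ennreal"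
  assumes h[measurable]: "h \<in> borel_measurable borel" and x: "x \<in> ball c \<rho>"
  shows "(\<integral>\<^sup>+y. (\<integral>\<^sup>+t. h (x + t *\<^sub>R (y - x)) * ennreal (norm (y - x)) * indicator {0..1} t \<partial>lborel) * indicator (ball c \<rho>) y \<partial>lborel)
    \<le> (\<integral>\<^sup>+z. h z * indicator (ball c \<rho>) z * ennreal ((2 * \<rho>) ^ DIM('a) / DIM('a) * norm (z - x) powr (1 - real DIM('a))) \<partial>lborel)"
proof -
  let ?B = "ball c \<rho>" and ?N = "DIM('a)"
  have \<rho>: "\<rho> > 0" using x by (simp add: order.strict_trans1[OF zero_le_dist])
  \<comment> \<open>The integrand in the variable z. The last factor remembers |y-x| <= 2\<rho>;
    without it the integral in t would diverge at 0.\<close>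
  define H where "H t z = h z * indicator ?B z * ennreal (norm (z - x) / t) * (if norm (z - x) \<le> 2 * \<rho> * t then 1 else 0)" for t z
  have [measurable]: "?B \<in> sets borel" by simp
  have Hm[measurable]: "case_prod H \<in> borel_measurable (borel \<Otimes>\<^sub>M borel)"
    unfolding H_def by measurable
  have "(\<integral>\<^sup>+y. (\<integral>\<^sup>+t. h (x + t *\<^sub>R (y - x)) * ennreal (norm (y - x)) * indicator {0..1} t \<partial>lborel) * indicator ?B y \<partial>lborel)
     = (\<integral>\<^sup>+y. (\<integral>\<^sup>+t. h (x + t *\<^sub>R (y - x)) * ennreal (norm (y - x)) * indicator {0..1} t * indicator ?B y \<partial>lborel) \<partial>lborel)"
    by (intro nn_integral_cong nn_integral_multc[symmetric]) measurable
  also have "\<dots> = (\<integral>\<^sup>+t. (\<integral>\<^sup>+y. h (x + t *\<^sub>R (y - x)) * ennreal (norm (y - x)) * indicator {0..1} t * indicator ?B y \<partial>lborel) \<partial>lborel)"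
    by (rule lborel_pair.Fubini'[symmetric]) measurable
  also have "\<dots> \<le> (\<integral>\<^sup>+t. ennreal (1 / t ^ ?N) * indicator {0<..} t * (\<integral>\<^sup>+z. H t z \<partial>lborel) \<partial>lborel)"
  proof (intro nn_integral_mono_AE)
    have "AE t in lborel. t \<noteq> (0::real)" by (rule AE_lborel_singleton)
    then show "AE t in lborel. (\<integral>\<^sup>+y. h (x + t *\<^sub>R (y - x)) * ennreal (norm (y - x)) * indicator {0..1} t * indicator ?B y \<partial>lborel)
       \<le> ennreal (1 / t ^ ?N) * indicator {0<..} t * (\<integral>\<^sup>+z. H t z \<partial>lborel)"
    proof (rule AE_mp, intro AE_I2 impI)
      fix t :: real assume t0: "t \<noteq> 0"
      show "(\<integral>\<^sup>+y. h (x + t *\<^sub>R (y - x)) * ennreal (norm (y - x)) * indicator {0..1} t * indicator ?B y \<partial>lborel)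
       \<le> ennreal (1 / t ^ ?N) * indicator {0<..} t * (\<integral>\<^sup>+z. H t z \<partial>lborel)"
      proof (cases "0 < t \<and> t \<le> 1")
        case True
        have "(\<integral>\<^sup>+y. h (x + t *\<^sub>R (y - x)) * ennreal (norm (y - x)) * indicator {0..1} t * indicator ?B y \<partial>lborel)
           \<le> (\<integral>\<^sup>+y. H t ((x - t *\<^sub>R x) + t *\<^sub>R y) \<partial>lborel)"
        proof (intro nn_integral_mono)
          fix y
          have e: "(x - t *\<^sub>R x) + t *\<^sub>R y = x + t *\<^sub>R (y - x)" by (simp add: algebra_simps)
          have n: "norm (x + t *\<^sub>R (y - x) - x) = t * norm (y - x)" using True by simp
          show "h (x + t *\<^sub>R (y - x)) * ennreal (norm (y - x)) * indicator {0..1} t * indicator ?B y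
             \<le> H t ((x - t *\<^sub>R x) + t *\<^sub>R y)"
          proof (cases "y \<in> ?B")
            case y: True
            have "(1 - t) *\<^sub>R x + t *\<^sub>R y \<in> ?B"
              using True x y convex_ball[of c \<rho>] by (intro convexD_alt) auto
            then have b: "x + t *\<^sub>R (y - x) \<in> ?B" by (simp add: algebra_simps)
            have "dist y x \<le> dist c y + dist c x" by (metis dist_commute dist_triangle)
            also have "\<dots> \<le> 2 * \<rho>" using x y by simp
            finally have "t * norm (y - x) \<le> 2 * \<rho> * t" using True by (simp add: dist_norm mult.commute)
            then show ?thesis using b True y unfolding e H_def n by simp
          qed simp
        qed
        also have "\<dots> = ennreal (1 / t ^ ?N) * (\<integral>\<^sup>+z. H t z \<partial>lborel)"
          using True by (intro nn_integral_lborel_affine) auto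
        finally show ?thesis using True by simp
      qed (use t0 in auto)
    qed
  qed
  also have "\<dots> = (\<integral>\<^sup>+t. (\<integral>\<^sup>+z. ennreal (1 / t ^ ?N) * indicator {0<..} t * H t z \<partial>lborel) \<partial>lborel)"
    by (intro nn_integral_cong nn_integral_cmult[symmetric]) measurable
  also have "\<dots> = (\<integral>\<^sup>+z. (\<integral>\<^sup>+t. ennreal (1 / t ^ ?N) * indicator {0<..} t * H t z \<partial>lborel) \<partial>lborel)"
    by (rule lborel_pair.Fubini'[symmetric]) measurable
  also have "\<dots> \<le> (\<integral>\<^sup>+z. h z * indicator ?B z * ennreal ((2 * \<rho>) ^ ?N / ?N * norm (z - x) powr (1 - real ?N)) \<partial>lborel)"
  proof (intro nn_integral_mono)
    fix z
    define s where "s = norm (z - x) / (2 * \<rho>)"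
    show "(\<integral>\<^sup>+t. ennreal (1 / t ^ ?N) * indicator {0<..} t * H t z \<partial>lborel)
       \<le> h z * indicator ?B z * ennreal ((2 * \<rho>) ^ ?N / ?N * norm (z - x) powr (1 - real ?N))"
    \<comment> \<open>For z = x the factor |z-x| makes \<open>H\<close> vanish, so the threshold s
      may be taken positive.\<close>
    proof (cases "z = x")
      case False
      then have s: "s > 0" using \<rho> by (simp add: s_def)
      have "(\<integral>\<^sup>+t. ennreal (1 / t ^ ?N) * indicator {0<..} t * H t z \<partial>lborel) \<le>
         (\<integral>\<^sup>+t. (h z * indicator ?B z * ennreal (norm (z - x))) * (ennreal (1 / t ^ (?N + 1)) * indicator {s..} t) \<partial>lborel)"
      proof (intro nn_integral_mono)
        fix t :: real
        show "ennreal (1 / t ^ ?N) * indicator {0<..} t * H t z \<le>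
          (h z * indicator ?B z * ennreal (norm (z - x))) * (ennreal (1 / t ^ (?N + 1)) * indicator {s..} t)"
        proof (cases "0 < t \<and> s \<le> t")
          case True
          have "ennreal (1 / t ^ ?N) * ennreal (norm (z - x) / t) = ennreal (norm (z - x)) * ennreal (1 / t ^ (?N + 1))"
            using True by (simp add: ennreal_mult[symmetric] field_simps)
          moreover have "norm (z - x) \<le> 2 * \<rho> * t" using True \<rho> by (simp add: s_def field_simps)
          ultimately show ?thesis using True by (simp add: H_def mult_ac)
        next
          case False
          then have "t \<le> 0 \<or> \<not> norm (z - x) \<le> 2 * \<rho> * t" using \<rho> by (auto simp: s_def field_simps)
          then show ?thesis by (auto simp: H_def)
        qed
      qed
      also have "\<dots> = (h z * indicator ?B z * ennreal (norm (z - x))) * ennreal (1 / (real ?N * s ^ ?N))"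
        using s by (subst nn_integral_cmult) (auto simp: nn_integral_powr_tail[simplified])
      also have "\<dots> = h z * indicator ?B z * ennreal (norm (z - x) * (1 / (real ?N * s ^ ?N)))"
        using s by (simp add: ennreal_mult[symmetric] mult.assoc)
      also have "norm (z - x) * (1 / (real ?N * s ^ ?N)) = (2 * \<rho>) ^ ?N / ?N * norm (z - x) powr (1 - real ?N)"
        using False by (simp add: s_def powr_diff powr_realpow power_divide)
      finally show ?thesis .
    qed (simp add: H_def)
  qed
  finally show ?thesis .
qed

section \<open>A continuously differentiable truncation\<close>

definition ramp_sq :: "real \<Rightarrow> real" where
  "ramp_sq s = (max 0 s)\<^sup>2"

lemma DERIV_ramp_sq: "(ramp_sq has_real_derivative 2 * max 0 s) (at s)"
proof -
  consider "s > 0" | "s < 0" | "s = 0" by linarith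
  then show ?thesis
  proof cases
    case 1
    have "((\<lambda>s. s\<^sup>2) has_real_derivative 2 * max 0 s) (at s)"
      using 1 by (auto intro!: derivative_eq_intros)
    then show ?thesis
      by (rule has_field_derivative_transform_within_open[where S="{0<..}"]) (use 1 in \<open>auto simp: ramp_sq_def\<close>)
  next
    case 2
    have "((\<lambda>s. 0) has_real_derivative 2 * max 0 s) (at s)" using 2 by simp
    then show ?thesis
      by (rule has_field_derivative_transform_within_open[where S="{..<0}"]) (use 2 in \<open>auto simp: ramp_sq_def\<close>)
  next
    case 3
    have "(\<lambda>h. (ramp_sq h - ramp_sq 0) / (h - 0)) \<midarrow>0\<rightarrow> 0"
    proof (rule Lim_null_comparison[where g="\<lambda>h. \<bar>h\<bar>"])
      show "\<forall>\<^sub>F h in at 0. norm ((ramp_sq h - ramp_sq 0) / (h - 0)) \<le> \<bar>h\<bar>"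
        by (rule always_eventually) (auto simp: ramp_sq_def max_def power2_eq_square)
      show "((\<lambda>h. \<bar>h\<bar>) \<longlongrightarrow> 0) (at (0::real))" by (auto intro!: tendsto_eq_intros)
    qed
    then show ?thesis using 3 by (simp add: has_field_derivative_iff)
  qed
qed

text \<open>Truncating with this step rather than with a piecewise linear one keeps \<open>C\<^sup>1\<close> functions \<open>C\<^sup>1\<close>.\<close>
definition step :: "real \<Rightarrow> real" where
  "step s = 2 * (ramp_sq s - 2 * ramp_sq (s - 1/2) + ramp_sq (s - 1))"

definition step' :: "real \<Rightarrow> real" where
  "step' s = 4 * (max 0 s - 2 * max 0 (s - 1/2) + max 0 (s - 1))"

lemma DERIV_step: "(step has_real_derivative step' s) (at s)"
proof -
  have D: "((\<lambda>s. ramp_sq (s - a)) has_real_derivative 2 * max 0 (s - a)) (at s)" for a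
  proof -
    have "((\<lambda>s. s - a) has_real_derivative 1) (at s)" by (auto intro!: derivative_eq_intros)
    from DERIV_chain2[OF DERIV_ramp_sq this] show ?thesis by simp
  qed
  show ?thesis unfolding step_def[abs_def] step'_def
    by (auto intro!: derivative_eq_intros D DERIV_ramp_sq)
qed

lemma step_le_0: "s \<le> 0 \<Longrightarrow> step s = 0"
  by (simp add: step_def ramp_sq_def)

lemma step_ge_1: "1 \<le> s \<Longrightarrow> step s = 1"
  by (simp add: step_def ramp_sq_def max_def power2_eq_square algebra_simps)

text \<open>The derivative is a tent of height 2. Its confinement to the open unit interval matters:
  it places the gradient in the open band l < v < 2l, and the bands of consecutive dyadic levels are
  disjoint.\<close>

lemma abs_step'_le: "\<bar>step' s\<bar> \<le> (if 0 < s \<and> s < 1 then 2 else 0)"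
  by (auto simp: step'_def max_def)

lemma continuous_on_step': "continuous_on S step'"
  unfolding step'_def[abs_def] by (intro continuous_intros)

text \<open>Along the segment the truncation of v falls from l to 0, and its derivative vanishes
  wherever v is outside the band. The factor 2 is the maximal slope of \<open>step\<close>.\<close>

lemma level_gap_le_segment_integral:
  fixes v :: "'a::euclidean_space \<Rightarrow> real" and D :: "'a \<Rightarrow> 'a"
  assumes der: "\<And>x. (v has_derivative (\<lambda>h. D x \<bullet> h)) (at x)" and cont: "continuous_on UNIV D"
    and l: "0 < l" and x: "2 * l \<le> v x" and y: "v y \<le> l"
  shows "ennreal l \<le> (\<integral>\<^sup>+t. ennreal (2 * norm (D (x + t *\<^sub>R (y - x)))) * indicator {z. l < v z \<and> v z < 2 * l} (x + t *\<^sub>R (y - x))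
       * ennreal (norm (y - x)) * indicator {0..1} t \<partial>lborel)"
proof -
  define P where "P t = x + t *\<^sub>R (y - x)" for t
  define \<phi> where "\<phi> t = l * step ((v (P t) - l) / l)" for t
  define \<phi>' where "\<phi>' t = step' ((v (P t) - l) / l) * (D (P t) \<bullet> (y - x))" for t
  have vc: "continuous_on UNIV v"
    using der by (meson continuous_at_imp_continuous_on has_derivative_continuous)
  have Pc: "continuous_on S P" for S unfolding P_def by (intro continuous_intros)
  have der\<phi>: "(\<phi> has_real_derivative \<phi>' t) (at t)" for t
  proof -
    have "((\<lambda>t. v (P t)) has_derivative (\<lambda>s. D (P t) \<bullet> (s *\<^sub>R (y - x)))) (at t)"
      by (rule has_derivative_compose[OF _ der]) (auto simp: P_def intro!: derivative_eq_intros)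
    then have 1: "((\<lambda>t. v (P t)) has_real_derivative D (P t) \<bullet> (y - x)) (at t)"
      by (rule has_derivative_imp_has_field_derivative) simp
    have 2: "((\<lambda>t. (v (P t) - l) / l) has_real_derivative (D (P t) \<bullet> (y - x)) / l) (at t)"
      using l by (auto intro!: derivative_eq_intros 1)
    show ?thesis unfolding \<phi>_def[abs_def] \<phi>'_def
      using l by (auto intro!: derivative_eq_intros DERIV_chain2[OF DERIV_step 2])
  qed
  have c\<phi>': "continuous_on {0..1} \<phi>'"
  proof -
    have 1: "continuous_on {0..1} (\<lambda>t. v (P t))" "continuous_on {0..1} (\<lambda>t. D (P t))"
      by (rule continuous_on_compose2[OF vc Pc], simp, rule continuous_on_compose2[OF cont Pc], simp)
    have 2: "continuous_on {0..1} (\<lambda>t. (v (P t) - l) / l)"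
      using l by (intro continuous_intros 1) auto
    show ?thesis unfolding \<phi>'_def
      by (intro continuous_on_mult continuous_on_compose2[OF continuous_on_step'[of UNIV] 2]
         continuous_on_inner 1 continuous_on_const) auto
  qed
  have int: "integrable lborel (\<lambda>t. indicator {0..1} t *\<^sub>R \<phi>' t)"
    using borel_integrable_atLeastAtMost'[OF c\<phi>'] by (simp add: set_integrable_def)
  have eq: "integral\<^sup>L lborel (\<lambda>t. indicator {0..1} t *\<^sub>R \<phi>' t) = \<phi> 1 - \<phi> 0"
    using der\<phi> c\<phi>' by (intro integral_FTC_atLeastAtMost)
      (auto simp: has_real_derivative_iff_has_vector_derivative intro: has_vector_derivative_at_within)
  have "\<phi> 0 = l" "\<phi> 1 = 0"
    using l x y by (auto simp: \<phi>_def P_def step_le_0 step_ge_1 divide_le_0_iff pos_le_divide_eq)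
  then have "ennreal l = ennreal (norm (integral\<^sup>L lborel (\<lambda>t. indicator {0..1} t *\<^sub>R \<phi>' t)))"
    using eq l by simp
  also have "\<dots> \<le> (\<integral>\<^sup>+t. ennreal (norm (indicator {0..1} t *\<^sub>R \<phi>' t)) \<partial>lborel)"
    by (rule integral_norm_bound_ennreal[OF int])
  also have "\<dots> \<le> (\<integral>\<^sup>+t. ennreal (2 * norm (D (P t))) * indicator {z. l < v z \<and> v z < 2 * l} (P t)
       * ennreal (norm (y - x)) * indicator {0..1} t \<partial>lborel)"
  proof (intro nn_integral_mono)
    fix t :: real
    have "\<bar>\<phi>' t\<bar> \<le> (if l < v (P t) \<and> v (P t) < 2 * l then 2 else 0) * (norm (D (P t)) * norm (y - x))"
      unfolding \<phi>'_def abs_mult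
    proof (rule mult_mono)
      show "\<bar>step' ((v (P t) - l) / l)\<bar> \<le> (if l < v (P t) \<and> v (P t) < 2 * l then 2 else 0)"
        using abs_step'_le[of "(v (P t) - l) / l"] l by (auto simp: field_simps split: if_splits)
    qed (auto simp: Cauchy_Schwarz_ineq2)
    then show "ennreal (norm (indicator {0..1} t *\<^sub>R \<phi>' t)) \<le> ennreal (2 * norm (D (P t))) * indicator {z. l < v z \<and> v z < 2 * l} (P t)
       * ennreal (norm (y - x)) * indicator {0..1} t"
      by (auto simp: indicator_def ennreal_mult[symmetric] mult_ac intro!: ennreal_leI split: if_splits)
  qed
  finally show ?thesis by (simp add: P_def)
qed

text \<open>One factor 2 is the slope of \<open>step\<close>, another arises because the set v <= 0
  need only fill half of the ball, and 2^N/N divided by the unit ball volume is the averaging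
  constant (2\<rho>)^N/N relative to the volume of the ball.\<close>

definition iso_const :: "'a::euclidean_space itself \<Rightarrow> real" where
  "iso_const T = 2 ^ (DIM('a) + 2) / (DIM('a) * unit_ball_vol DIM('a)) * kernel_const T"

lemma iso_const_pos: "iso_const TYPE('a::euclidean_space) > 0"
proof -
  have "kernel_const TYPE('a) > 0" unfolding kernel_const_def by (intro add_nonneg_pos) auto
  then show ?thesis by (simp add: iso_const_def)
qed

text \<open>In dimension one the exponent on the left is 0; since \<open>0 powr 0 = 0\<close>, the statement is then
  trivial for null superlevel sets, as it should be.\<close>
lemma truncation_isoperimetric:
  fixes v :: "'a::euclidean_space \<Rightarrow> real" and D :: "'a \<Rightarrow> 'a"
  assumes der: "\<And>x. (v has_derivative (\<lambda>h. D x \<bullet> h)) (at x)" and cont: "continuous_on UNIV D"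
    and l: "0 < l" and \<rho>: "0 < \<rho>"
    and half: "measure lborel (ball c \<rho>) \<le> 2 * measure lborel {x\<in>ball c \<rho>. v x \<le> 0}"
  shows "ennreal (l * measure lborel {x\<in>ball c \<rho>. 2 * l \<le> v x} powr (1 - 1 / real DIM('a)))
    \<le> ennreal (iso_const TYPE('a)) * (\<integral>\<^sup>+x. ennreal (norm (D x)) * indicator {x\<in>ball c \<rho>. l < v x \<and> v x < 2 * l} x \<partial>lborel)"
proof -
  let ?N = "DIM('a)" and ?B = "ball c \<rho>"
  define E where "E = {x\<in>?B. 2 * l \<le> v x}"
  define F where "F = {x\<in>?B. v x \<le> 0}"
  define h where "h z = ennreal (2 * norm (D z)) * indicator {z. l < v z \<and> v z < 2 * l} z" for z
  have vc: "continuous_on UNIV v"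
    using der by (meson continuous_at_imp_continuous_on has_derivative_continuous)
  have vm[measurable]: "v \<in> borel_measurable borel" and Dm[measurable]: "D \<in> borel_measurable borel"
    using vc cont by (auto intro: borel_measurable_continuous_onI)
  have [measurable]: "?B \<in> sets borel" by simp
  have Em[measurable]: "E \<in> sets borel" and Fm[measurable]: "F \<in> sets borel"
    unfolding E_def F_def by measurable
  have hm[measurable]: "h \<in> borel_measurable borel" unfolding h_def by measurable
  have Bfin: "emeasure lborel ?B < \<infinity>" using \<rho> by (simp add: emeasure_ball)
  have "emeasure lborel E \<le> emeasure lborel ?B" "emeasure lborel F \<le> emeasure lborel ?B"
    by (intro emeasure_mono; auto simp: E_def F_def)+
  then have Efin: "emeasure lborel E < \<infinity>" and Ffin: "emeasure lborel F < \<infinity>"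
    using Bfin by (auto intro: order.strict_trans1)
  define m where "m = measure lborel E"
  define V where "V = unit_ball_vol ?N"
  have V: "V > 0" by (simp add: V_def)
  have mB: "measure lborel ?B = V * \<rho> ^ ?N" using \<rho> by (simp add: content_ball V_def)
  define K where "K = (2 * \<rho>) ^ ?N / ?N"
  have K: "K > 0" using \<rho> by (simp add: K_def)
  \<comment> \<open>The gap bound is integrated over all pairs (x, y) in E x F, which puts |E| |F|
    on the left.\<close>
  have "ennreal (l * measure lborel F) * ennreal m = ennreal l * emeasure lborel F * emeasure lborel E"
    using l Efin Ffin by (simp add: m_def ennreal_mult emeasure_eq_ennreal_measure top.not_eq_extremum)
  also have "\<dots> = (\<integral>\<^sup>+x. (\<integral>\<^sup>+y. ennreal l * indicator F y \<partial>lborel) * indicator E x \<partial>lborel)"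
    by (simp add: nn_integral_cmult_indicator)
  also have "\<dots> \<le> (\<integral>\<^sup>+x. (\<integral>\<^sup>+y. (\<integral>\<^sup>+t. h (x + t *\<^sub>R (y - x)) * ennreal (norm (y - x)) * indicator {0..1} t \<partial>lborel)
      * indicator ?B y \<partial>lborel) * indicator E x \<partial>lborel)"
  proof (intro nn_integral_mono)
    fix x
    show "(\<integral>\<^sup>+y. ennreal l * indicator F y \<partial>lborel) * indicator E x \<le>
      (\<integral>\<^sup>+y. (\<integral>\<^sup>+t. h (x + t *\<^sub>R (y - x)) * ennreal (norm (y - x)) * indicator {0..1} t \<partial>lborel) * indicator ?B y \<partial>lborel) * indicator E x"
    proof (cases "x \<in> E")
      case True
      have "(\<integral>\<^sup>+y. ennreal l * indicator F y \<partial>lborel) \<le>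
        (\<integral>\<^sup>+y. (\<integral>\<^sup>+t. h (x + t *\<^sub>R (y - x)) * ennreal (norm (y - x)) * indicator {0..1} t \<partial>lborel) * indicator ?B y \<partial>lborel)"
      proof (intro nn_integral_mono)
        fix y
        show "ennreal l * indicator F y \<le>
          (\<integral>\<^sup>+t. h (x + t *\<^sub>R (y - x)) * ennreal (norm (y - x)) * indicator {0..1} t \<partial>lborel) * indicator ?B y"
        proof (cases "y \<in> F")
          case y: True
          have "ennreal l \<le> (\<integral>\<^sup>+t. h (x + t *\<^sub>R (y - x)) * ennreal (norm (y - x)) * indicator {0..1} t \<partial>lborel)"
            unfolding h_def
            by (rule level_gap_le_segment_integral[OF der cont l]) (use True y l in \<open>auto simp: E_def F_def\<close>)
          then show ?thesis using y by (simp add: F_def)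
        qed simp
      qed
      then show ?thesis using True by simp
    qed simp
  qed
  also have "\<dots> \<le> (\<integral>\<^sup>+x. (\<integral>\<^sup>+z. h z * indicator ?B z * ennreal (K * norm (z - x) powr (1 - real ?N)) * indicator E x \<partial>lborel) \<partial>lborel)"
  proof (intro nn_integral_mono)
    fix x
    show "(\<integral>\<^sup>+y. (\<integral>\<^sup>+t. h (x + t *\<^sub>R (y - x)) * ennreal (norm (y - x)) * indicator {0..1} t \<partial>lborel) * indicator ?B y \<partial>lborel) * indicator E x
      \<le> (\<integral>\<^sup>+z. h z * indicator ?B z * ennreal (K * norm (z - x) powr (1 - real ?N)) * indicator E x \<partial>lborel)"
      using segment_average_le[OF hm, of x c \<rho>] by (cases "x \<in> E") (auto simp: E_def K_def)
  qed
  \<comment> \<open>In the exchanged order the kernel is integrated over E first, for fixed z, which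
    yields |E|^(1/N).\<close>
  also have "\<dots> = (\<integral>\<^sup>+z. (\<integral>\<^sup>+x. h z * indicator ?B z * ennreal (K * norm (z - x) powr (1 - real ?N)) * indicator E x \<partial>lborel) \<partial>lborel)"
    by (rule lborel_pair.Fubini'[symmetric]) measurable
  also have "\<dots> \<le> (\<integral>\<^sup>+z. (h z * indicator ?B z) * ennreal (K * (kernel_const TYPE('a) * m powr (1 / real ?N))) \<partial>lborel)"
  proof (intro nn_integral_mono)
    fix z
    have "(\<integral>\<^sup>+x. h z * indicator ?B z * ennreal (K * norm (z - x) powr (1 - real ?N)) * indicator E x \<partial>lborel)
       = (\<integral>\<^sup>+x. (h z * indicator ?B z * ennreal K) * (ennreal (norm (x - z) powr (1 - real ?N)) * indicator E x) \<partial>lborel)"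
      using K by (intro nn_integral_cong) (simp add: ennreal_mult mult_ac norm_minus_commute)
    also have "\<dots> = (h z * indicator ?B z * ennreal K) * (\<integral>\<^sup>+x. ennreal (norm (x - z) powr (1 - real ?N)) * indicator E x \<partial>lborel)"
      by (rule nn_integral_cmult) measurable
    also have "\<dots> \<le> (h z * indicator ?B z * ennreal K) * ennreal (kernel_const TYPE('a) * m powr (1 / real ?N))"
      unfolding m_def by (intro mult_left_mono kernel_integral Em Efin) simp
    also have "\<dots> = (h z * indicator ?B z) * ennreal (K * (kernel_const TYPE('a) * m powr (1 / real ?N)))"
      using K by (simp add: ennreal_mult' mult_ac)
    finally show "(\<integral>\<^sup>+x. h z * indicator ?B z * ennreal (K * norm (z - x) powr (1 - real ?N)) * indicator E x \<partial>lborel)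
      \<le> (h z * indicator ?B z) * ennreal (K * (kernel_const TYPE('a) * m powr (1 / real ?N)))" .
  qed
  also have "\<dots> = (\<integral>\<^sup>+z. h z * indicator ?B z \<partial>lborel) * ennreal (K * (kernel_const TYPE('a) * m powr (1 / real ?N)))"
    by (rule nn_integral_multc) measurable
  also have "(\<integral>\<^sup>+z. h z * indicator ?B z \<partial>lborel) = 2 * (\<integral>\<^sup>+x. ennreal (norm (D x)) * indicator {x\<in>?B. l < v x \<and> v x < 2 * l} x \<partial>lborel)"
    by (subst nn_integral_cmult[symmetric], measurable, intro nn_integral_cong)
      (auto simp: h_def indicator_def ennreal_mult)
  finally have main: "ennreal (l * measure lborel F) * ennreal m \<le>
     2 * (\<integral>\<^sup>+x. ennreal (norm (D x)) * indicator {x\<in>?B. l < v x \<and> v x < 2 * l} x \<partial>lborel)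
      * ennreal (K * (kernel_const TYPE('a) * m powr (1 / real ?N)))" (is "_ \<le> 2 * ?I * _") .
  show ?thesis
  proof (cases "m = 0 \<or> ?I = \<infinity>")
    case True
    then show ?thesis
      using iso_const_pos[where 'a='a] by (auto simp: m_def E_def ennreal_mult_top)
  next
    case False
    then have m: "m > 0" by (simp add: m_def zero_less_measure_iff)
    obtain I where I: "?I = ennreal I" "I \<ge> 0" using False by (cases ?I) auto
    have kc: "kernel_const TYPE('a) > 0" unfolding kernel_const_def by (intro add_nonneg_pos) auto
    have "2 * ennreal I = ennreal (2 * I)" using I by (simp add: ennreal_mult)
    then have "ennreal (l * measure lborel F * m) \<le> ennreal (2 * I * (K * (kernel_const TYPE('a) * m powr (1 / real ?N))))"
      using main l K m kc I by (simp add: ennreal_mult[symmetric])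
    then have 1: "l * measure lborel F * m \<le> 2 * I * (K * (kernel_const TYPE('a) * m powr (1 / real ?N)))"
      using K kc I by (subst (asm) ennreal_le_iff) auto
    \<comment> \<open>F fills half of the ball, so \<rho>^N appears on both sides and cancels. The
      final constant does not depend on the radius.\<close>
    have "l * (V * \<rho> ^ ?N / 2) * m \<le> l * measure lborel F * m"
      using half l m by (intro mult_right_mono mult_left_mono) (auto simp: mB F_def)
    also note 1
    also have "2 * I * (K * (kernel_const TYPE('a) * m powr (1 / real ?N))) = \<rho> ^ ?N * (2 ^ (?N + 1) / ?N * kernel_const TYPE('a) * I * m powr (1 / real ?N))"
      by (simp add: K_def power_mult_distrib)
    also have "l * (V * \<rho> ^ ?N / 2) * m = \<rho> ^ ?N * (l * V / 2 * m)" by simp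
    finally have "\<rho> ^ ?N * (l * V / 2 * m) \<le> \<rho> ^ ?N * (2 ^ (?N + 1) / ?N * kernel_const TYPE('a) * I * m powr (1 / real ?N))" .
    then have "l * V / 2 * m \<le> 2 ^ (?N + 1) / ?N * kernel_const TYPE('a) * I * m powr (1 / real ?N)"
      by (rule mult_left_le_imp_le) (use \<rho> in simp)
    \<comment> \<open>Dividing by the m^(1/N) that came from the kernel leaves the isoperimetric
      power m^(1-1/N).\<close>
    moreover have meq: "m powr (1 - 1 / real ?N) * m powr (1 / real ?N) = m" using m by (simp flip: powr_add)
    ultimately have "l * V / 2 * m powr (1 - 1 / real ?N) * m powr (1 / real ?N)
        \<le> 2 ^ (?N + 1) / ?N * kernel_const TYPE('a) * I * m powr (1 / real ?N)"
      by (simp only: mult.assoc meq)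
    then have "l * V / 2 * m powr (1 - 1 / real ?N) \<le> 2 ^ (?N + 1) / ?N * kernel_const TYPE('a) * I"
      by (rule mult_right_le_imp_le) (use m in simp)
    then have "l * m powr (1 - 1 / real ?N) \<le> iso_const TYPE('a) * I"
      using V by (simp add: iso_const_def V_def[symmetric] field_simps)
    then show ?thesis using I iso_const_pos[where 'a='a]
      by (auto simp: m_def E_def ennreal_mult[symmetric] intro!: ennreal_leI)
  qed
qed

subsection \<open>The Gagliardo--Nirenberg inequality on balls\<close>

text \<open>The tangent line of x^p at A, rearranged. Its left side is linear in x, so it can be
  integrated against any weight.\<close>

lemma Young_tangent:
  fixes x A p :: real
  assumes "0 \<le> x" "0 \<le> A" "1 \<le> p"
  shows "x * A powr (p - 1) \<le> x powr p / p + (1 - 1 / p) * A powr p"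
proof (cases "p = 1")
  case True
  then show ?thesis using assms by (cases "A = 0") auto
next
  case False
  then have p: "p > 1" using assms by simp
  have "x * A powr (p - 1) \<le> x powr p / p + (A powr (p - 1)) powr (p / (p - 1)) / (p / (p - 1))"
    using p assms by (intro Youngs_inequality) (auto simp: field_simps)
  also have "(A powr (p - 1)) powr (p / (p - 1)) / (p / (p - 1)) = (1 - 1 / p) * A powr p"
  proof -
    have "(p - 1) * (p / (p - 1)) = p" "1 / (p / (p - 1)) = 1 - 1 / p" using p by (auto simp: field_simps)
    moreover have "(A powr (p - 1)) powr (p / (p - 1)) / (p / (p - 1)) = A powr ((p - 1) * (p / (p - 1))) * (1 / (p / (p - 1)))"
      by (simp only: powr_powr times_divide_eq_right mult_1_right)
    ultimately show ?thesis by (simp only: mult.commute)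
  qed
  finally show ?thesis .
qed

text \<open>Jensen's inequality for a weight of arbitrary total mass. With an indicator as weight it
  gives Hoelder's inequality, with a mollifier the L^p bound for convolutions.\<close>

lemma weighted_Jensen:
  fixes f w :: "'b \<Rightarrow> real"
  assumes p: "1 \<le> p" and w: "integrable M w" "\<And>x. 0 \<le> w x" and f: "\<And>x. 0 \<le> f x"
    and fw: "integrable M (\<lambda>x. f x * w x)" and fpw: "integrable M (\<lambda>x. f x powr p * w x)"
  shows "(\<integral>x. f x * w x \<partial>M) powr p \<le> (\<integral>x. w x \<partial>M) powr (p - 1) * (\<integral>x. f x powr p * w x \<partial>M)"
proof -
  define W where "W = (\<integral>x. w x \<partial>M)"
  define G where "G = (\<integral>x. f x powr p * w x \<partial>M)"
  have W0: "W \<ge> 0" unfolding W_def using w by simp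
  have G0: "G \<ge> 0" unfolding G_def using w by simp
  show ?thesis
  proof (cases "W = 0")
    case True
    then have "AE x in M. w x = 0"
      using integral_nonneg_eq_0_iff_AE[OF w(1)] w(2) by (simp add: W_def)
    then have "(\<integral>x. f x * w x \<partial>M) = (\<integral>x. 0 \<partial>M)"
      using fw by (intro integral_cong_AE) auto
    then show ?thesis using G0 W0 by (simp flip: G_def W_def)
  next
    case False
    then have W: "W > 0" using W0 by simp
    \<comment> \<open>The weighted mean of f; touching the convex power at this point is what makes
      the tangent inequality sharp enough.\<close>
    define A where "A = (\<integral>x. f x * w x \<partial>M) / W"
    have I: "(\<integral>x. f x * w x \<partial>M) = A * W" using W by (simp add: A_def)
    have A: "A \<ge> 0" unfolding A_def using W w f by simp
    have "(\<integral>x. (f x * w x) * A powr (p - 1) \<partial>M) \<le> (\<integral>x. (f x powr p * w x) / p + ((1 - 1 / p) * A powr p) * w x \<partial>M)"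
    proof (rule integral_mono)
      fix x
      have "w x * (f x * A powr (p - 1)) \<le> w x * (f x powr p / p + (1 - 1 / p) * A powr p)"
        using w f A p by (intro mult_left_mono Young_tangent) auto
      then show "f x * w x * A powr (p - 1) \<le> f x powr p * w x / p + (1 - 1 / p) * A powr p * w x"
        by (simp add: algebra_simps)
    qed (use fw fpw w in auto)
    then have "A * W * A powr (p - 1) \<le> G / p + (1 - 1 / p) * A powr p * W"
      using fw fpw w by (simp add: I G_def W_def)
    moreover have "A * A powr (p - 1) = A powr p"
      using A p by (cases "A = 0") (auto simp: powr_diff)
    moreover have "A * W * A powr (p - 1) = A * A powr (p - 1) * W" by simp
    ultimately have "A powr p * W \<le> G / p + (1 - 1 / p) * A powr p * W" by simp
    then have "A powr p * W \<le> G / p + (A powr p * W - A powr p * W / p)"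
      by (simp add: algebra_simps)
    then have "A powr p * W / p \<le> G / p" by linarith
    then have "A powr p * W \<le> G" using p by (simp add: divide_le_cancel)
    then have "W powr (p - 1) * (A powr p * W) \<le> W powr (p - 1) * G" by (intro mult_left_mono) auto
    also have "W powr (p - 1) * (A powr p * W) = (A * W) powr p"
      using W A p by (simp add: powr_mult powr_diff)
    finally show ?thesis by (simp add: I G_def W_def)
  qed
qed

text \<open>Hoelder's inequality for exponents whose sum may exceed 1: after normalisation by X and
  Y each product is at most max(x,y)^(a+b) <= max(x,y) <= x + y. It serves for the sum over levels
  and again for the sum over scales; both times a + b >= 1 follows from r >= max(p,q).\<close>

lemma sum_powr_mult_le:
  fixes \<xi> \<eta> :: "'i \<Rightarrow> real"
  assumes I: "finite I" and \<xi>: "\<And>i. 0 \<le> \<xi> i" "(\<Sum>i\<in>I. \<xi> i) \<le> X" and \<eta>: "\<And>i. 0 \<le> \<eta> i" "(\<Sum>i\<in>I. \<eta> i) \<le> Y"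
    and ab: "0 \<le> a" "0 \<le> b" "1 \<le> a + b"
  shows "(\<Sum>i\<in>I. \<xi> i powr a * \<eta> i powr b) \<le> 2 * (X powr a * Y powr b)"
proof -
  have le: "\<xi> i \<le> X" "\<eta> i \<le> Y" if "i \<in> I" for i
    using member_le_sum[OF that, of \<xi>] member_le_sum[OF that, of \<eta>] I \<xi> \<eta> by (auto intro: order_trans)
  have X0: "X \<ge> 0" "Y \<ge> 0" using \<xi> \<eta> sum_nonneg[of I \<xi>] sum_nonneg[of I \<eta>] by (auto intro: order_trans)
  show ?thesis
  proof (cases "X = 0 \<or> Y = 0")
    case True
    then have "\<xi> i powr a * \<eta> i powr b = 0" if "i \<in> I" for i
      using le[OF that] \<xi>(1)[of i] \<eta>(1)[of i] by (auto simp: order_antisym_conv)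
    then have "(\<Sum>i\<in>I. \<xi> i powr a * \<eta> i powr b) = 0" by (intro sum.neutral) blast
    then show ?thesis by simp
  next
    case False
    then have XY: "X > 0" "Y > 0" using X0 by auto
    have "\<xi> i powr a * \<eta> i powr b \<le> X powr a * Y powr b * (\<xi> i / X + \<eta> i / Y)" if i: "i \<in> I" for i
    proof -
      define x y m where "x = \<xi> i / X" and "y = \<eta> i / Y" and "m = max x y"
      have xy: "0 \<le> x" "x \<le> 1" "0 \<le> y" "y \<le> 1" using le[OF i] \<xi>(1) \<eta>(1) XY by (auto simp: x_def y_def)
      have "x powr a * y powr b \<le> m powr a * m powr b"
        using xy ab by (intro mult_mono powr_mono2) (auto simp: m_def)
      also have "\<dots> = m powr (a + b)" by (simp add: powr_add)
      also have "\<dots> \<le> m powr 1" using xy ab by (intro powr_mono') (auto simp: m_def)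
      also have "\<dots> \<le> x + y" using xy by (auto simp: m_def max_def)
      finally have "X powr a * Y powr b * (x powr a * y powr b) \<le> X powr a * Y powr b * (x + y)"
        by (intro mult_left_mono) auto
      moreover have "\<xi> i = X * x" "\<eta> i = Y * y" using XY by (auto simp: x_def y_def)
      then have "\<xi> i powr a * \<eta> i powr b = X powr a * Y powr b * (x powr a * y powr b)"
        using xy XY by (simp add: powr_mult)
      ultimately show ?thesis by (simp add: x_def y_def)
    qed
    then have "(\<Sum>i\<in>I. \<xi> i powr a * \<eta> i powr b) \<le> (\<Sum>i\<in>I. X powr a * Y powr b * (\<xi> i / X + \<eta> i / Y))"
      by (rule sum_mono)
    also have "\<dots> = X powr a * Y powr b * ((\<Sum>i\<in>I. \<xi> i) / X + (\<Sum>i\<in>I. \<eta> i) / Y)"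
      unfolding sum_distrib_left[symmetric] sum.distrib sum_divide_distrib ..
    also have "\<dots> \<le> X powr a * Y powr b * (1 + 1)"
      using XY \<xi> \<eta> by (intro mult_left_mono add_mono) (auto simp: divide_le_eq_1)
    finally show ?thesis by simp
  qed
qed

text \<open>Either the measure of the superlevel sets drops so fast that the next level contributes
  at most half as much, or the isoperimetric inequality bounds the current level.\<close>
lemma level_step:
  fixes e e' l \<xi> b C p q r \<theta> \<kappa> N :: real
  assumes e: "0 \<le> e'" "e' \<le> e" "e \<le> b" and l: "0 < l" and \<xi>: "0 \<le> \<xi>" and C: "0 < C"
    and p: "1 \<le> p" and q: "1 \<le> q" and r: "1 \<le> r" and \<theta>: "0 \<le> \<theta>" "\<theta> \<le> 1" and N: "1 \<le> N"
    and iso: "l * e' powr (1 - 1 / N) \<le> C * (\<xi> powr (1 / p) * e powr (1 - 1 / p))"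
    and \<kappa>: "\<kappa> = r * (\<theta> * (1 / p - 1 / N) + (1 - \<theta>) / q)" "\<kappa> \<le> 1"
  shows "(2 * l) powr r * e' \<le> l powr r * e / 2
    + 2 powr r * b powr (1 - \<kappa>) * (C * 2 powr (r + 1)) powr (\<theta> * r) * (\<xi> powr (\<theta> * r / p) * (l powr q * e) powr ((1 - \<theta>) * r / q))"
    (is "_ \<le> _ + ?H")
proof -
  \<comment> \<open>Chosen so that K e' <= e gives (2l)^r e' <= l^r e / 2.\<close>
  define K where "K = (2::real) powr (r + 1)"
  have K: "K \<ge> 1" unfolding K_def using r by (intro ge_one_powr_ge_zero) auto
  have H0: "?H \<ge> 0" by simp
  have r2: "(2 * l) powr r * x = 2 powr r * (l powr r * x)" for x using l by (simp add: powr_mult)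
  show ?thesis
  proof (cases "K * e' \<le> e")
    case True
    have "e' \<le> e / K" using True K by (simp add: field_simps)
    then have "(2 * l) powr r * e' \<le> 2 powr r * (l powr r * (e / K))"
      unfolding r2 by (intro mult_left_mono) auto
    also have "\<dots> = l powr r * e / 2" by (simp add: K_def powr_add)
    finally show ?thesis using H0 by linarith
  next
    case False
    \<comment> \<open>Now e' > e/K, so the isoperimetric bound for e' becomes one for e at the cost
      of a factor K.\<close>
    then have e0: "e > 0" and e'0: "e' > 0" using e K by (auto intro: ccontr dest: order.antisym)
    have "(e / K) powr (1 - 1 / N) \<le> e' powr (1 - 1 / N)"
      using False e K N by (intro powr_mono2) (auto simp: field_simps)
    moreover have "(1 / K) powr 1 \<le> (1 / K) powr (1 - 1 / N)"
      using K N by (intro powr_mono') (auto simp: field_simps)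
    ultimately have "e powr (1 - 1 / N) * (1 / K) \<le> e' powr (1 - 1 / N)"
    proof -
      assume a: "(e / K) powr (1 - 1 / N) \<le> e' powr (1 - 1 / N)" and b: "(1 / K) powr 1 \<le> (1 / K) powr (1 - 1 / N)"
      have "e powr (1 - 1 / N) * (1 / K) \<le> e powr (1 - 1 / N) * (1 / K) powr (1 - 1 / N)"
        using b K by (intro mult_left_mono) auto
      also have "\<dots> = (e / K) powr (1 - 1 / N)" using e0 K by (simp add: powr_divide)
      finally show ?thesis using a by linarith
    qed
    then have "l * (e powr (1 - 1 / N) * (1 / K)) \<le> C * (\<xi> powr (1 / p) * e powr (1 - 1 / p))"
      using iso l by (meson mult_left_mono less_imp_le order_trans)
    then have "l * e powr (1 - 1 / N) \<le> C * K * \<xi> powr (1 / p) * e powr (1 - 1 / p)"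
      using K by (simp add: field_simps)
    moreover have "e powr (1 - 1 / N) = e powr (1 / p - 1 / N) * e powr (1 - 1 / p)"
      by (simp flip: powr_add)
    ultimately have "(l * e powr (1 / p - 1 / N)) * e powr (1 - 1 / p) \<le> (C * K * \<xi> powr (1 / p)) * e powr (1 - 1 / p)"
      by (simp add: mult.assoc)
    then have "l * e powr (1 / p - 1 / N) \<le> C * K * \<xi> powr (1 / p)"
      by (rule mult_right_le_imp_le) (use e0 in simp)
    then have "(l * e powr (1 / p - 1 / N)) powr (\<theta> * r) \<le> (C * K * \<xi> powr (1 / p)) powr (\<theta> * r)"
      using l \<theta> r by (intro powr_mono2) auto
    also have "\<dots> = (C * K) powr (\<theta> * r) * \<xi> powr (\<theta> * r / p)"
      using C K by (simp add: powr_mult powr_powr mult_ac)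
    finally have 1: "(l * e powr (1 / p - 1 / N)) powr (\<theta> * r) \<le> (C * K) powr (\<theta> * r) * \<xi> powr (\<theta> * r / p)" .
    \<comment> \<open>Interpolation between the isoperimetric quantity l e^(1/p-1/N) and the
      Chebyshev quantity l^q e: the powers of l add up to r, those of e to \<kappa>.\<close>
    have 2: "l powr r * e powr \<kappa> = (l * e powr (1 / p - 1 / N)) powr (\<theta> * r) * (l powr q * e) powr ((1 - \<theta>) * r / q)"
    proof -
      have "(l * e powr (1 / p - 1 / N)) powr (\<theta> * r) * (l powr q * e) powr ((1 - \<theta>) * r / q)
        = (l powr (\<theta> * r) * l powr ((1 - \<theta>) * r)) * (e powr ((1 / p - 1 / N) * (\<theta> * r)) * e powr ((1 - \<theta>) * r / q))"
        using l e0 q by (simp add: powr_mult powr_powr mult_ac)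
      also have "\<dots> = l powr r * e powr \<kappa>"
        unfolding \<kappa>(1) powr_add[symmetric] by (simp add: algebra_simps)
      finally show ?thesis by simp
    qed
    \<comment> \<open>Here \<kappa> <= 1 enters: the surplus power of e is bounded by the same power
      of the full volume b.\<close>
    have "e = e powr \<kappa> * e powr (1 - \<kappa>)" using e0 by (simp flip: powr_add)
    also have "\<dots> \<le> e powr \<kappa> * b powr (1 - \<kappa>)"
      using e e0 \<kappa> by (intro mult_left_mono powr_mono2) auto
    finally have "e \<le> e powr \<kappa> * b powr (1 - \<kappa>)" .
    then have "e' \<le> e powr \<kappa> * b powr (1 - \<kappa>)" using e by linarith
    then have "(2 * l) powr r * e' \<le> 2 powr r * (l powr r * (e powr \<kappa> * b powr (1 - \<kappa>)))"
      unfolding r2 by (intro mult_left_mono) auto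
    also have "\<dots> = 2 powr r * b powr (1 - \<kappa>) * (l powr r * e powr \<kappa>)" by simp
    also have "\<dots> \<le> 2 powr r * b powr (1 - \<kappa>) * ((C * K) powr (\<theta> * r) * \<xi> powr (\<theta> * r / p) * (l powr q * e) powr ((1 - \<theta>) * r / q))"
      unfolding 2 by (intro mult_left_mono mult_right_mono 1) auto
    also have "\<dots> = ?H" by (simp add: K_def mult_ac)
    also have "\<dots> \<le> l powr r * e / 2 + ?H" using e0 by simp
    finally show ?thesis .
  qed
qed

text \<open>If a sequence at least doubles, everything before index n adds up to at most
  \<open>a n\<close>, so the last admissible term controls the whole sum.\<close>

lemma dyadic_sum_le:
  fixes a :: "nat \<Rightarrow> real"
  assumes a: "\<And>i. 0 \<le> a i" "\<And>i. 2 * a i \<le> a (Suc i)" and V: "0 \<le> V" and P: "\<And>i. P i \<Longrightarrow> a i \<le> V"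
  shows "(\<Sum>i<n. a i * of_bool (P i)) \<le> 2 * V"
proof -
  have s: "(\<Sum>i<n. a i * of_bool (P i)) \<le> a n" for n
  proof (induction n)
    case (Suc n)
    have "(\<Sum>i<Suc n. a i * of_bool (P i)) \<le> a n + a n" using Suc a(1)[of n] by (simp add: of_bool_def)
    then show ?case using a(2)[of n] by linarith
  qed (simp add: a)
  show ?thesis
  proof (induction n)
    case (Suc n)
    then show ?case using s[of n] P[of n] by (cases "P n") (auto simp: of_bool_def)
  qed (simp add: V)
qed

text \<open>A discrete layer-cake bound: the largest dyadic level below v already carries v^r up to
  the factor 2^r. Values under the lowest level are covered by l^r, which disappears as l tends to
  0.\<close>

lemma powr_le_dyadic_sum:
  fixes v l r :: real
  assumes l: "0 < l" and r: "0 \<le> r" and v: "v < l * 2 ^ n"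
  shows "max 0 v powr r \<le> l powr r + 2 powr r * (\<Sum>i<n. (l * 2 ^ i) powr r * of_bool (l * 2 ^ i \<le> v))"
  using v
proof (induction n)
  case 0
  then have "max 0 v powr r \<le> l powr r" using l r by (intro powr_mono2) auto
  then show ?case by simp
next
  case (Suc n)
  show ?case
  proof (cases "v < l * 2 ^ n")
    case True
    then have "max 0 v powr r \<le> l powr r + 2 powr r * (\<Sum>i<n. (l * 2 ^ i) powr r * of_bool (l * 2 ^ i \<le> v))"
      by (rule Suc.IH)
    moreover have "(\<Sum>i<n. (l * 2 ^ i) powr r * of_bool (l * 2 ^ i \<le> v)) \<le> (\<Sum>i<Suc n. (l * 2 ^ i) powr r * of_bool (l * 2 ^ i \<le> v))"
      by (rule sum_mono2) auto
    then have "2 powr r * (\<Sum>i<n. (l * 2 ^ i) powr r * of_bool (l * 2 ^ i \<le> v)) \<le> 2 powr r * (\<Sum>i<Suc n. (l * 2 ^ i) powr r * of_bool (l * 2 ^ i \<le> v))"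
      by (intro mult_left_mono) auto
    ultimately show ?thesis by linarith
  next
    case False
    then have "max 0 v powr r \<le> (2 * (l * 2 ^ n)) powr r"
      using Suc.prems l r by (intro powr_mono2) auto
    also have "\<dots> = 2 powr r * (l * 2 ^ n) powr r" using l by (simp add: powr_mult)
    also have "\<dots> \<le> 2 powr r * (\<Sum>i<Suc n. (l * 2 ^ i) powr r * of_bool (l * 2 ^ i \<le> v))"
      using False l by (intro mult_left_mono) (auto simp: sum_nonneg)
    also have "\<dots> \<le> l powr r + \<dots>" by simp
    finally show ?thesis .
  qed
qed

section \<open>From level sets to integrals over a ball\<close>

lemma integrable_indicator_mult_continuous:
  fixes f :: "'a::euclidean_space \<Rightarrow> real"
  assumes f: "continuous_on UNIV f" and S: "S \<in> sets borel" "bounded S"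
  shows "integrable lborel (\<lambda>x. indicator S x * f x)"
proof -
  from S(2) obtain R where "\<forall>x\<in>S. norm x \<le> R" unfolding bounded_iff by (elim exE)
  then have R: "S \<subseteq> cball 0 R" by auto
  have "integrable lborel (\<lambda>x. indicator (cball 0 R) x *\<^sub>R f x)"
    by (intro borel_integrable_compact continuous_on_subset[OF f]) auto
  moreover have [measurable]: "f \<in> borel_measurable borel" using f by (rule borel_measurable_continuous_onI)
  have "(\<lambda>x. indicator S x * f x) \<in> borel_measurable lborel" using S(1) by measurable
  moreover have "AE x in lborel. norm (indicator S x * f x) \<le> norm (indicator (cball 0 R) x *\<^sub>R f x)"
    using R by (intro AE_I2) (auto simp: indicator_def)
  ultimately show ?thesis by (rule Bochner_Integration.integrable_bound)
qed

lemma integral_indicator_Jensen: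
  fixes f :: "'a::euclidean_space \<Rightarrow> real"
  assumes f: "continuous_on UNIV f" "\<And>x. 0 \<le> f x" and p: "1 \<le> p" and S: "S \<in> sets borel" "bounded S"
  shows "(\<integral>x. indicator S x * f x \<partial>lborel) \<le> (\<integral>x. indicator S x * f x powr p \<partial>lborel) powr (1 / p) * measure lborel S powr (1 - 1 / p)"
proof -
  have fp: "continuous_on UNIV (\<lambda>x. f x powr p)"
    using f p by (intro continuous_on_powr') (auto intro: continuous_on_const)
  have i1: "integrable lborel (\<lambda>x. f x * indicator S x)" "integrable lborel (\<lambda>x. f x powr p * indicator S x)"
    using integrable_indicator_mult_continuous[OF f(1) S] integrable_indicator_mult_continuous[OF fp S]
    by (simp_all add: mult.commute)
  have i0: "integrable lborel (indicator S :: 'a \<Rightarrow> real)"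
    using integrable_indicator_mult_continuous[OF continuous_on_const S, of 1] by simp
  have "(\<integral>x. f x * indicator S x \<partial>lborel) powr p \<le> measure lborel S powr (p - 1) * (\<integral>x. f x powr p * indicator S x \<partial>lborel)"
    using weighted_Jensen[OF p i0 _ f(2) i1] S by simp
  then have "((\<integral>x. f x * indicator S x \<partial>lborel) powr p) powr (1 / p) \<le> (measure lborel S powr (p - 1) * (\<integral>x. f x powr p * indicator S x \<partial>lborel)) powr (1 / p)"
    using p by (intro powr_mono2) auto
  also have "\<dots> = measure lborel S powr ((p - 1) * (1 / p)) * (\<integral>x. f x powr p * indicator S x \<partial>lborel) powr (1 / p)"
    by (simp add: powr_mult powr_powr)
  also have "(p - 1) * (1 / p) = 1 - 1 / p" using p by (simp add: field_simps)
  also have "((\<integral>x. f x * indicator S x \<partial>lborel) powr p) powr (1 / p) = (\<integral>x. f x * indicator S x \<partial>lborel)"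
    using p f by (simp add: powr_powr)
  finally show ?thesis by (simp add: mult.commute)
qed

text \<open>The power 2^(3r+2) collects 2^r from the layer-cake bound, 2 from absorbing half of the
  sum, 2^r from \<open>level_step\<close>, 2 from the Hoelder inequality for sums, and at most 2^r
  from the factor 2 in front of the L^q integral.\<close>

definition GN_const :: "'a::euclidean_space itself \<Rightarrow> real \<Rightarrow> real \<Rightarrow> real" where
  "GN_const T r \<theta> = 2 powr (3 * r + 2) * (iso_const T * 2 powr (r + 1)) powr (\<theta> * r)"

text \<open>In the recursion over the levels l 2^i the term \<open>R i / 2\<close> is absorbed, the
  gradient is charged on disjoint bands only, and the L^q contributions of the levels add up
  geometrically at each point. Summing before estimating yields the strong inequality directly, with
  no weak-type bound in between.\<close>

lemma truncated_Gagliardo_Nirenberg: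
  fixes v :: "'a::euclidean_space \<Rightarrow> real" and D :: "'a \<Rightarrow> 'a" and p q r \<theta> \<kappa> \<rho> :: real
  assumes der: "\<And>x. (v has_derivative (\<lambda>h. D x \<bullet> h)) (at x)" and cont: "continuous_on UNIV D"
    and \<rho>: "0 < \<rho>"
    and half: "measure lborel (ball c \<rho>) \<le> 2 * measure lborel {x\<in>ball c \<rho>. v x \<le> 0}"
    and p: "1 \<le> p" "p \<le> r" and q: "1 \<le> q" "q \<le> r" and \<theta>: "0 \<le> \<theta>" "\<theta> \<le> 1"
    and \<kappa>: "\<kappa> = r * (\<theta> * (1 / p - 1 / real DIM('a)) + (1 - \<theta>) / q)" "\<kappa> \<le> 1"
  shows "(\<integral>x. indicator (ball c \<rho>) x * max 0 (v x) powr r \<partial>lborel) \<le>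
    GN_const TYPE('a) r \<theta> * measure lborel (ball c \<rho>) powr (1 - \<kappa>) *
     ((\<integral>x. indicator (ball c \<rho>) x * norm (D x) powr p \<partial>lborel) powr (\<theta> * r / p) *
      (\<integral>x. indicator (ball c \<rho>) x * max 0 (v x) powr q \<partial>lborel) powr ((1 - \<theta>) * r / q))"
proof -
  let ?N = "real DIM('a)" and ?B = "ball c \<rho>" and ?C = "iso_const TYPE('a)"
  have N: "?N \<ge> 1" using DIM_positive[where 'a='a] by linarith
  have r: "r \<ge> 1" using p by simp
  have vc: "continuous_on UNIV v"
    using der by (meson continuous_at_imp_continuous_on has_derivative_continuous)
  have vm[measurable]: "v \<in> borel_measurable borel" and Dm[measurable]: "D \<in> borel_measurable borel"
    using vc cont by (auto intro: borel_measurable_continuous_onI)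
  have Bm[measurable]: "?B \<in> sets borel" by simp
  have bS: "bounded S" if "S \<subseteq> ?B" for S using that bounded_ball bounded_subset by blast
  have cD: "continuous_on UNIV (\<lambda>x. norm (D x))" by (intro continuous_intros cont)
  have cDp: "continuous_on UNIV (\<lambda>x. norm (D x) powr p)"
    using p by (intro continuous_on_powr' cD continuous_on_const) auto
  have cv: "continuous_on UNIV (\<lambda>x. max 0 (v x) powr s)" if "s \<ge> 1" for s
    using that by (intro continuous_on_powr' continuous_on_max vc continuous_on_const) auto
  note ii = integrable_indicator_mult_continuous
  define b where "b = measure lborel ?B"
  have Bfin: "emeasure lborel ?B < \<infinity>" using \<rho> by (simp add: emeasure_ball)
  have fin: "emeasure lborel S < \<infinity>" "measure lborel S \<le> b" if "S \<subseteq> ?B" "S \<in> sets borel" for S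
  proof -
    have "emeasure lborel S \<le> emeasure lborel ?B" using that by (intro emeasure_mono) auto
    then show "emeasure lborel S < \<infinity>" using Bfin by (rule order.strict_trans1)
    show "measure lborel S \<le> b" unfolding b_def
      using that Bfin by (intro measure_mono_fmeasurable) (auto simp: fmeasurable_def)
  qed
  have ind: "integrable lborel (\<lambda>x. k * indicator S x :: real)" "(\<integral>x. k * indicator S x \<partial>lborel) = k * measure lborel S"
    if "S \<subseteq> ?B" "S \<in> sets borel" for S k
    using fin[OF that] that by (auto intro!: integrable_mult_right integrable_real_indicator)
  define X where "X = (\<integral>x. indicator ?B x * norm (D x) powr p \<partial>lborel)"
  define Y where "Y = (\<integral>x. indicator ?B x * max 0 (v x) powr q \<partial>lborel)"
  define Z where "Z = (\<integral>x. indicator ?B x * max 0 (v x) powr r \<partial>lborel)"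
  have XY0: "X \<ge> 0" "Y \<ge> 0" by (auto simp: X_def Y_def intro!: integral_nonneg_AE)
  \<comment> \<open>v is bounded on the ball, so only finitely many levels occur for a given
    l.\<close>
  obtain V where V: "\<And>x. x \<in> ?B \<Longrightarrow> v x \<le> V"
  proof -
    have "compact (v ` cball c \<rho>)" by (intro compact_continuous_image continuous_on_subset[OF vc]) auto
    then have "bdd_above (v ` cball c \<rho>)" by (intro bounded_imp_bdd_above compact_imp_bounded)
    then obtain V where "\<And>y. y \<in> v ` cball c \<rho> \<Longrightarrow> y \<le> V" by (auto simp: bdd_above_def)
    then show ?thesis by (intro that[of V]) auto
  qed
  define H where "H = 2 powr r * b powr (1 - \<kappa>) * (?C * 2 powr (r + 1)) powr (\<theta> * r)"
  have H0: "H \<ge> 0" by (simp add: H_def)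
  have bound: "Z \<le> l powr r * b * (1 + 2 powr (r + 1)) + 2 powr (r + 1) * (H * (2 * (X powr (\<theta> * r / p) * (2 * Y) powr ((1 - \<theta>) * r / q))))"
    if l: "l > 0" for l
  proof -
    define L where "L i = l * 2 ^ i" for i :: nat
    have L: "L i > 0" "L (Suc i) = 2 * L i" for i using l by (auto simp: L_def)
    obtain n where n: "V < L n"
    proof -
      obtain n where "V / l < 2 ^ n" using real_arch_pow[of 2 "V / l"] by auto
      then show ?thesis using l by (intro that[of n]) (simp add: L_def field_simps)
    qed
    define E where "E i = {x\<in>?B. L i \<le> v x}" for i
    define S where "S i = {x\<in>?B. L i < v x \<and> v x < 2 * L i}" for i
    have Em[measurable]: "E i \<in> sets borel" and Sm[measurable]: "S i \<in> sets borel" for i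
      unfolding E_def S_def by measurable
    have sub: "E i \<subseteq> ?B" "S i \<subseteq> ?B" "S i \<subseteq> E i" "E (Suc i) \<subseteq> E i" for i
      using L[of i] by (auto simp: E_def S_def L(2))
    define e where "e i = measure lborel (E i)" for i
    define \<xi> where "\<xi> i = (\<integral>x. indicator (S i) x * norm (D x) powr p \<partial>lborel)" for i
    have \<xi>0: "\<xi> i \<ge> 0" for i unfolding \<xi>_def by (intro integral_nonneg_AE) auto
    have e: "0 \<le> e i" "e (Suc i) \<le> e i" "e i \<le> b" for i
      using fin[OF sub(1) Em] sub(4) by (auto simp: e_def fmeasurable_def intro!: measure_mono_fmeasurable)
    have iso: "L i * e (Suc i) powr (1 - 1 / ?N) \<le> ?C * (\<xi> i powr (1 / p) * e i powr (1 - 1 / p))" for i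
    proof -
      let ?I = "\<integral>x. indicator (S i) x * norm (D x) \<partial>lborel"
      have "ennreal (L i * measure lborel {x\<in>?B. 2 * L i \<le> v x} powr (1 - 1 / ?N))
        \<le> ennreal ?C * (\<integral>\<^sup>+x. ennreal (norm (D x)) * indicator (S i) x \<partial>lborel)"
        unfolding S_def by (rule truncation_isoperimetric[OF der cont L(1) \<rho> half])
      also have "(\<integral>\<^sup>+x. ennreal (norm (D x)) * indicator (S i) x \<partial>lborel) = (\<integral>\<^sup>+x. ennreal (indicator (S i) x * norm (D x)) \<partial>lborel)"
        by (intro nn_integral_cong) (auto simp: indicator_def)
      also have "\<dots> = ennreal ?I"
        by (intro nn_integral_eq_integral ii[OF cD Sm] bS sub) auto
      also have "ennreal ?C * ennreal ?I = ennreal (?C * ?I)"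
        using iso_const_pos[where 'a='a] by (simp add: ennreal_mult')
      also have "{x\<in>?B. 2 * L i \<le> v x} = E (Suc i)" by (simp add: E_def L)
      finally have "L i * e (Suc i) powr (1 - 1 / ?N) \<le> ?C * ?I"
        using iso_const_pos[where 'a='a] by (subst (asm) ennreal_le_iff) (auto simp: e_def intro!: mult_nonneg_nonneg integral_nonneg_AE)
      also have "?I \<le> \<xi> i powr (1 / p) * measure lborel (S i) powr (1 - 1 / p)"
        unfolding \<xi>_def by (intro integral_indicator_Jensen cD p Sm bS sub) auto
      also have "\<dots> \<le> \<xi> i powr (1 / p) * e i powr (1 - 1 / p)"
        unfolding e_def using p fin[OF sub(1) Em] sub(3)
        by (intro mult_left_mono powr_mono2 measure_mono_fmeasurable) (auto simp: fmeasurable_def)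
      finally show ?thesis using iso_const_pos[where 'a='a] by (simp add: mult_left_mono)
    qed
    define R where "R i = L i powr r * e i" for i
    have R0: "R i \<ge> 0" for i using e by (simp add: R_def)
    define \<eta> where "\<eta> i = L i powr q * e i" for i
    have \<eta>0: "\<eta> i \<ge> 0" for i using e by (simp add: \<eta>_def)
    have step: "R (Suc i) \<le> R i / 2 + H * (\<xi> i powr (\<theta> * r / p) * \<eta> i powr ((1 - \<theta>) * r / q))" for i
      unfolding R_def \<eta>_def L(2) H_def
      by (rule level_step[OF e(1) e(2) e(3) L(1) \<xi>0 iso_const_pos p(1) q(1) r \<theta> N iso \<kappa>])
    have sum\<xi>: "(\<Sum>i<n. \<xi> i) \<le> X"
    proof -
      have "(\<Sum>i<n. \<xi> i) = (\<integral>x. (\<Sum>i<n. indicator (S i) x * norm (D x) powr p) \<partial>lborel)"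
        unfolding \<xi>_def by (rule Bochner_Integration.integral_sum[symmetric]) (intro ii[OF cDp Sm] bS sub)
      also have "\<dots> \<le> X" unfolding X_def
      proof (rule integral_mono)
        show "integrable lborel (\<lambda>x. \<Sum>i<n. indicator (S i) x * norm (D x) powr p)"
          by (intro Bochner_Integration.integrable_sum ii[OF cDp Sm] bS sub)
        show "integrable lborel (\<lambda>x. indicator ?B x * norm (D x) powr p)"
          by (intro ii[OF cDp Bm] bS) auto
        fix x
        \<comment> \<open>Each band lies in \<open>E i\<close> without \<open>E (Suc i)\<close>, so
          the indicators telescope and no part of the gradient is counted twice.\<close>
        have "(\<Sum>i<n. indicator (S i) x :: real) \<le> (\<Sum>i<n. indicator (E i) x - indicator (E (Suc i)) x)"
        proof (rule sum_mono)
          fix i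
          show "indicator (S i) x \<le> indicator (E i) x - (indicator (E (Suc i)) x :: real)"
            using L(1)[of i] by (auto simp: indicator_def E_def S_def L(2))
        qed
        also have "\<dots> = indicator (E 0) x - indicator (E n) x" by (rule sum_lessThan_telescope')
        also have "\<dots> \<le> indicator ?B x" using sub(1)[of 0] by (auto simp: indicator_def)
        finally show "(\<Sum>i<n. indicator (S i) x * norm (D x) powr p) \<le> indicator ?B x * norm (D x) powr p"
          unfolding sum_distrib_right[symmetric] by (intro mult_right_mono) auto
      qed
      finally show ?thesis .
    qed
    have sum\<eta>: "(\<Sum>i<n. \<eta> i) \<le> 2 * Y"
    proof -
      have "(\<Sum>i<n. \<eta> i) = (\<Sum>i<n. \<integral>x. L i powr q * indicator (E i) x \<partial>lborel)"
        by (simp only: \<eta>_def e_def ind(2)[OF sub(1) Em])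
      also have "\<dots> = (\<integral>x. (\<Sum>i<n. L i powr q * indicator (E i) x) \<partial>lborel)"
        by (rule Bochner_Integration.integral_sum[symmetric]) (intro ind sub Em)
      also have "\<dots> \<le> (\<integral>x. 2 * (indicator ?B x * max 0 (v x) powr q) \<partial>lborel)"
      proof (rule integral_mono)
        show "integrable lborel (\<lambda>x. \<Sum>i<n. L i powr q * indicator (E i) x)"
          by (intro Bochner_Integration.integrable_sum ind sub Em)
        show "integrable lborel (\<lambda>x. 2 * (indicator ?B x * max 0 (v x) powr q))"
          by (intro integrable_mult_right ii[OF cv Bm] bS q) auto
        fix x
        have "(\<Sum>i<n. L i powr q * of_bool (x \<in> E i)) \<le> 2 * (indicator ?B x * max 0 (v x) powr q)"
        proof (rule dyadic_sum_le)
          fix i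
          show "2 * L i powr q \<le> L (Suc i) powr q"
            using q L(1)[of i] powr_mono[of 1 q 2] by (simp add: L(2) powr_mult mult_right_mono)
          show "L i powr q \<le> indicator ?B x * max 0 (v x) powr q" if "x \<in> E i"
            using that q L(1)[of i] by (auto simp: E_def intro!: powr_mono2)
        qed auto
        then show "(\<Sum>i<n. L i powr q * indicator (E i) x) \<le> 2 * (indicator ?B x * max 0 (v x) powr q)"
          by (simp add: indicator_def of_bool_def)
      qed
      also have "\<dots> = 2 * Y" by (simp add: Y_def)
      finally show ?thesis .
    qed
    have "(\<Sum>i<n. \<xi> i powr (\<theta> * r / p) * \<eta> i powr ((1 - \<theta>) * r / q)) \<le> 2 * (X powr (\<theta> * r / p) * (2 * Y) powr ((1 - \<theta>) * r / q))" (is "?A \<le> ?A'")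
    proof (rule sum_powr_mult_le)
      show "0 \<le> \<theta> * r / p" "0 \<le> (1 - \<theta>) * r / q" using \<theta> r p q by auto
      have "\<theta> * 1 \<le> \<theta> * (r / p)" "(1 - \<theta>) * 1 \<le> (1 - \<theta>) * (r / q)" using \<theta> p q by (intro mult_left_mono; simp)+
      then show "1 \<le> \<theta> * r / p + (1 - \<theta>) * r / q" by simp
    qed (auto intro: \<xi>0 \<eta>0 sum\<xi> sum\<eta>)
    then have HA: "H * ?A \<le> H * ?A'" using H0 by (rule mult_left_mono)
    have "(\<Sum>i<n. R i) \<le> (\<Sum>i<Suc n. R i)" using R0 by simp
    also have "\<dots> = R 0 + (\<Sum>i<n. R (Suc i))" by (rule sum.lessThan_Suc_shift)
    also have "(\<Sum>i<n. R (Suc i)) \<le> (\<Sum>i<n. R i / 2 + H * (\<xi> i powr (\<theta> * r / p) * \<eta> i powr ((1 - \<theta>) * r / q)))"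
      by (intro sum_mono step)
    also have "\<dots> = (\<Sum>i<n. R i) / 2 + H * ?A"
      unfolding sum.distrib sum_divide_distrib sum_distrib_left ..
    \<comment> \<open>All sums are finite, so half of the sum of the \<open>R i\<close> may be moved
      to the left.\<close>
    finally have RS: "(\<Sum>i<n. R i) \<le> 2 * R 0 + 2 * (H * ?A')" using HA by linarith
    have "R 0 \<le> l powr r * b" using e(3)[of 0] by (simp add: R_def L_def mult_left_mono)
    then have RS: "(\<Sum>i<n. R i) \<le> 2 * (l powr r * b) + 2 * (H * ?A')" using RS by linarith
    have "Z \<le> (\<integral>x. l powr r * indicator ?B x + 2 powr r * (\<Sum>i<n. L i powr r * indicator (E i) x) \<partial>lborel)"
      unfolding Z_def
    proof (rule integral_mono)
      show "integrable lborel (\<lambda>x. indicator ?B x * max 0 (v x) powr r)"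
        by (intro ii[OF cv Bm] bS r) auto
      show "integrable lborel (\<lambda>x. l powr r * indicator ?B x + 2 powr r * (\<Sum>i<n. L i powr r * indicator (E i) x))"
        by (intro Bochner_Integration.integrable_add integrable_mult_right Bochner_Integration.integrable_sum ind sub Em Bm order_refl)
      fix x
      show "indicator ?B x * max 0 (v x) powr r \<le> l powr r * indicator ?B x + 2 powr r * (\<Sum>i<n. L i powr r * indicator (E i) x)"
      proof (cases "x \<in> ?B")
        case True
        then have "max 0 (v x) powr r \<le> l powr r + 2 powr r * (\<Sum>i<n. L i powr r * of_bool (L i \<le> v x))"
          unfolding L_def using V[OF True] n l r by (intro powr_le_dyadic_sum) (auto simp: L_def)
        also have "(\<Sum>i<n. L i powr r * of_bool (L i \<le> v x)) = (\<Sum>i<n. L i powr r * indicator (E i) x)"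
          using True by (intro sum.cong) (auto simp: E_def indicator_def)
        finally show ?thesis using True by simp
      qed (auto intro!: mult_nonneg_nonneg sum_nonneg)
    qed
    also have "\<dots> = l powr r * b + 2 powr r * (\<Sum>i<n. R i)"
    proof -
      have "(\<integral>x. (\<Sum>i<n. L i powr r * indicator (E i) x) \<partial>lborel) = (\<Sum>i<n. \<integral>x. L i powr r * indicator (E i) x \<partial>lborel)"
        by (rule Bochner_Integration.integral_sum) (intro ind sub Em)
      also have "\<dots> = (\<Sum>i<n. R i)"
        by (simp only: R_def e_def ind(2)[OF sub(1) Em])
      finally have "(\<integral>x. (\<Sum>i<n. L i powr r * indicator (E i) x) \<partial>lborel) = (\<Sum>i<n. R i)" .
      moreover have "(\<integral>x. l powr r * indicator ?B x \<partial>lborel) = l powr r * b"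
        unfolding b_def by (rule ind) auto
      moreover have "integrable lborel (\<lambda>x. (\<Sum>i<n. L i powr r * indicator (E i) x))"
        by (intro Bochner_Integration.integrable_sum ind sub Em)
      moreover have "integrable lborel (\<lambda>x. l powr r * indicator ?B x)" by (rule ind) auto
      ultimately show ?thesis
        by (subst Bochner_Integration.integral_add) (auto intro!: integrable_mult_right simp del: integral_mult_right_zero simp: integral_mult_right)
    qed
    also have "\<dots> \<le> l powr r * b + 2 powr r * (2 * (l powr r * b) + 2 * (H * ?A'))"
      using RS by (intro add_left_mono mult_left_mono) auto
    also have "\<dots> = l powr r * b * (1 + 2 powr (r + 1)) + 2 powr (r + 1) * (H * ?A')"
      by (simp add: powr_add algebra_simps)
    finally show ?thesis .
  qed
  \<comment> \<open>The bound holds for every lowest level l > 0; the term containing l^r disappears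
    along l = 1/(n+1).\<close>
  have "Z \<le> 2 powr (r + 1) * (H * (2 * (X powr (\<theta> * r / p) * (2 * Y) powr ((1 - \<theta>) * r / q))))" (is "_ \<le> ?T")
  proof (rule LIMSEQ_le_const)
    have "(\<lambda>n. (1 / real (Suc n)) powr r * b * (1 + 2 powr (r + 1)) + ?T) \<longlonglongrightarrow> 0 powr r * b * (1 + 2 powr (r + 1)) + ?T"
      using r by (intro tendsto_intros tendsto_powr' LIMSEQ_Suc[OF lim_1_over_n]) auto
    then show "(\<lambda>n. (1 / real (Suc n)) powr r * b * (1 + 2 powr (r + 1)) + ?T) \<longlonglongrightarrow> ?T" by simp
    show "\<exists>M. \<forall>n\<ge>M. Z \<le> (1 / real (Suc n)) powr r * b * (1 + 2 powr (r + 1)) + ?T"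
      using bound[of "1 / real (Suc n)" for n] by auto
  qed
  also have "\<dots> \<le> GN_const TYPE('a) r \<theta> * b powr (1 - \<kappa>) * (X powr (\<theta> * r / p) * Y powr ((1 - \<theta>) * r / q))"
  proof -
    have "(1 - \<theta>) * r / q \<le> r"
    proof -
      have "(1 - \<theta>) * r \<le> 1 * (r * q)" using \<theta> q r by (intro mult_mono) auto
      then show ?thesis using q by (simp add: field_simps)
    qed
    then have "2 powr ((1 - \<theta>) * r / q) \<le> 2 powr r" by simp
    then have "(2 * Y) powr ((1 - \<theta>) * r / q) \<le> 2 powr r * Y powr ((1 - \<theta>) * r / q)"
      using XY0 by (simp add: powr_mult mult_right_mono)
    then have "?T \<le> 2 powr (r + 1) * (H * (2 * (X powr (\<theta> * r / p) * (2 powr r * Y powr ((1 - \<theta>) * r / q)))))"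
      using H0 by (intro mult_left_mono) auto
    also have "\<dots> = GN_const TYPE('a) r \<theta> * b powr (1 - \<kappa>) * (X powr (\<theta> * r / p) * Y powr ((1 - \<theta>) * r / q))"
    proof -
      have "3 * r + 2 = (r + 1) + r + 1 + r" by simp
      then have "2 powr (3 * r + 2) = 2 powr (r + 1) * 2 powr r * 2 * 2 powr r"
        by (simp only: powr_add powr_one_gt_zero_iff) simp
      then show ?thesis by (simp add: GN_const_def H_def mult_ac)
    qed
    finally show ?thesis .
  qed
  finally show ?thesis by (simp add: X_def Y_def Z_def b_def)
qed

section \<open>Medians\<close>

lemma emeasure_subset_ball_finite:
  assumes "S \<subseteq> ball (c::'a::euclidean_space) \<rho>" shows "emeasure lborel S \<noteq> \<infinity>"
proof -
  have "emeasure lborel S \<le> emeasure lborel (ball c \<rho>)" using assms by (intro emeasure_mono) auto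
  moreover have "emeasure lborel (ball c \<rho>) < \<infinity>"
    by (cases "\<rho> \<ge> 0") (auto simp: emeasure_ball ball_empty)
  ultimately have "emeasure lborel S < \<infinity>" by (rule order.strict_trans1)
  then show ?thesis by simp
qed

text \<open>m is the infimum of the levels whose sublevel set fills at least half of the ball.
  Continuity of the measure along decreasing sets puts m itself among these levels; along increasing
  sets it shows that {v < m} fills at most half.\<close>

lemma median_exists:
  fixes v :: "'a::euclidean_space \<Rightarrow> real"
  assumes vc: "continuous_on UNIV v" and \<rho>: "0 < \<rho>"
  shows "\<exists>m. measure lborel (ball c \<rho>) \<le> 2 * measure lborel {x\<in>ball c \<rho>. v x \<le> m} \<and>
             measure lborel (ball c \<rho>) \<le> 2 * measure lborel {x\<in>ball c \<rho>. m \<le> v x}"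
proof -
  let ?B = "ball c \<rho>"
  have vm[measurable]: "v \<in> borel_measurable borel" using vc by (rule borel_measurable_continuous_onI)
  have [measurable]: "?B \<in> sets borel" by simp
  define b where "b = measure lborel ?B"
  have b: "b > 0" using \<rho> by (simp add: b_def content_ball)
  define T where "T = {t. b \<le> 2 * measure lborel {x\<in>?B. v x \<le> t}}"
  have "compact (v ` cball c \<rho>)" by (intro compact_continuous_image continuous_on_subset[OF vc]) auto
  then obtain L where L: "\<And>x. x \<in> cball c \<rho> \<Longrightarrow> \<bar>v x\<bar> \<le> L"
    using compact_imp_bounded bounded_iff by (metis imageI real_norm_def)
  have vL: "v x \<le> L" "- L \<le> v x" if "x \<in> ?B" for x using L[of x] that by auto
  have B_up: "{x\<in>?B. v x \<le> L} = ?B" using vL by blast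
  have TL: "L \<in> T" unfolding T_def mem_Collect_eq B_up b_def[symmetric] using b by simp
  have low: "- L \<le> t" if "t \<in> T" for t
  proof (rule ccontr)
    assume "\<not> - L \<le> t"
    then have "v x > t" if "x \<in> ?B" for x using vL(2)[OF that] by linarith
    then have "{x\<in>?B. v x \<le> t} = {}" by (auto simp: not_le[symmetric] simp del: mem_ball)
    then show False using that b unfolding T_def mem_Collect_eq by (simp only: measure_empty)
  qed
  then have bdd: "bdd_below T" by (auto simp: bdd_below_def)
  define m where "m = Inf T"
  have up: "b \<le> 2 * measure lborel {x\<in>?B. v x \<le> t}" if t: "m < t" for t
  proof -
    obtain s where s: "s \<in> T" "s < t" using cInf_lessD[of T t] TL t by (auto simp: m_def)
    have "measure lborel {x\<in>?B. v x \<le> s} \<le> measure lborel {x\<in>?B. v x \<le> t}"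
    proof (rule measure_mono_fmeasurable)
      have "emeasure lborel {x\<in>?B. v x \<le> t} \<noteq> \<infinity>" by (rule emeasure_subset_ball_finite) auto
      then show "{x\<in>?B. v x \<le> t} \<in> fmeasurable lborel" by (auto simp: fmeasurable_def top.not_eq_extremum)
    qed (use s in auto)
    then show ?thesis using s by (simp add: T_def)
  qed
  have dn: "2 * measure lborel {x\<in>?B. v x \<le> t} < b" if "t < m" for t
    using that bdd cInf_lower[of t T] by (force simp: T_def m_def)
  have "(\<lambda>n. measure lborel {x\<in>?B. v x \<le> m + 1 / real (Suc n)}) \<longlonglongrightarrow> measure lborel (\<Inter>n. {x\<in>?B. v x \<le> m + 1 / real (Suc n)})"
  proof (rule Lim_measure_decseq)
    show "range (\<lambda>n. {x\<in>?B. v x \<le> m + 1 / real (Suc n)}) \<subseteq> sets lborel" by (auto; measurable)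
    show "decseq (\<lambda>n. {x\<in>?B. v x \<le> m + 1 / real (Suc n)})"
    proof (rule decseq_SucI, rule Collect_mono, intro impI)
      fix n x assume "x \<in> ?B \<and> v x \<le> m + 1 / real (Suc (Suc n))"
      moreover have "1 / real (Suc (Suc n)) \<le> 1 / real (Suc n)" by (simp add: frac_le)
      ultimately show "x \<in> ?B \<and> v x \<le> m + 1 / real (Suc n)" by linarith
    qed
    show "emeasure lborel {x\<in>?B. v x \<le> m + 1 / real (Suc n)} \<noteq> \<infinity>" for n
      by (rule emeasure_subset_ball_finite) auto
  qed
  also have "(\<Inter>n. {x\<in>?B. v x \<le> m + 1 / real (Suc n)}) = {x\<in>?B. v x \<le> m}"
  proof -
    have "v x \<le> m" if "\<And>n. v x \<le> m + 1 / real (Suc n)" for x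
    proof (rule field_le_epsilon)
      fix e :: real assume "e > 0"
      then obtain n where "1 / real (Suc n) < e" using nat_approx_posE by blast
      then show "v x \<le> m + e" using that[of n] by linarith
    qed
    then show ?thesis by (auto intro: order_trans)
  qed
  finally have 1: "b / 2 \<le> measure lborel {x\<in>?B. v x \<le> m}"
  proof (rule LIMSEQ_le_const, intro exI[of _ 0] allI impI)
    show "b / 2 \<le> measure lborel {x\<in>?B. v x \<le> m + 1 / real (Suc n)}" for n
    proof -
      have "1 / real (Suc n) > 0" by simp
      then show ?thesis using up[of "m + 1 / real (Suc n)"] by linarith
    qed
  qed
  have "(\<lambda>n. measure lborel {x\<in>?B. v x \<le> m - 1 / real (Suc n)}) \<longlonglongrightarrow> measure lborel (\<Union>n. {x\<in>?B. v x \<le> m - 1 / real (Suc n)})"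
  proof (rule Lim_measure_incseq)
    show "range (\<lambda>n. {x\<in>?B. v x \<le> m - 1 / real (Suc n)}) \<subseteq> sets lborel" by (auto; measurable)
    show "incseq (\<lambda>n. {x\<in>?B. v x \<le> m - 1 / real (Suc n)})"
    proof (rule incseq_SucI, rule Collect_mono, intro impI)
      fix n x assume "x \<in> ?B \<and> v x \<le> m - 1 / real (Suc n)"
      moreover have "1 / real (Suc (Suc n)) \<le> 1 / real (Suc n)" by (simp add: frac_le)
      ultimately show "x \<in> ?B \<and> v x \<le> m - 1 / real (Suc (Suc n))" by linarith
    qed
    show "emeasure lborel (\<Union>n. {x\<in>?B. v x \<le> m - 1 / real (Suc n)}) \<noteq> \<infinity>"
      by (rule emeasure_subset_ball_finite) auto
  qed
  also have "(\<Union>n. {x\<in>?B. v x \<le> m - 1 / real (Suc n)}) = {x\<in>?B. v x < m}"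
  proof -
    have "\<exists>n. v x \<le> m - 1 / real (Suc n)" if "v x < m" for x
    proof -
      have "m - v x > 0" using that by simp
      then obtain n where "1 / real (Suc n) < m - v x" using nat_approx_posE by blast
      then show ?thesis by (intro exI[of _ n]) linarith
    qed
    then show ?thesis by (auto intro: order.strict_trans1)
  qed
  finally have 2: "measure lborel {x\<in>?B. v x < m} \<le> b / 2"
  proof (rule LIMSEQ_le_const2, intro exI[of _ 0] allI impI)
    show "measure lborel {x\<in>?B. v x \<le> m - 1 / real (Suc n)} \<le> b / 2" for n
    proof -
      have "1 / real (Suc n) > 0" by simp
      then show ?thesis using dn[of "m - 1 / real (Suc n)"] by linarith
    qed
  qed
  have "b = measure lborel ({x\<in>?B. v x < m} \<union> {x\<in>?B. m \<le> v x})"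
    unfolding b_def by (rule arg_cong[where f="measure lborel"]) auto
  also have "\<dots> = measure lborel {x\<in>?B. v x < m} + measure lborel {x\<in>?B. m \<le> v x}"
  proof (rule measure_Union)
    show "emeasure lborel {x\<in>?B. v x < m} \<noteq> \<infinity>" "emeasure lborel {x\<in>?B. m \<le> v x} \<noteq> \<infinity>"
      by (rule emeasure_subset_ball_finite; auto)+
  qed auto
  finally show ?thesis using 1 2 by (intro exI[of _ m]) (auto simp: b_def)
qed

lemma powr_add_le:
  fixes x y r :: real
  assumes "0 \<le> x" "0 \<le> y" "0 \<le> r"
  shows "(x + y) powr r \<le> 2 powr r * (x powr r + y powr r)"
proof -
  have "(x + y) powr r \<le> (2 * max x y) powr r" using assms by (intro powr_mono2) auto
  also have "\<dots> = 2 powr r * max x y powr r" using assms by (simp add: powr_mult)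
  also have "max x y powr r \<le> x powr r + y powr r" by (auto simp: max_def)
  finally show ?thesis by simp
qed

text \<open>The positive and the negative part of v - m each vanish on half of the ball, so the
  truncated inequality applies to both. Their supports are disjoint, so their r-th powers add up to
  |v - m|^r; this costs the factor 2.\<close>

lemma Gagliardo_Nirenberg_median:
  fixes v :: "'a::euclidean_space \<Rightarrow> real" and D :: "'a \<Rightarrow> 'a" and \<rho> m :: real
  assumes der: "\<And>x. (v has_derivative (\<lambda>h. D x \<bullet> h)) (at x)" and cont: "continuous_on UNIV D"
    and \<rho>: "0 < \<rho>"
    and m: "measure lborel (ball c \<rho>) \<le> 2 * measure lborel {x\<in>ball c \<rho>. v x \<le> m}"
           "measure lborel (ball c \<rho>) \<le> 2 * measure lborel {x\<in>ball c \<rho>. m \<le> v x}"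
    and p: "1 \<le> p" "p \<le> r" and q: "1 \<le> q" "q \<le> r" and \<theta>: "0 \<le> \<theta>" "\<theta> \<le> 1"
    and \<kappa>: "\<kappa> = r * (\<theta> * (1 / p - 1 / real DIM('a)) + (1 - \<theta>) / q)" "\<kappa> \<le> 1"
  shows "(\<integral>x. indicator (ball c \<rho>) x * \<bar>v x - m\<bar> powr r \<partial>lborel) \<le>
    2 * GN_const TYPE('a) r \<theta> * measure lborel (ball c \<rho>) powr (1 - \<kappa>) *
     ((\<integral>x. indicator (ball c \<rho>) x * norm (D x) powr p \<partial>lborel) powr (\<theta> * r / p) *
      (\<integral>x. indicator (ball c \<rho>) x * \<bar>v x - m\<bar> powr q \<partial>lborel) powr ((1 - \<theta>) * r / q))"
proof -
  let ?B = "ball c \<rho>"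
  have vc: "continuous_on UNIV v"
    using der by (meson continuous_at_imp_continuous_on has_derivative_continuous)
  have r: "r \<ge> 1" using p by simp
  define I where "I f s = (\<integral>x. indicator ?B x * f x powr s \<partial>lborel)" for f :: "'a \<Rightarrow> real" and s :: real
  define P where "P x = max 0 (v x - m)" for x
  define M where "M x = max 0 (m - v x)" for x
  have int: "integrable lborel (\<lambda>x. indicator ?B x * f x powr s)" if "continuous_on UNIV f" "s \<ge> 1" "\<And>x. 0 \<le> f x" for f :: "'a \<Rightarrow> real" and s
    using that by (intro integrable_indicator_mult_continuous continuous_on_powr' continuous_on_const) auto
  have cP: "continuous_on UNIV P" and cM: "continuous_on UNIV M" and cA: "continuous_on UNIV (\<lambda>x. \<bar>v x - m\<bar>)"
    unfolding P_def M_def by (intro continuous_intros vc)+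
  define X where "X = (\<integral>x. indicator ?B x * norm (D x) powr p \<partial>lborel)"
  define K where "K = GN_const TYPE('a) r \<theta> * measure lborel ?B powr (1 - \<kappa>)"
  have K0: "K \<ge> 0" unfolding K_def GN_const_def by simp
  have 1: "I P r \<le> K * (X powr (\<theta> * r / p) * I P q powr ((1 - \<theta>) * r / q))"
    unfolding I_def P_def K_def X_def
  proof (rule truncated_Gagliardo_Nirenberg[OF _ cont \<rho> _ p q \<theta> \<kappa>])
    show "((\<lambda>x. v x - m) has_derivative (\<bullet>) (D x)) (at x)" for x
      by (auto intro!: derivative_eq_intros der)
    show "measure lborel ?B \<le> 2 * measure lborel {x \<in> ?B. v x - m \<le> 0}" using m(1) by simp
  qed
  have 2: "I M r \<le> K * (X powr (\<theta> * r / p) * I M q powr ((1 - \<theta>) * r / q))"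
  proof -
    have "I M r \<le> K * ((\<integral>x. indicator ?B x * norm (- D x) powr p \<partial>lborel) powr (\<theta> * r / p) * I M q powr ((1 - \<theta>) * r / q))"
      unfolding I_def M_def K_def
    proof (rule truncated_Gagliardo_Nirenberg[OF _ _ \<rho> _ p q \<theta> \<kappa>])
      show "((\<lambda>x. m - v x) has_derivative (\<bullet>) (- D x)) (at x)" for x
        by (auto intro!: derivative_eq_intros der)
      show "continuous_on UNIV (\<lambda>x. - D x)" by (intro continuous_intros cont)
      show "measure lborel ?B \<le> 2 * measure lborel {x \<in> ?B. m - v x \<le> 0}" using m(2) by simp
    qed
    then show ?thesis by (simp add: X_def)
  qed
  have I0: "0 \<le> I f s" for f s unfolding I_def by (intro integral_nonneg_AE) auto
  have mono: "I P q \<le> I (\<lambda>x. \<bar>v x - m\<bar>) q" "I M q \<le> I (\<lambda>x. \<bar>v x - m\<bar>) q"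
    unfolding I_def using q
    by (intro integral_mono int cP cM cA; auto simp: P_def M_def intro!: mult_left_mono powr_mono2)+
  have e: "0 \<le> (1 - \<theta>) * r / q" using \<theta> r q by simp
  have "I (\<lambda>x. \<bar>v x - m\<bar>) r = I P r + I M r"
    unfolding I_def using r
  proof (subst Bochner_Integration.integral_add[symmetric])
    show "integrable lborel (\<lambda>x. indicator ?B x * P x powr r)" by (rule int[OF cP r]) (simp add: P_def)
    show "integrable lborel (\<lambda>x. indicator ?B x * M x powr r)" by (rule int[OF cM r]) (simp add: M_def)
    show "(\<integral>x. indicator ?B x * \<bar>v x - m\<bar> powr r \<partial>lborel) = (\<integral>x. indicator ?B x * P x powr r + indicator ?B x * M x powr r \<partial>lborel)"
      using r by (intro Bochner_Integration.integral_cong refl) (auto simp: P_def M_def max_def indicator_def)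
  qed
  also have "\<dots> \<le> K * (X powr (\<theta> * r / p) * I (\<lambda>x. \<bar>v x - m\<bar>) q powr ((1 - \<theta>) * r / q)) + K * (X powr (\<theta> * r / p) * I (\<lambda>x. \<bar>v x - m\<bar>) q powr ((1 - \<theta>) * r / q))"
    using K0 I0 mono e
    by (intro add_mono order_trans[OF 1] order_trans[OF 2] mult_left_mono powr_mono2) auto
  finally show ?thesis by (simp add: I_def K_def X_def)
qed

text \<open>Three bounds with one and the same m: the size of the median, the oscillation in L^r,
  and a Poincare inequality in L^p. The last one will compare the medians of neighbouring
  cells.\<close>

lemma smooth_cell_estimate:
  fixes v :: "'a::euclidean_space \<Rightarrow> real" and D :: "'a \<Rightarrow> 'a" and \<rho> :: real and c :: 'a
  assumes der: "\<And>x. (v has_derivative (\<lambda>h. D x \<bullet> h)) (at x)" and cont: "continuous_on UNIV D"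
    and \<rho>: "0 < \<rho>"
    and p: "1 \<le> p" "p \<le> r" and q: "1 \<le> q" "q \<le> r" and \<theta>: "0 \<le> \<theta>" "\<theta> \<le> 1"
    and \<kappa>: "\<kappa> = r * (\<theta> * (1 / p - 1 / real DIM('a)) + (1 - \<theta>) / q)" "\<kappa> \<le> 1"
  defines "b \<equiv> measure lborel (ball c \<rho>)"
    and "X \<equiv> (\<integral>x. indicator (ball c \<rho>) x * norm (D x) powr p \<partial>lborel)"
    and "Y \<equiv> (\<integral>x. indicator (ball c \<rho>) x * \<bar>v x\<bar> powr q \<partial>lborel)"
  shows "\<exists>m. b * \<bar>m\<bar> powr q \<le> 2 * Y \<and>
    (\<integral>x. indicator (ball c \<rho>) x * \<bar>v x - m\<bar> powr r \<partial>lborel)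
      \<le> 2 * GN_const TYPE('a) r \<theta> * b powr (1 - \<kappa>) * (X powr (\<theta> * r / p) * (2 powr q * 3 * Y) powr ((1 - \<theta>) * r / q)) \<and>
    (\<integral>x. indicator (ball c \<rho>) x * \<bar>v x - m\<bar> powr p \<partial>lborel)
      \<le> 2 * GN_const TYPE('a) p 1 * b powr (p / real DIM('a)) * X"
proof -
  let ?B = "ball c \<rho>"
  have vc: "continuous_on UNIV v"
    using der by (meson continuous_at_imp_continuous_on has_derivative_continuous)
  have r: "r \<ge> 1" using p by simp
  obtain m where m: "b \<le> 2 * measure lborel {x\<in>?B. v x \<le> m}" "b \<le> 2 * measure lborel {x\<in>?B. m \<le> v x}"
    using median_exists[OF vc \<rho>, of c] unfolding b_def by blast
  have vm[measurable]: "v \<in> borel_measurable borel" using vc by (rule borel_measurable_continuous_onI)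
  have Bm[measurable]: "?B \<in> sets borel" by simp
  have int: "integrable lborel (\<lambda>x. indicator ?B x * f x powr s)" if "continuous_on UNIV f" "s \<ge> 1" "\<And>x. 0 \<le> f x" for f :: "'a \<Rightarrow> real" and s
    using that by (intro integrable_indicator_mult_continuous continuous_on_powr' continuous_on_const) auto
  have ind: "integrable lborel (\<lambda>x. k * indicator S x :: real)" "(\<integral>x. k * indicator S x \<partial>lborel) = k * measure lborel S"
    if "S \<subseteq> ?B" "S \<in> sets borel" for S k
    using emeasure_subset_ball_finite[OF that(1)] that
    by (auto intro!: integrable_mult_right integrable_real_indicator simp: top.not_eq_extremum)
  have cA: "continuous_on UNIV (\<lambda>x. \<bar>v x - m\<bar>)" "continuous_on UNIV (\<lambda>x. \<bar>v x\<bar>)" by (intro continuous_intros vc)+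
  have mq: "b * \<bar>m\<bar> powr q \<le> 2 * Y"
  proof -
    \<comment> \<open>Depending on the sign of m, one of its two half-balls carries |v| >=
      |m|.\<close>
    define S where "S = (if m \<ge> 0 then {x\<in>?B. m \<le> v x} else {x\<in>?B. v x \<le> m})"
    have S: "S \<subseteq> ?B" "S \<in> sets borel" "b \<le> 2 * measure lborel S" using m by (auto simp: S_def)
    have "\<bar>m\<bar> powr q * measure lborel S = (\<integral>x. \<bar>m\<bar> powr q * indicator S x \<partial>lborel)"
      by (rule ind(2)[OF S(1,2), symmetric])
    also have "\<dots> \<le> Y" unfolding Y_def
    proof (rule integral_mono)
      fix x
      show "\<bar>m\<bar> powr q * indicator S x \<le> indicator ?B x * \<bar>v x\<bar> powr q"
        using q by (auto simp: S_def indicator_def intro!: powr_mono2)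
    qed (use ind(1)[OF S(1,2)] int[OF cA(2)] q in auto)
    finally have "\<bar>m\<bar> powr q * measure lborel S \<le> Y" .
    moreover have "b * \<bar>m\<bar> powr q \<le> 2 * measure lborel S * \<bar>m\<bar> powr q" using S by (intro mult_right_mono) auto
    ultimately show ?thesis by (simp add: mult_ac)
  qed
  define Y' where "Y' s = (\<integral>x. indicator ?B x * \<bar>v x - m\<bar> powr s \<partial>lborel)" for s
  have Y'0: "Y' s \<ge> 0" for s unfolding Y'_def by (intro integral_nonneg_AE) auto
  have X0: "X \<ge> 0" unfolding X_def by (intro integral_nonneg_AE) auto
  \<comment> \<open>The power of v contributes Y and the median at most 2Y, hence the factor
    3.\<close>
  have Y': "Y' q \<le> 2 powr q * 3 * Y"
  proof -
    have i1: "integrable lborel (\<lambda>x. 2 powr q * (indicator ?B x * \<bar>v x\<bar> powr q))"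
        using q by (intro integrable_mult_right int cA) auto
      have i2: "integrable lborel (\<lambda>x. (2 powr q * \<bar>m\<bar> powr q) * indicator ?B x)"
        "(\<integral>x. (2 powr q * \<bar>m\<bar> powr q) * indicator ?B x \<partial>lborel) = 2 powr q * \<bar>m\<bar> powr q * b"
        unfolding b_def by (rule ind; simp)+
    have "Y' q \<le> (\<integral>x. 2 powr q * (indicator ?B x * \<bar>v x\<bar> powr q) + (2 powr q * \<bar>m\<bar> powr q) * indicator ?B x \<partial>lborel)"
      unfolding Y'_def
    proof (rule integral_mono)
      fix x
      have "\<bar>v x - m\<bar> powr q \<le> (\<bar>v x\<bar> + \<bar>m\<bar>) powr q" using q by (intro powr_mono2) auto
      also have "\<dots> \<le> 2 powr q * (\<bar>v x\<bar> powr q + \<bar>m\<bar> powr q)" using q by (intro powr_add_le) auto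
      finally show "indicator ?B x * \<bar>v x - m\<bar> powr q \<le> 2 powr q * (indicator ?B x * \<bar>v x\<bar> powr q) + (2 powr q * \<bar>m\<bar> powr q) * indicator ?B x"
        by (auto simp: indicator_def algebra_simps)
    next
      show "integrable lborel (\<lambda>x. indicator ?B x * \<bar>v x - m\<bar> powr q)" by (rule int[OF cA(1) q(1)]) simp
    qed (rule Bochner_Integration.integrable_add[OF i1 i2(1)])
    also have "\<dots> = 2 powr q * Y + 2 powr q * \<bar>m\<bar> powr q * b"
      unfolding Bochner_Integration.integral_add[OF i1 i2(1)] i2(2) by (simp add: Y_def)
    also have "\<dots> \<le> 2 powr q * Y + 2 powr q * (2 * Y)" using mq by (simp add: mult_ac)
    finally show ?thesis by (simp add: mult_ac)
  qed
  have K0: "GN_const TYPE('a) s t \<ge> 0" for s t unfolding GN_const_def by simp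
  have e: "0 \<le> (1 - \<theta>) * r / q" using \<theta> r q by simp
  have "Y' r \<le> 2 * GN_const TYPE('a) r \<theta> * b powr (1 - \<kappa>) * (X powr (\<theta> * r / p) * Y' q powr ((1 - \<theta>) * r / q))"
    unfolding Y'_def b_def X_def
    by (rule Gagliardo_Nirenberg_median[OF der cont \<rho> m[unfolded b_def] p q \<theta> \<kappa>])
  also have "\<dots> \<le> 2 * GN_const TYPE('a) r \<theta> * b powr (1 - \<kappa>) * (X powr (\<theta> * r / p) * (2 powr q * 3 * Y) powr ((1 - \<theta>) * r / q))"
    using K0 Y' Y'0 e by (intro mult_left_mono powr_mono2) auto
  finally have 1: "Y' r \<le> 2 * GN_const TYPE('a) r \<theta> * b powr (1 - \<kappa>) * (X powr (\<theta> * r / p) * (2 powr q * 3 * Y) powr ((1 - \<theta>) * r / q))" .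
  \<comment> \<open>The Poincare inequality is the case r = q = p, \<theta> = 1, where \<kappa> = 1
    - p/N. The L^q factor then has exponent 0 and equals 1, or 0 for base 0; it is at most 1 either
    way.\<close>
  have "Y' p \<le> 2 * GN_const TYPE('a) p 1 * b powr (1 - (1 - p / real DIM('a))) * (X powr (1 * p / p) * Y' p powr ((1 - 1) * p / p))"
    unfolding Y'_def b_def X_def
    by (rule Gagliardo_Nirenberg_median[OF der cont \<rho> m[unfolded b_def]]) (use p in \<open>auto simp: field_simps\<close>)
  also have "\<dots> \<le> 2 * GN_const TYPE('a) p 1 * b powr (p / real DIM('a)) * (X * 1)"
    using K0 X0 p by (intro mult_mono) auto
  finally show ?thesis using mq 1 by (intro exI[of _ m]) (auto simp: Y'_def)
qed

subsection \<open>Mollification\<close>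

lemma uniformly_continuous_compact_support:
  fixes f :: "'a::euclidean_space \<Rightarrow> 'b::real_normed_vector"
  assumes f: "continuous_on UNIV f" and z: "\<And>x. R < norm x \<Longrightarrow> f x = 0"
  shows "uniformly_continuous_on UNIV f"
  unfolding uniformly_continuous_on_def
proof (intro allI impI)
  fix \<epsilon> :: real assume \<epsilon>: "\<epsilon> > 0"
  have "uniformly_continuous_on (cball 0 (R + 1)) f"
    by (intro compact_uniformly_continuous continuous_on_subset[OF f]) auto
  then obtain d where d: "d > 0" "\<And>x y. x \<in> cball 0 (R + 1) \<Longrightarrow> y \<in> cball 0 (R + 1) \<Longrightarrow> dist y x < d \<Longrightarrow> dist (f y) (f x) < \<epsilon>"
    using \<epsilon> unfolding uniformly_continuous_on_def by metis
  show "\<exists>d>0. \<forall>x\<in>UNIV. \<forall>x'\<in>UNIV. dist x' x < d \<longrightarrow> dist (f x') (f x) < \<epsilon>"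
  proof (intro exI[of _ "min d 1"] conjI ballI impI)
    fix x y :: 'a assume xy: "dist y x < min d 1"
    have n: "norm y \<le> norm x + dist y x" "norm x \<le> norm y + dist y x"
      using norm_triangle_sub[of y x] norm_triangle_sub[of x y] by (auto simp: dist_norm norm_minus_commute)
    show "dist (f y) (f x) < \<epsilon>"
    proof (cases "norm x \<le> R \<or> norm y \<le> R")
      case True
      then have "x \<in> cball 0 (R + 1)" "y \<in> cball 0 (R + 1)" using n xy by auto
      then show ?thesis using d xy by auto
    next
      case False
      then show ?thesis using z[of x] z[of y] \<epsilon> by simp
    qed
  qed (use d in auto)
qed

lemma integrable_bounded_mult:
  fixes f :: "'a::euclidean_space \<Rightarrow> real" and k :: "'a \<Rightarrow> 'b::{real_normed_vector,second_countable_topology,banach}"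
  assumes f: "integrable lborel f" and k: "continuous_on UNIV k" "\<And>x. norm (k x) \<le> L"
  shows "integrable lborel (\<lambda>y. f y *\<^sub>R k (x - y))"
proof (rule Bochner_Integration.integrable_bound)
  show "integrable lborel (\<lambda>y. L * norm (f y))" using f by simp
  have "continuous_on UNIV (\<lambda>y. k (x - y))"
    by (rule continuous_on_compose2[OF k(1)]) (auto intro!: continuous_intros)
  then have "(\<lambda>y. k (x - y)) \<in> borel_measurable borel" by (rule borel_measurable_continuous_onI)
  then show "(\<lambda>y. f y *\<^sub>R k (x - y)) \<in> borel_measurable lborel"
    using f by (intro borel_measurable_scaleR) auto
  show "AE y in lborel. norm (f y *\<^sub>R k (x - y)) \<le> norm (L * norm (f y))"
  proof (intro AE_I2)
    fix y
    have "\<bar>f y\<bar> * norm (k (x - y)) \<le> \<bar>f y\<bar> * \<bar>L\<bar>"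
      using k(2)[of "x - y"] by (intro mult_left_mono) auto
    then show "norm (f y *\<^sub>R k (x - y)) \<le> norm (L * norm (f y))" by (simp add: abs_mult mult.commute)
  qed
qed

text \<open>All regularity comes from the kernel, as f is merely integrable. Uniform continuity of
  \<open>dk\<close> makes the linearisation error small uniformly in y, and integration against |f|
  preserves this. The 1 in F + 1 covers f = 0.\<close>

lemma convolution_has_derivative:
  fixes f k :: "'a::euclidean_space \<Rightarrow> real" and dk :: "'a \<Rightarrow> 'a"
  assumes f: "integrable lborel f"
    and k: "\<And>x. (k has_derivative (\<lambda>h. dk x \<bullet> h)) (at x)" "\<And>x. norm (k x) \<le> L"
    and dk: "uniformly_continuous_on UNIV dk" "\<And>x. norm (dk x) \<le> L'"
  shows "((\<lambda>x. \<integral>y. f y * k (x - y) \<partial>lborel) has_derivative (\<lambda>h. (\<integral>y. f y *\<^sub>R dk (x - y) \<partial>lborel) \<bullet> h)) (at x)"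
    and "continuous_on UNIV (\<lambda>x. \<integral>y. f y *\<^sub>R dk (x - y) \<partial>lborel)"
proof -
  have kc: "continuous_on UNIV k"
    using k(1) by (meson continuous_at_imp_continuous_on has_derivative_continuous)
  have dkc: "continuous_on UNIV dk" using dk(1) by (rule uniformly_continuous_imp_continuous)
  have ik: "integrable lborel (\<lambda>y. f y * k (x - y))" for x
    using integrable_bounded_mult[OF f kc k(2)] by simp
  have idk: "integrable lborel (\<lambda>y. f y *\<^sub>R dk (x - y))" for x
    by (rule integrable_bounded_mult[OF f dkc dk(2)])
  define F where "F = (\<integral>y. \<bar>f y\<bar> \<partial>lborel)"
  have F0: "F \<ge> 0" unfolding F_def by (intro integral_nonneg_AE) auto
  have fabs: "integrable lborel (\<lambda>y. \<bar>f y\<bar>)" using f by simp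
  have uc: "\<exists>d>0. \<forall>x y. norm (x - y) < d \<longrightarrow> norm (dk x - dk y) \<le> \<epsilon>" if "\<epsilon> > 0" for \<epsilon> :: real
    using dk(1) that unfolding uniformly_continuous_on_def dist_norm by (meson UNIV_I less_imp_le)
  show "((\<lambda>x. \<integral>y. f y * k (x - y) \<partial>lborel) has_derivative (\<lambda>h. (\<integral>y. f y *\<^sub>R dk (x - y) \<partial>lborel) \<bullet> h)) (at x)"
    unfolding has_derivative_at_alt
  proof (intro conjI allI impI)
    show "bounded_linear ((\<bullet>) (\<integral>y. f y *\<^sub>R dk (x - y) \<partial>lborel))" by (rule bounded_linear_inner_right)
    fix \<epsilon> :: real assume \<epsilon>: "\<epsilon> > 0"
    obtain d where d: "d > 0" "\<And>x y. norm (x - y) < d \<Longrightarrow> norm (dk x - dk y) \<le> \<epsilon> / (F + 1)"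
      using uc[of "\<epsilon> / (F + 1)"] \<epsilon> F0 by auto
    show "\<exists>d>0. \<forall>y. norm (y - x) < d \<longrightarrow>
       norm ((\<integral>ya. f ya * k (y - ya) \<partial>lborel) - (\<integral>y. f y * k (x - y) \<partial>lborel) - (\<integral>y. f y *\<^sub>R dk (x - y) \<partial>lborel) \<bullet> (y - x)) \<le> \<epsilon> * norm (y - x)"
    proof (intro exI[of _ d] conjI allI impI d(1))
      fix x' assume x': "norm (x' - x) < d"
      have lin: "\<bar>k (x' - y) - k (x - y) - dk (x - y) \<bullet> (x' - x)\<bar> \<le> norm (x' - x) * (\<epsilon> / (F + 1))" for y
      proof -
        have "norm (k (x' - y) - k (x - y) - dk (x - y) \<bullet> ((x' - y) - (x - y))) \<le> norm ((x' - y) - (x - y)) * (\<epsilon> / (F + 1))"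
        proof (rule differentiable_bound_linearization[where S = "ball (x - y) d" and f' = "\<lambda>x h. dk x \<bullet> h"])
          fix t :: real assume t: "t \<in> {0..1}"
          have "t * norm (x' - x) \<le> 1 * norm (x' - x)" using t by (intro mult_right_mono) auto
          then show "x - y + t *\<^sub>R (x' - y - (x - y)) \<in> ball (x - y) d"
            using x' t by (simp add: dist_norm)
        next
          fix w assume w: "w \<in> ball (x - y) d"
          show "(k has_derivative (\<bullet>) (dk w)) (at w within ball (x - y) d)"
            using k(1) by (rule has_derivative_at_withinI)
          have "norm (dk w - dk (x - y)) \<le> \<epsilon> / (F + 1)" using w by (intro d) (simp add: dist_norm norm_minus_commute)
          moreover have "((\<bullet>) (dk w) - (\<bullet>) (dk (x - y))) = (\<bullet>) (dk w - dk (x - y))"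
            by (auto simp: inner_diff_left)
          moreover have "onorm ((\<bullet>) (dk w - dk (x - y))) \<le> norm (dk w - dk (x - y))"
            by (rule onorm_bound) (auto simp: Cauchy_Schwarz_ineq2)
          ultimately show "onorm ((\<bullet>) (dk w) - (\<bullet>) (dk (x - y))) \<le> \<epsilon> / (F + 1)" by simp
        qed (use d in auto)
        then show ?thesis by simp
      qed
      have "(\<integral>y. f y * k (x' - y) \<partial>lborel) - (\<integral>y. f y * k (x - y) \<partial>lborel) - (\<integral>y. f y *\<^sub>R dk (x - y) \<partial>lborel) \<bullet> (x' - x)
          = (\<integral>y. f y * (k (x' - y) - k (x - y) - dk (x - y) \<bullet> (x' - x)) \<partial>lborel)"
      proof -
        have "(\<integral>y. f y *\<^sub>R dk (x - y) \<partial>lborel) \<bullet> (x' - x) = (\<integral>y. (f y *\<^sub>R dk (x - y)) \<bullet> (x' - x) \<partial>lborel)"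
          using idk by (intro integral_inner_left[symmetric]) auto
        moreover have "integrable lborel (\<lambda>y. (f y *\<^sub>R dk (x - y)) \<bullet> (x' - x))"
          using idk by (intro integrable_inner_left) auto
        moreover have "(\<integral>y. f y * (k (x' - y) - k (x - y) - dk (x - y) \<bullet> (x' - x)) \<partial>lborel)
            = (\<integral>y. f y * k (x' - y) - f y * k (x - y) - (f y *\<^sub>R dk (x - y)) \<bullet> (x' - x) \<partial>lborel)"
          by (intro Bochner_Integration.integral_cong refl) (simp only: right_diff_distrib inner_scaleR_left)
        ultimately show ?thesis
          using Bochner_Integration.integral_diff[OF Bochner_Integration.integrable_diff[OF ik[of x'] ik[of x]], of "\<lambda>y. (f y *\<^sub>R dk (x - y)) \<bullet> (x' - x)"]
            Bochner_Integration.integral_diff[OF ik[of x'] ik[of x]] by linarith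
      qed
      also have "norm \<dots> \<le> (\<integral>y. norm (f y * (k (x' - y) - k (x - y) - dk (x - y) \<bullet> (x' - x))) \<partial>lborel)"
        by (rule integral_norm_bound)
      also have "\<dots> \<le> (\<integral>y. \<bar>f y\<bar> * (norm (x' - x) * (\<epsilon> / (F + 1))) \<partial>lborel)"
      proof (rule integral_mono')
        show "integrable lborel (\<lambda>y. \<bar>f y\<bar> * (norm (x' - x) * (\<epsilon> / (F + 1))))"
          using fabs by (intro integrable_mult_left)
        show "norm (f y * (k (x' - y) - k (x - y) - dk (x - y) \<bullet> (x' - x))) \<le> \<bar>f y\<bar> * (norm (x' - x) * (\<epsilon> / (F + 1)))" for y
          unfolding real_norm_def abs_mult by (rule mult_left_mono[OF lin]) simp
      qed (use \<epsilon> F0 in auto)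
      also have "\<dots> = norm (x' - x) * (\<epsilon> * (F / (F + 1)))" by (simp add: F_def)
      also have "\<dots> \<le> norm (x' - x) * (\<epsilon> * 1)" using F0 \<epsilon> by (intro mult_left_mono) auto
      finally show "norm ((\<integral>y. f y * k (x' - y) \<partial>lborel) - (\<integral>y. f y * k (x - y) \<partial>lborel) - (\<integral>y. f y *\<^sub>R dk (x - y) \<partial>lborel) \<bullet> (x' - x)) \<le> \<epsilon> * norm (x' - x)"
        by (simp add: mult.commute)
    qed
  qed
  show "continuous_on UNIV (\<lambda>x. \<integral>y. f y *\<^sub>R dk (x - y) \<partial>lborel)"
    unfolding continuous_on_iff
  proof (intro ballI allI impI)
    fix x :: 'a and \<epsilon> :: real assume \<epsilon>: "\<epsilon> > 0"
    obtain d where d: "d > 0" "\<And>x y. norm (x - y) < d \<Longrightarrow> norm (dk x - dk y) \<le> \<epsilon> / (F + 1)"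
      using uc[of "\<epsilon> / (F + 1)"] \<epsilon> F0 by auto
    show "\<exists>d>0. \<forall>x'\<in>UNIV. dist x' x < d \<longrightarrow> dist (\<integral>y. f y *\<^sub>R dk (x' - y) \<partial>lborel) (\<integral>y. f y *\<^sub>R dk (x - y) \<partial>lborel) < \<epsilon>"
    proof (intro exI[of _ d] conjI ballI impI d(1))
      fix x' assume x': "dist x' x < d"
      have "dist (\<integral>y. f y *\<^sub>R dk (x' - y) \<partial>lborel) (\<integral>y. f y *\<^sub>R dk (x - y) \<partial>lborel) = norm (\<integral>y. f y *\<^sub>R (dk (x' - y) - dk (x - y)) \<partial>lborel)"
        using idk[of x] idk[of x'] by (simp add: dist_norm scaleR_diff_right)
      also have "\<dots> \<le> (\<integral>y. norm (f y *\<^sub>R (dk (x' - y) - dk (x - y))) \<partial>lborel)" by (rule integral_norm_bound)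
      also have "\<dots> \<le> (\<integral>y. (\<epsilon> / (F + 1)) * \<bar>f y\<bar> \<partial>lborel)"
      proof (rule integral_mono')
        show "integrable lborel (\<lambda>y. (\<epsilon> / (F + 1)) * \<bar>f y\<bar>)" using fabs by (intro integrable_mult_right)
        fix y
        have "norm (dk (x' - y) - dk (x - y)) \<le> \<epsilon> / (F + 1)" using x' by (intro d) (simp add: dist_norm)
        from mult_left_mono[OF this, of "\<bar>f y\<bar>"]
        show "norm (f y *\<^sub>R (dk (x' - y) - dk (x - y))) \<le> (\<epsilon> / (F + 1)) * \<bar>f y\<bar>" by (simp add: mult.commute)
      qed (use \<epsilon> F0 in auto)
      also have "\<dots> = \<epsilon> * (F / (F + 1))" by (simp add: F_def)
      also have "\<dots> < \<epsilon> * 1" using F0 \<epsilon> by (intro mult_strict_left_mono) auto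
      finally show "dist (\<integral>y. f y *\<^sub>R dk (x' - y) \<partial>lborel) (\<integral>y. f y *\<^sub>R dk (x - y) \<partial>lborel) < \<epsilon>" by simp
    qed
  qed
qed

section \<open>Mollifiers and their convolutions\<close>

definition bump_mass :: "'a::euclidean_space itself \<Rightarrow> real \<Rightarrow> real" where
  "bump_mass _ e = (\<integral>x. bump e x \<partial>(lborel :: 'a measure))"

text \<open>Each radius is normalised by its own mass; the mollifiers are not rescalings of a single
  kernel.\<close>

definition moll :: "real \<Rightarrow> 'a::euclidean_space \<Rightarrow> real" where
  "moll e x = bump e x / bump_mass TYPE('a) e"

definition moll_grad :: "real \<Rightarrow> 'a::euclidean_space \<Rightarrow> 'a" where
  "moll_grad e x = (1 / bump_mass TYPE('a) e) *\<^sub>R bump_grad e x"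

lemma integrable_bump:
  assumes "e > 0" shows "integrable lborel (bump e :: 'a::euclidean_space \<Rightarrow> real)"
proof -
  have "integrable lborel (\<lambda>x::'a. indicator (cball 0 e) x * bump e x)"
    by (intro integrable_indicator_mult_continuous continuous_bump) auto
  moreover have "(\<lambda>x::'a. indicator (cball 0 e) x * bump e x) = bump e"
    by (rule ext) (auto simp: indicator_def not_le intro!: bump_eq_0[OF assms])
  ultimately show ?thesis by simp
qed

lemma bump_mass_pos:
  assumes "e > 0" shows "bump_mass TYPE('a::euclidean_space) e > 0"
proof -
  have "bump_mass TYPE('a) e \<noteq> 0"
  proof
    assume "bump_mass TYPE('a) e = 0"
    then have "AE x in lborel. bump e (x::'a) = 0"
      using integral_nonneg_eq_0_iff_AE[OF integrable_bump[OF assms, where 'a='a]] bump_nonneg by (auto simp: bump_mass_def)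
    then have "AE x in lborel. x \<notin> ball (0::'a) e"
      by eventually_elim (use bump_pos_iff[OF assms] in auto)
    then have "ball (0::'a) e \<in> null_sets lborel"
      by (subst AE_iff_null_sets) auto
    then have "emeasure lborel (ball (0::'a) e) = 0" by (rule null_setsD1)
    then show False using assms unit_ball_vol_pos[of "real DIM('a)"] by (simp add: emeasure_ball)
  qed
  moreover have "bump_mass TYPE('a) e \<ge> 0" unfolding bump_mass_def by (intro integral_nonneg_AE) (auto simp: bump_nonneg)
  ultimately show ?thesis by simp
qed

context
  fixes e :: real
  assumes e: "e > 0"
begin

lemma moll_nonneg: "0 \<le> moll e (x::'a::euclidean_space)"
  using bump_mass_pos[OF e, where 'a='a] by (simp add: moll_def bump_nonneg)

lemma moll_eq_0: "e \<le> norm x \<Longrightarrow> moll e x = 0"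
  by (simp add: moll_def bump_eq_0[OF e])

lemma moll_grad_eq_0: "e \<le> norm x \<Longrightarrow> moll_grad e x = 0"
  by (simp add: moll_grad_def bump_grad_eq_0[OF e])

lemma moll_minus: "moll e (- x) = moll e x" by (simp add: moll_def bump_minus)

lemma continuous_moll: "continuous_on S (moll e)"
  unfolding moll_def[abs_def] divide_inverse by (intro continuous_intros continuous_bump)

lemma continuous_moll_grad: "continuous_on S (moll_grad e)"
  unfolding moll_grad_def[abs_def] by (intro continuous_intros continuous_bump_grad)

lemma moll_has_derivative: "(moll e has_derivative (\<lambda>h. moll_grad e x \<bullet> h)) (at x)"
  unfolding moll_def[abs_def] moll_grad_def
  by (auto intro!: derivative_eq_intros bump_has_derivative simp: divide_inverse mult.commute)

lemma moll_measurable[measurable]: "moll e \<in> borel_measurable borel"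
  by (intro borel_measurable_continuous_onI continuous_moll)

lemma nn_integral_moll: "(\<integral>\<^sup>+y. ennreal (moll e (x - y)) \<partial>lborel) = 1" "(\<integral>\<^sup>+y. ennreal (moll e (y - x)) \<partial>lborel) = 1"
  for x :: "'a::euclidean_space"
proof -
  have "(\<integral>\<^sup>+y. ennreal (moll e (- x + 1 *\<^sub>R y)) \<partial>lborel) = (\<integral>\<^sup>+y. ennreal (moll e (y::'a)) \<partial>lborel)"
    by (subst nn_integral_lborel_affine) auto
  also have "\<dots> = ennreal (\<integral>y. moll e y \<partial>(lborel :: 'a measure))"
    using integrable_bump[OF e, where 'a='a] by (intro nn_integral_eq_integral) (auto simp: moll_nonneg, simp add: moll_def[abs_def])
  also have "(\<integral>y. moll e y \<partial>(lborel :: 'a measure)) = 1"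
    using bump_mass_pos[OF e, where 'a='a] by (simp add: moll_def bump_mass_def)
  finally show 1: "(\<integral>\<^sup>+y. ennreal (moll e (y - x)) \<partial>lborel) = 1" by simp
  have "moll e (x - y) = moll e (y - x)" for y using moll_minus[of "x - y"] by simp
  then show "(\<integral>\<^sup>+y. ennreal (moll e (x - y)) \<partial>lborel) = 1" using 1 by simp
qed

lemma moll_le: "norm (moll e x) \<le> 1 / bump_mass TYPE('a) e" for x :: "'a::euclidean_space"
  using bump_mass_pos[OF e, where 'a='a] bump_le_1[of e x] bump_nonneg[of e x] by (simp add: moll_def divide_right_mono)

lemma moll_grad_bounded: "\<exists>L. \<forall>x::'a::euclidean_space. norm (moll_grad e x) \<le> L"
proof -
  obtain L where "\<forall>x::'a. norm (bump_grad e x) \<le> L" using bump_grad_bounded[OF e] by blast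
  then have "norm (moll_grad e x) \<le> \<bar>1 / bump_mass TYPE('a) e\<bar> * L" for x :: 'a
    unfolding moll_grad_def norm_scaleR by (intro mult_left_mono) auto
  then show ?thesis by blast
qed

lemma integrable_moll: "integrable lborel (\<lambda>y. moll e (x - y))"
  and integral_moll: "(\<integral>y. moll e (x - y) \<partial>lborel) = 1" for x :: "'a::euclidean_space"
proof -
  have "has_bochner_integral lborel (\<lambda>y. moll e (x - y)) 1"
    by (rule has_bochner_integral_nn_integral) (auto simp: moll_nonneg nn_integral_moll)
  then show "integrable lborel (\<lambda>y. moll e (x - y))" "(\<integral>y. moll e (x - y) \<partial>lborel) = 1"
    by (auto simp: has_bochner_integral_iff)
qed

lemma integrable_mult_moll: "integrable lborel f \<Longrightarrow> integrable lborel (\<lambda>y. f y * moll e (x - y))"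
  for x :: "'a::euclidean_space"
  using integrable_bounded_mult[OF _ continuous_moll moll_le, of f x] by simp

lemma mollification_smooth:
  fixes f :: "'a::euclidean_space \<Rightarrow> real"
  assumes f: "integrable lborel f"
  shows "((\<lambda>x. \<integral>y. f y * moll e (x - y) \<partial>lborel) has_derivative (\<lambda>h. (\<integral>y. f y *\<^sub>R moll_grad e (x - y) \<partial>lborel) \<bullet> h)) (at x)"
    and "continuous_on UNIV (\<lambda>x. \<integral>y. f y *\<^sub>R moll_grad e (x - y) \<partial>lborel)"
proof -
  obtain L' where L': "\<And>x::'a. norm (moll_grad e x) \<le> L'" using moll_grad_bounded by blast
  have "uniformly_continuous_on UNIV (moll_grad e :: 'a \<Rightarrow> 'a)"
    by (rule uniformly_continuous_compact_support[where R=e]) (auto simp: continuous_moll_grad moll_grad_eq_0)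
  note h = convolution_has_derivative[OF f moll_has_derivative moll_le this L']
  show "((\<lambda>x. \<integral>y. f y * moll e (x - y) \<partial>lborel) has_derivative (\<lambda>h. (\<integral>y. f y *\<^sub>R moll_grad e (x - y) \<partial>lborel) \<bullet> h)) (at x)"
    by (rule h(1))
  show "continuous_on UNIV (\<lambda>x. \<integral>y. f y *\<^sub>R moll_grad e (x - y) \<partial>lborel)" by (rule h(2))
qed

text \<open>Jensen for the probability density y -> \<open>moll e (x - y)\<close>, then Tonelli. It
  is applied to absolute values and to norms of gradients, hence the nonnegative h.\<close>

lemma mollification_Lp:
  fixes h :: "'a::euclidean_space \<Rightarrow> real"
  assumes s: "1 \<le> s" and h: "integrable lborel h" "\<And>x. 0 \<le> h x" "integrable lborel (\<lambda>x. h x powr s)"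
  shows "(\<integral>\<^sup>+x. ennreal ((\<integral>y. h y * moll e (x - y) \<partial>lborel) powr s) \<partial>lborel) \<le> (\<integral>\<^sup>+x. ennreal (h x powr s) \<partial>lborel)"
proof -
  have [measurable]: "h \<in> borel_measurable borel" using h(1) by auto
  have "(\<integral>\<^sup>+x. ennreal ((\<integral>y. h y * moll e (x - y) \<partial>lborel) powr s) \<partial>lborel) \<le> (\<integral>\<^sup>+x. (\<integral>\<^sup>+y. ennreal (h y powr s * moll e (x - y)) \<partial>lborel) \<partial>lborel)"
  proof (intro nn_integral_mono)
    fix x
    have "(\<integral>y. h y * moll e (x - y) \<partial>lborel) powr s \<le> (\<integral>y. moll e (x - y) \<partial>lborel) powr (s - 1) * (\<integral>y. h y powr s * moll e (x - y) \<partial>lborel)"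
      by (intro weighted_Jensen s integrable_moll moll_nonneg h(2) integrable_mult_moll h)
    then have "ennreal ((\<integral>y. h y * moll e (x - y) \<partial>lborel) powr s) \<le> ennreal (\<integral>y. h y powr s * moll e (x - y) \<partial>lborel)"
      by (intro ennreal_leI) (simp add: integral_moll)
    also have "\<dots> = (\<integral>\<^sup>+y. ennreal (h y powr s * moll e (x - y)) \<partial>lborel)"
      by (intro nn_integral_eq_integral[symmetric] integrable_mult_moll h) (auto simp: moll_nonneg)
    finally show "ennreal ((\<integral>y. h y * moll e (x - y) \<partial>lborel) powr s) \<le> (\<integral>\<^sup>+y. ennreal (h y powr s * moll e (x - y)) \<partial>lborel)" .
  qed
  also have "\<dots> = (\<integral>\<^sup>+y. (\<integral>\<^sup>+x. ennreal (h y powr s * moll e (x - y)) \<partial>lborel) \<partial>lborel)"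
    by (rule lborel_pair.Fubini'[symmetric]) measurable
  also have "\<dots> = (\<integral>\<^sup>+y. ennreal (h y powr s) * (\<integral>\<^sup>+x. ennreal (moll e (x - y)) \<partial>lborel) \<partial>lborel)"
    by (intro nn_integral_cong, subst nn_integral_cmult[symmetric]) (auto simp: ennreal_mult moll_nonneg)
  also have "\<dots> = (\<integral>\<^sup>+y. ennreal (h y powr s) \<partial>lborel)" by (simp add: nn_integral_moll)
  finally show ?thesis .
qed

end

text \<open>The error is uniformly small and, for e < 1, supported in the ball of radius R + 1 of
  volume b. The pointwise error \<eta>/(b+1) integrates to at most \<eta>.\<close>

lemma mollification_continuous_L1:
  fixes g :: "'a::euclidean_space \<Rightarrow> real"
  assumes g: "continuous_on UNIV g" "\<And>x. R < norm x \<Longrightarrow> g x = 0" and \<eta>: "0 < \<eta>"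
  shows "\<exists>e0>0. \<forall>e. 0 < e \<and> e < e0 \<longrightarrow>
    (\<integral>\<^sup>+x. ennreal \<bar>(\<integral>y. g y * moll e (x - y) \<partial>lborel) - g x\<bar> \<partial>lborel) \<le> ennreal \<eta>"
proof -
  define b where "b = measure lborel (cball (0::'a) (R + 1))"
  have b0: "b \<ge> 0" by (simp add: b_def)
  have uc: "uniformly_continuous_on UNIV g" by (rule uniformly_continuous_compact_support[OF g])
  have "\<eta> / (b + 1) > 0" using \<eta> b0 by simp
  then obtain d where d: "d > 0" "\<And>x y. dist y x < d \<Longrightarrow> dist (g y) (g x) < \<eta> / (b + 1)"
    using uc unfolding uniformly_continuous_on_def by (metis UNIV_I)
  have gint: "integrable lborel g"
  proof -
    have "integrable lborel (\<lambda>x. indicator (cball 0 R) x * g x)"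
      by (intro integrable_indicator_mult_continuous g) auto
    moreover have "(\<lambda>x. indicator (cball 0 R) x * g x) = g"
      by (rule ext) (auto simp: indicator_def not_le intro!: g(2))
    ultimately show ?thesis by simp
  qed
  show ?thesis
  proof (intro exI[of _ "min d 1"] conjI allI impI)
    fix e assume e: "0 < e \<and> e < min d 1"
    then have e0: "0 < e" by simp
    have pw: "\<bar>(\<integral>y. g y * moll e (x - y) \<partial>lborel) - g x\<bar> \<le> \<eta> / (b + 1) * indicator (cball 0 (R + 1)) x" for x
    proof -
      have "(\<integral>y. g y * moll e (x - y) \<partial>lborel) - g x = (\<integral>y. g y * moll e (x - y) \<partial>lborel) - (\<integral>y. g x * moll e (x - y) \<partial>lborel)"
        by (simp add: integral_moll[OF e0])
      also have "\<dots> = (\<integral>y. g y * moll e (x - y) - g x * moll e (x - y) \<partial>lborel)"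
        by (intro Bochner_Integration.integral_diff[symmetric] integrable_mult_moll[OF e0] gint integrable_mult_right integrable_moll[OF e0])
      finally have "\<bar>(\<integral>y. g y * moll e (x - y) \<partial>lborel) - g x\<bar> \<le> (\<integral>y. \<bar>g y * moll e (x - y) - g x * moll e (x - y)\<bar> \<partial>lborel)"
        using integral_norm_bound[of lborel "\<lambda>y. g y * moll e (x - y) - g x * moll e (x - y)"] by simp
      also have "\<dots> \<le> (\<integral>y. (\<eta> / (b + 1) * indicator (cball 0 (R + 1)) x) * moll e (x - y) \<partial>lborel)"
      proof (rule integral_mono')
        show "integrable lborel (\<lambda>y. \<eta> / (b + 1) * indicator (cball 0 (R + 1)) x * moll e (x - y))"
          by (intro integrable_mult_right integrable_moll[OF e0])
        fix y
        show "\<bar>g y * moll e (x - y) - g x * moll e (x - y)\<bar> \<le> \<eta> / (b + 1) * indicator (cball 0 (R + 1)) x * moll e (x - y)"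
        proof (cases "norm (x - y) < e")
          case True
          have "\<bar>g y - g x\<bar> \<le> \<eta> / (b + 1) * indicator (cball 0 (R + 1)) x"
          proof (cases "norm x \<le> R + 1")
            case inside: True
            have "dist (g y) (g x) < \<eta> / (b + 1)"
              using True e by (intro d) (auto simp: dist_norm norm_minus_commute)
            then show ?thesis using inside by (simp add: dist_norm)
          next
            case False
            have "norm x \<le> norm y + norm (x - y)" by (metis add.commute norm_triangle_sub)
            then have "R < norm y" "R < norm x" using False True e by auto
            then show ?thesis using g(2) \<eta> b0 by (simp add: indicator_def)
          qed
          from mult_right_mono[OF this moll_nonneg[OF e0, of "x - y"]]
          show ?thesis using moll_nonneg[OF e0, of "x - y"] by (simp add: abs_mult flip: left_diff_distrib)
        next
          case False
          then show ?thesis using moll_eq_0[OF e0, of "x - y"] by simp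
        qed
        show "0 \<le> \<eta> / (b + 1) * indicator (cball 0 (R + 1)) x * moll e (x - y)"
          using \<eta> b0 moll_nonneg[OF e0, of "x - y"] by simp
      qed
      also have "\<dots> = \<eta> / (b + 1) * indicator (cball 0 (R + 1)) x" by (simp add: integral_moll[OF e0])
      finally show ?thesis .
    qed
    have "(\<integral>\<^sup>+x. ennreal \<bar>(\<integral>y. g y * moll e (x - y) \<partial>lborel) - g x\<bar> \<partial>lborel) \<le> (\<integral>\<^sup>+x. ennreal (\<eta> / (b + 1)) * indicator (cball (0::'a) (R + 1)) x \<partial>lborel)"
    proof (intro nn_integral_mono)
      fix x
      have "ennreal \<bar>(\<integral>y. g y * moll e (x - y) \<partial>lborel) - g x\<bar> \<le> ennreal (\<eta> / (b + 1) * indicator (cball 0 (R + 1)) x)"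
        by (rule ennreal_leI[OF pw])
      then show "ennreal \<bar>(\<integral>y. g y * moll e (x - y) \<partial>lborel) - g x\<bar> \<le> ennreal (\<eta> / (b + 1)) * indicator (cball 0 (R + 1)) x"
        by (cases "x \<in> cball 0 (R + 1)") auto
    qed
    also have "\<dots> = ennreal (\<eta> / (b + 1)) * emeasure lborel (cball (0::'a) (R + 1))"
      by (rule nn_integral_cmult_indicator) simp
    also have "\<dots> = ennreal (\<eta> / (b + 1)) * ennreal b"
      unfolding b_def using emeasure_bounded_finite[of "cball (0::'a) (R + 1)"]
      by (subst emeasure_eq_ennreal_measure) auto
    also have "\<dots> = ennreal (\<eta> / (b + 1) * b)" using \<eta> b0 by (intro ennreal_mult[symmetric]) auto
    also have "\<dots> \<le> ennreal \<eta>" using \<eta> b0 by (intro ennreal_leI) (simp add: field_simps)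
    finally show "(\<integral>\<^sup>+x. ennreal \<bar>(\<integral>y. g y * moll e (x - y) \<partial>lborel) - g x\<bar> \<partial>lborel) \<le> ennreal \<eta>" .
  qed (use d in auto)
qed

text \<open>f is first clipped in height and restricted to a ball, with small L^1 error. The bounded
  function so obtained is an almost everywhere limit of continuous functions; these are clipped and
  cut off as well, so that dominated convergence yields an L^1 limit.\<close>

lemma continuous_compact_support_dense_L1:
  fixes f :: "'a::euclidean_space \<Rightarrow> real"
  assumes f: "integrable lborel f" and \<eta>: "0 < \<eta>"
  shows "\<exists>g R. continuous_on UNIV g \<and> (\<forall>x. R < norm x \<longrightarrow> g x = 0) \<and> (\<integral>\<^sup>+x. ennreal \<bar>f x - g x\<bar> \<partial>lborel) \<le> ennreal \<eta>"
proof -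
  define cl where "cl M t = max (- M) (min M t)" for M t :: real
  have clc: "continuous_on S (cl M)" for S M unfolding cl_def by (intro continuous_intros)
  have [measurable]: "cl M \<in> borel_measurable borel" for M by (intro borel_measurable_continuous_onI clc)
  have cl_le: "\<bar>cl M t\<bar> \<le> \<bar>t\<bar>" "\<bar>cl M t\<bar> \<le> M" "\<bar>t\<bar> \<le> M \<Longrightarrow> cl M t = t" if "0 \<le> M" for M t
    using that by (auto simp: cl_def max_def min_def)
  have fm[measurable]: "f \<in> borel_measurable borel" using f by auto
  define h where "h n x = indicator (cball 0 (real n)) x * cl (real n) (f x)" for n x
  have hm[measurable]: "h n \<in> borel_measurable borel" for n
    unfolding h_def by (intro borel_measurable_times borel_measurable_indicator measurable_compose[OF fm]) auto
  have "(\<lambda>n. \<integral>x. \<bar>f x - h n x\<bar> \<partial>lborel) \<longlonglongrightarrow> (\<integral>x. 0 \<partial>(lborel :: 'a measure))"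
  proof (rule integral_dominated_convergence[where w="\<lambda>x. 2 * \<bar>f x\<bar>"])
    show "AE x in lborel. (\<lambda>n. \<bar>f x - h n x\<bar>) \<longlonglongrightarrow> 0"
    proof (intro AE_I2 tendsto_eventually)
      fix x
      obtain n0 :: nat where n0: "max (norm x) \<bar>f x\<bar> \<le> real n0" using real_arch_simple by blast
      then show "\<forall>\<^sub>F n in sequentially. \<bar>f x - h n x\<bar> = 0"
        unfolding eventually_sequentially by (intro exI[of _ n0]) (auto simp: h_def indicator_def cl_le)
    qed
    show "AE x in lborel. norm \<bar>f x - h n x\<bar> \<le> 2 * \<bar>f x\<bar>" for n
    proof (intro AE_I2)
      fix x
      have "\<bar>h n x\<bar> \<le> \<bar>f x\<bar>" using cl_le(1)[of "real n" "f x"] by (auto simp: h_def indicator_def)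
      then show "norm \<bar>f x - h n x\<bar> \<le> 2 * \<bar>f x\<bar>" by simp
    qed
  qed (use f in auto)
  then have "\<forall>\<^sub>F n in sequentially. (\<integral>x. \<bar>f x - h n x\<bar> \<partial>lborel) < \<eta> / 2"
    using \<eta> by (intro order_tendstoD) auto
  then obtain n where n: "(\<integral>x. \<bar>f x - h n x\<bar> \<partial>lborel) < \<eta> / 2" by (auto simp: eventually_sequentially)
  have habs: "\<bar>h n x\<bar> \<le> \<bar>f x\<bar>" "\<bar>h n x\<bar> \<le> real n" for x using cl_le(1,2)[of "real n" "f x"] by (auto simp: h_def indicator_def)
  have hint: "integrable lborel (h n)"
    by (rule Bochner_Integration.integrable_bound[OF f]) (use habs in auto)
  have "h n measurable_on UNIV"
    by (subst measurable_on_iff_borel_measurable) (auto simp: lebesgue_on_UNIV_eq intro: measurable_completion)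
  then obtain N g where N: "negligible N" and g: "\<And>k. continuous_on UNIV (g k)" "\<And>x. x \<notin> N \<Longrightarrow> (\<lambda>k. g k x) \<longlonglongrightarrow> h n x"
    unfolding measurable_on_def by auto
  have AEN: "AE x in lborel. x \<notin> N"
  proof -
    have "AE x in lebesgue. x \<notin> N" using N by (intro AE_not_in) (simp add: negligible_iff_null_sets)
    then show ?thesis by (simp add: AE_completion_iff)
  qed
  define cut where "cut x = max 0 (min 1 (real n + 1 - norm x))" for x :: 'a
  have cut: "0 \<le> cut x" "cut x \<le> 1" "norm x \<le> real n \<Longrightarrow> cut x = 1" "real n + 1 < norm x \<Longrightarrow> cut x = 0" for x
    by (auto simp: cut_def)
  define G where "G k x = cl (real n) (g k x) * cut x" for k x
  have Gc: "continuous_on UNIV (G k)" for k unfolding G_def cut_def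
    by (intro continuous_intros continuous_on_compose2[OF clc[of UNIV] g(1)]) auto
  have Gm[measurable]: "G k \<in> borel_measurable borel" for k by (intro borel_measurable_continuous_onI Gc)
  \<comment> \<open>Clipping and cut-off leave \<open>h n\<close> unchanged, so they do not disturb
    the limit of the approximants.\<close>
  have hcut: "h n x = cl (real n) (h n x) * cut x" for x
    using habs(2)[of x] cl_le(3)[of "real n" "h n x"] cut(3)[of x] by (cases "norm x \<le> real n") (auto simp: h_def)
  have "(\<lambda>k. \<integral>x. \<bar>h n x - G k x\<bar> \<partial>lborel) \<longlonglongrightarrow> (\<integral>x. 0 \<partial>(lborel :: 'a measure))"
  proof (rule integral_dominated_convergence[where w="\<lambda>x. indicator (cball 0 (real n + 1)) x * (2 * real n)"])
    show "integrable lborel (\<lambda>x::'a. indicator (cball 0 (real n + 1)) x * (2 * real n))"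
      by (intro integrable_indicator_mult_continuous) auto
    show "AE x in lborel. (\<lambda>k. \<bar>h n x - G k x\<bar>) \<longlonglongrightarrow> 0"
      using AEN
    proof eventually_elim
      fix x assume "x \<notin> N"
      then have "(\<lambda>k. cl (real n) (g k x)) \<longlonglongrightarrow> cl (real n) (h n x)"
        using clc[of UNIV "real n"] g(2) by (intro isCont_tendsto_compose[of _ "cl (real n)"]) (auto simp: continuous_on_eq_continuous_at)
      then have "(\<lambda>k. \<bar>h n x - G k x\<bar>) \<longlonglongrightarrow> \<bar>h n x - cl (real n) (h n x) * cut x\<bar>"
        unfolding G_def by (intro tendsto_intros)
      then show "(\<lambda>k. \<bar>h n x - G k x\<bar>) \<longlonglongrightarrow> 0" using hcut[of x] by simp
    qed
    show "AE x in lborel. norm \<bar>h n x - G k x\<bar> \<le> indicator (cball 0 (real n + 1)) x * (2 * real n)" for k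
    proof (intro AE_I2)
      fix x
      show "norm \<bar>h n x - G k x\<bar> \<le> indicator (cball 0 (real n + 1)) x * (2 * real n)"
      proof (cases "norm x \<le> real n + 1")
        case True
        have "\<bar>G k x\<bar> \<le> real n * 1" unfolding G_def abs_mult using cl_le(2) cut(1,2) by (intro mult_mono) auto
        then show ?thesis using True habs(2)[of x] by simp
      next
        case False
        then show ?thesis using cut(4)[of x] by (simp add: G_def h_def indicator_def)
      qed
    qed
  qed auto
  then have "\<forall>\<^sub>F k in sequentially. (\<integral>x. \<bar>h n x - G k x\<bar> \<partial>lborel) < \<eta> / 2"
    using \<eta> by (intro order_tendstoD) auto
  then obtain k where k: "(\<integral>x. \<bar>h n x - G k x\<bar> \<partial>lborel) < \<eta> / 2" by (auto simp: eventually_sequentially)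
  have Gint: "integrable lborel (G k)"
  proof -
    have "integrable lborel (\<lambda>x. indicator (cball 0 (real n + 1)) x * G k x)"
      by (intro integrable_indicator_mult_continuous Gc) auto
    moreover have "(\<lambda>x. indicator (cball 0 (real n + 1)) x * G k x) = G k"
      by (rule ext) (auto simp: indicator_def not_le G_def cut(4))
    ultimately show ?thesis by simp
  qed
  have "(\<integral>\<^sup>+x. ennreal \<bar>f x - G k x\<bar> \<partial>lborel) = ennreal (\<integral>x. \<bar>f x - G k x\<bar> \<partial>lborel)"
    using f Gint by (intro nn_integral_eq_integral) auto
  also have "\<dots> \<le> ennreal (\<integral>x. \<bar>f x - h n x\<bar> + \<bar>h n x - G k x\<bar> \<partial>lborel)"
    using f hint Gint by (intro ennreal_leI integral_mono) auto
  also have "(\<integral>x. \<bar>f x - h n x\<bar> + \<bar>h n x - G k x\<bar> \<partial>lborel) = (\<integral>x. \<bar>f x - h n x\<bar> \<partial>lborel) + (\<integral>x. \<bar>h n x - G k x\<bar> \<partial>lborel)"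
    using f hint Gint by (intro Bochner_Integration.integral_add) auto
  also have "ennreal \<dots> \<le> ennreal \<eta>" using n k by (intro ennreal_leI) auto
  finally show ?thesis
    by (intro exI[of _ "G k"] exI[of _ "real n + 1"]) (use Gc cut(4) in \<open>auto simp: G_def\<close>)
qed

text \<open>A three-term estimate through a continuous approximant g. The mollifications of f and g
  stay close by the L^1 contraction property, the case s = 1 of the L^p bound.\<close>

lemma mollification_L1:
  fixes f :: "'a::euclidean_space \<Rightarrow> real"
  assumes f: "integrable lborel f" and \<eta>: "0 < \<eta>"
  shows "\<exists>e0>0. \<forall>e. 0 < e \<and> e < e0 \<longrightarrow>
    (\<integral>\<^sup>+x. ennreal \<bar>(\<integral>y. f y * moll e (x - y) \<partial>lborel) - f x\<bar> \<partial>lborel) \<le> ennreal \<eta>"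
proof -
  obtain g R where g: "continuous_on UNIV g" "\<And>x. R < norm x \<Longrightarrow> g x = 0"
    and fg: "(\<integral>\<^sup>+x. ennreal \<bar>f x - g x\<bar> \<partial>lborel) \<le> ennreal (\<eta> / 3)"
    using continuous_compact_support_dense_L1[OF f, of "\<eta> / 3"] \<eta> by auto
  obtain e0 where e0: "e0 > 0" and e0': "\<And>e. 0 < e \<Longrightarrow> e < e0 \<Longrightarrow>
    (\<integral>\<^sup>+x. ennreal \<bar>(\<integral>y. g y * moll e (x - y) \<partial>lborel) - g x\<bar> \<partial>lborel) \<le> ennreal (\<eta> / 3)"
    using mollification_continuous_L1[of g R "\<eta> / 3"] g \<eta> by auto
  have gint: "integrable lborel g"
  proof -
    have "integrable lborel (\<lambda>x. indicator (cball 0 R) x * g x)"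
      by (intro integrable_indicator_mult_continuous g) auto
    moreover have "(\<lambda>x. indicator (cball 0 R) x * g x) = g"
      by (rule ext) (auto simp: indicator_def not_le intro!: g(2))
    ultimately show ?thesis by simp
  qed
  have [measurable]: "f \<in> borel_measurable borel" "g \<in> borel_measurable borel" using f gint by auto
  show ?thesis
  proof (intro exI[of _ e0] conjI allI impI e0)
    fix e assume e: "0 < e \<and> e < e0"
    define Mf where "Mf x = (\<integral>y. f y * moll e (x - y) \<partial>lborel)" for x
    define Mg where "Mg x = (\<integral>y. g y * moll e (x - y) \<partial>lborel)" for x
    define Md where "Md x = (\<integral>y. \<bar>f y - g y\<bar> * moll e (x - y) \<partial>lborel)" for x
    have meas: "(\<lambda>x. \<integral>y. F y * moll e (x - y) \<partial>lborel) \<in> borel_measurable borel" if "integrable lborel F" for F :: "'a \<Rightarrow> real"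
      using mollification_smooth(1)[OF _ that, of e] e
      by (intro borel_measurable_continuous_onI) (meson continuous_at_imp_continuous_on has_derivative_continuous)
    have dint: "integrable lborel (\<lambda>y. \<bar>f y - g y\<bar>)" using f gint by auto
    have [measurable]: "Mf \<in> borel_measurable borel" "Mg \<in> borel_measurable borel" "Md \<in> borel_measurable borel"
      unfolding Mf_def Mg_def Md_def by (intro meas f gint dint)+
    have Md0: "Md x \<ge> 0" for x unfolding Md_def using e by (intro integral_nonneg_AE) (auto simp: moll_nonneg)
    have MM: "\<bar>Mf x - Mg x\<bar> \<le> Md x" for x
    proof -
      have "Mf x - Mg x = (\<integral>y. f y * moll e (x - y) - g y * moll e (x - y) \<partial>lborel)"
        unfolding Mf_def Mg_def using e by (intro Bochner_Integration.integral_diff[symmetric] integrable_mult_moll f gint) auto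
      also have "\<bar>\<dots>\<bar> \<le> (\<integral>y. \<bar>f y * moll e (x - y) - g y * moll e (x - y)\<bar> \<partial>lborel)"
        using integral_norm_bound[of lborel "\<lambda>y. f y * moll e (x - y) - g y * moll e (x - y)"] by simp
      also have "\<dots> = Md x" unfolding Md_def using e
        by (intro Bochner_Integration.integral_cong refl) (simp add: moll_nonneg abs_mult flip: left_diff_distrib)
      finally show ?thesis .
    qed
    have "(\<integral>\<^sup>+x. ennreal \<bar>Mf x - f x\<bar> \<partial>lborel) \<le> (\<integral>\<^sup>+x. (ennreal (Md x) + ennreal \<bar>Mg x - g x\<bar>) + ennreal \<bar>f x - g x\<bar> \<partial>lborel)"
    proof (intro nn_integral_mono)
      fix x
      have "\<bar>Mf x - f x\<bar> \<le> Md x + \<bar>Mg x - g x\<bar> + \<bar>f x - g x\<bar>" using MM[of x] by linarith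
      then show "ennreal \<bar>Mf x - f x\<bar> \<le> (ennreal (Md x) + ennreal \<bar>Mg x - g x\<bar>) + ennreal \<bar>f x - g x\<bar>"
        using Md0[of x] by (simp add: ennreal_plus[symmetric] ennreal_leI del: ennreal_plus)
    qed
    also have "\<dots> = ((\<integral>\<^sup>+x. ennreal (Md x) \<partial>lborel) + (\<integral>\<^sup>+x. ennreal \<bar>Mg x - g x\<bar> \<partial>lborel)) + (\<integral>\<^sup>+x. ennreal \<bar>f x - g x\<bar> \<partial>lborel)"
      by (simp add: nn_integral_add)
    also have "\<dots> \<le> (ennreal (\<eta> / 3) + ennreal (\<eta> / 3)) + ennreal (\<eta> / 3)"
    proof (intro add_mono fg)
      show "(\<integral>\<^sup>+x. ennreal \<bar>Mg x - g x\<bar> \<partial>lborel) \<le> ennreal (\<eta> / 3)" unfolding Mg_def using e by (intro e0') auto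
      have "(\<integral>\<^sup>+x. ennreal (Md x powr 1) \<partial>lborel) \<le> (\<integral>\<^sup>+x. ennreal (\<bar>f x - g x\<bar> powr 1) \<partial>lborel)"
        unfolding Md_def using e dint by (intro mollification_Lp) auto
      then show "(\<integral>\<^sup>+x. ennreal (Md x) \<partial>lborel) \<le> ennreal (\<eta> / 3)" using Md0 fg by simp
    qed
    also have "\<dots> = ennreal \<eta>" using \<eta> by (simp add: ennreal_plus[symmetric] del: ennreal_plus)
    finally show "(\<integral>\<^sup>+x. ennreal \<bar>(\<integral>y. f y * moll e (x - y) \<partial>lborel) - f x\<bar> \<partial>lborel) \<le> ennreal \<eta>" by (simp add: Mf_def)
  qed
qed

text \<open>The bound d on the radii keeps the mollification on a cell within a slightly larger
  concentric ball.\<close>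

lemma mollification_AE_convergent:
  fixes f :: "'a::euclidean_space \<Rightarrow> real"
  assumes f: "integrable lborel f" and d: "0 < d"
  shows "\<exists>e :: nat \<Rightarrow> real. (\<forall>n. 0 < e n \<and> e n < d) \<and>
    (AE x in lborel. (\<lambda>n. \<integral>y. f y * moll (e n) (x - y) \<partial>lborel) \<longlonglongrightarrow> f x)"
proof -
  have "\<forall>n. \<exists>e. 0 < e \<and> e < d \<and> (\<integral>\<^sup>+x. ennreal \<bar>(\<integral>y. f y * moll e (x - y) \<partial>lborel) - f x\<bar> \<partial>lborel) \<le> ennreal (1 / real (Suc n))"
  proof
    fix n
    obtain e0 where "e0 > 0" "\<And>e. 0 < e \<Longrightarrow> e < e0 \<Longrightarrow>
      (\<integral>\<^sup>+x. ennreal \<bar>(\<integral>y. f y * moll e (x - y) \<partial>lborel) - f x\<bar> \<partial>lborel) \<le> ennreal (1 / real (Suc n))"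
      using mollification_L1[OF f, of "1 / real (Suc n)"] by auto
    then show "\<exists>e. 0 < e \<and> e < d \<and> (\<integral>\<^sup>+x. ennreal \<bar>(\<integral>y. f y * moll e (x - y) \<partial>lborel) - f x\<bar> \<partial>lborel) \<le> ennreal (1 / real (Suc n))"
      using d by (intro exI[of _ "min e0 d / 2"]) auto
  qed
  then obtain e where e: "\<And>n. 0 < e n" "\<And>n. e n < d"
    and eL: "\<And>n. (\<integral>\<^sup>+x. ennreal \<bar>(\<integral>y. f y * moll (e n) (x - y) \<partial>lborel) - f x\<bar> \<partial>lborel) \<le> ennreal (1 / real (Suc n))"
    by metis
  define u where "u n x = (\<integral>y. f y * moll (e n) (x - y) \<partial>lborel) - f x" for n x
  have fm[measurable]: "f \<in> borel_measurable borel" using f by auto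
  have um[measurable]: "u n \<in> borel_measurable borel" for n
  proof -
    have "(\<lambda>x. \<integral>y. f y * moll (e n) (x - y) \<partial>lborel) \<in> borel_measurable borel"
      using mollification_smooth(1)[OF e(1) f]
      by (intro borel_measurable_continuous_onI) (meson continuous_at_imp_continuous_on has_derivative_continuous)
    then show ?thesis unfolding u_def by measurable
  qed
  have uint: "integrable lborel (u n)" for n
  proof (rule integrableI_bounded)
    show "(\<integral>\<^sup>+x. ennreal (norm (u n x)) \<partial>lborel) < \<infinity>"
      using eL[of n] by (auto simp: u_def intro: order.strict_trans1)
  qed auto
  have "(\<lambda>n. \<integral>x. norm (u n x) \<partial>lborel) \<longlonglongrightarrow> 0"
  proof (rule Lim_null_comparison[OF always_eventually])
    show "\<forall>n. norm (\<integral>x. norm (u n x) \<partial>lborel) \<le> 1 / real (Suc n)"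
    proof
      fix n
      have "ennreal (\<integral>x. norm (u n x) \<partial>lborel) = (\<integral>\<^sup>+x. ennreal (norm (u n x)) \<partial>lborel)"
        using uint by (intro nn_integral_eq_integral[symmetric]) auto
      also have "\<dots> \<le> ennreal (1 / real (Suc n))" using eL[of n] by (simp add: u_def)
      finally show "norm (\<integral>x. norm (u n x) \<partial>lborel) \<le> 1 / real (Suc n)"
        by (subst (asm) ennreal_le_iff) auto
    qed
    show "(\<lambda>n. 1 / real (Suc n)) \<longlonglongrightarrow> 0" by (rule LIMSEQ_Suc[OF lim_1_over_n])
  qed
  \<comment> \<open>Convergence in L^1 gives almost everywhere convergence along a subsequence only;
    the radii are reindexed along it.\<close>
  from tendsto_L1_AE_subseq[OF uint this]
  obtain s where s: "strict_mono s" "AE x in lborel. (\<lambda>n. u (s n) x) \<longlonglongrightarrow> 0" by blast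
  have "AE x in lborel. (\<lambda>n. \<integral>y. f y * moll (e (s n)) (x - y) \<partial>lborel) \<longlonglongrightarrow> f x"
    using s(2) by eventually_elim (auto simp: u_def intro: LIM_zero_cancel)
  then show ?thesis using e by (intro exI[of _ "e \<circ> s"]) auto
qed

subsection \<open>Estimates on a cell for weakly differentiable functions\<close>

lemma nn_integral_limit_le:
  fixes w :: "nat \<Rightarrow> 'b \<Rightarrow> real"
  assumes [measurable]: "\<And>n. w n \<in> borel_measurable M"
    and lim: "AE x in M. (\<lambda>n. w n x) \<longlonglongrightarrow> w' x" and K: "\<And>n. (\<integral>\<^sup>+x. ennreal (w n x) \<partial>M) \<le> K"
  shows "(\<integral>\<^sup>+x. ennreal (w' x) \<partial>M) \<le> K"
proof -
  have "(\<integral>\<^sup>+x. ennreal (w' x) \<partial>M) = (\<integral>\<^sup>+x. liminf (\<lambda>n. ennreal (w n x)) \<partial>M)"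
  proof (rule nn_integral_cong_AE, use lim in eventually_elim)
    fix x assume "(\<lambda>n. w n x) \<longlonglongrightarrow> w' x"
    then have "(\<lambda>n. ennreal (w n x)) \<longlonglongrightarrow> ennreal (w' x)" by (rule tendsto_ennrealI)
    then show "ennreal (w' x) = liminf (\<lambda>n. ennreal (w n x))"
      by (intro lim_imp_Liminf[symmetric]) auto
  qed
  also have "\<dots> \<le> liminf (\<lambda>n. \<integral>\<^sup>+x. ennreal (w n x) \<partial>M)"
    by (rule nn_integral_liminf) measurable
  also have "\<dots> \<le> limsup (\<lambda>n. \<integral>\<^sup>+x. ennreal (w n x) \<partial>M)"
    by (rule Liminf_le_Limsup) simp
  also have "\<dots> \<le> K" by (intro Limsup_bounded always_eventually allI K)
  finally show ?thesis .
qed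

text \<open>The embedding concerns Lebesgue measurable functions, while Fubini and convolution are
  carried out for Borel functions. For vector fields a Borel representative is found coordinate by
  coordinate.\<close>

lemma completion_ex_borel_measurable_euclidean:
  fixes g :: "'b \<Rightarrow> 'a::euclidean_space"
  assumes g: "g \<in> borel_measurable (completion M)"
  shows "\<exists>g'\<in>borel_measurable M. (AE x in M. g x = g' x)"
proof -
  have "\<exists>h\<in>borel_measurable M. (AE x in M. g x \<bullet> i = h x)" for i
    using g by (intro completion_ex_borel_measurable_real) auto
  then obtain h where h: "\<And>i. h i \<in> borel_measurable M" "\<And>i. AE x in M. g x \<bullet> i = h i x" by metis
  show ?thesis
  proof (intro bexI[of _ "\<lambda>x. \<Sum>i\<in>Basis. h i x *\<^sub>R i"])
    have "AE x in M. \<forall>i\<in>Basis. g x \<bullet> i = h i x" using h(2) by (intro AE_finite_allI) auto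
    then show "AE x in M. g x = (\<Sum>i\<in>Basis. h i x *\<^sub>R i)"
    proof eventually_elim
      fix x assume "\<forall>i\<in>Basis. g x \<bullet> i = h i x"
      then have "(\<Sum>i\<in>Basis. h i x *\<^sub>R i) = (\<Sum>i\<in>Basis. (g x \<bullet> i) *\<^sub>R i)" by (intro sum.cong) auto
      then show "g x = (\<Sum>i\<in>Basis. h i x *\<^sub>R i)" by (simp add: euclidean_representation)
    qed
    show "(\<lambda>x. \<Sum>i\<in>Basis. h i x *\<^sub>R i) \<in> borel_measurable M"
      using h(1) by (intro borel_measurable_sum borel_measurable_scaleR) auto
  qed
qed

text \<open>Mollification commutes with the weak gradient away from the origin: y ->
  \<open>bump e (y - x)\<close> is an admissible test function because \<open>cball x e\<close> lies
  in K and K avoids 0. The functions f and G are Borel representatives of u and g restricted to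
  K.\<close>

lemma mollified_gradient:
  fixes u :: "'a::euclidean_space \<Rightarrow> real" and g :: "'a \<Rightarrow> 'a"
  assumes w: "weak_grad_punct u g" and e: "0 < e" and x: "cball x e \<subseteq> K" and K: "0 \<notin> K"
    and f: "integrable lborel f" "AE y in lborel. indicator K y * u y = f y"
    and G: "integrable lborel G" "AE y in lborel. indicator K y *\<^sub>R g y = G y"
  shows "norm (\<integral>y. f y *\<^sub>R moll_grad e (x - y) \<partial>lborel) \<le> (\<integral>y. norm (G y) * moll e (x - y) \<partial>lborel)"
proof -
  have Z: "bump_mass TYPE('a) e > 0" by (rule bump_mass_pos[OF e])
  have ex: "e < norm x"
  proof (rule ccontr)
    assume "\<not> e < norm x"
    then have "0 \<in> cball x e" by (simp add: dist_norm)
    then show False using x K by blast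
  qed
  \<comment> \<open>The kernel centred at x vanishes off K, so the restriction to K is not
    felt.\<close>
  have out: "e \<le> norm (x - y)" if "y \<notin> K" for y
    using that x by (force simp: dist_norm)
  obtain L where L: "\<And>x::'a. norm (moll_grad e x) \<le> L" using moll_grad_bounded[OF e] by blast
  have [measurable]: "f \<in> borel_measurable borel" "G \<in> borel_measurable borel" using f G by auto
  have mgm: "(\<lambda>y. moll_grad e (x - y)) \<in> borel_measurable borel"
    by (intro borel_measurable_continuous_onI continuous_on_compose2[OF continuous_moll_grad[OF e, of UNIV]] continuous_intros) auto
  have mm: "(\<lambda>y. moll e (x - y)) \<in> borel_measurable borel"
    by (intro borel_measurable_continuous_onI continuous_on_compose2[OF continuous_moll[OF e, of UNIV]] continuous_intros) auto
  have if': "integrable lborel (\<lambda>y. f y *\<^sub>R moll_grad e (x - y))"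
    by (rule integrable_bounded_mult[OF f(1) continuous_moll_grad[OF e] L])
  have iG: "integrable lborel (\<lambda>y. moll e (x - y) *\<^sub>R G y)"
  proof (rule Bochner_Integration.integrable_bound)
    show "integrable lborel (\<lambda>y. norm (G y) * moll e (x - y))"
      using G(1) by (intro integrable_mult_moll e) auto
    show "(\<lambda>y. moll e (x - y) *\<^sub>R G y) \<in> borel_measurable lborel" using mm by measurable
  qed (simp add: moll_nonneg[OF e] mult.commute)
  have m1: "(\<lambda>y. (f y *\<^sub>R moll_grad e (x - y)) \<bullet> i) \<in> borel_measurable lborel" for i
    using mgm by (intro borel_measurable_inner borel_measurable_scaleR borel_measurable_const) auto
  have m2: "(\<lambda>y. (moll e (x - y) *\<^sub>R G y) \<bullet> i) \<in> borel_measurable lborel" for i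
    using mm by (intro borel_measurable_inner borel_measurable_scaleR borel_measurable_const) auto
  have comp: "(\<integral>y. f y *\<^sub>R moll_grad e (x - y) \<partial>lborel) \<bullet> i = (\<integral>y. moll e (x - y) *\<^sub>R G y \<partial>lborel) \<bullet> i" if i: "i \<in> Basis" for i
  proof -
    have "(\<integral>y. f y *\<^sub>R moll_grad e (x - y) \<partial>lborel) \<bullet> i = (\<integral>y. (f y *\<^sub>R moll_grad e (x - y)) \<bullet> i \<partial>lborel)"
      using if' by (intro integral_inner_left[symmetric]) auto
    also have "\<dots> = (\<integral>y. (f y *\<^sub>R moll_grad e (x - y)) \<bullet> i \<partial>lebesgue)"
      by (rule integral_completion[OF m1, symmetric])
    also have "\<dots> = (\<integral>y. - (1 / bump_mass TYPE('a) e) * (u y * partial_dir (\<lambda>y. bump e (y - x)) i y) \<partial>lebesgue)"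
    proof (rule integral_cong_AE)
      have *: "AE y in lebesgue. indicator K y * u y = f y" using f(2) by (rule AE_completion)
      then show "AE y in lebesgue. (f y *\<^sub>R moll_grad e (x - y)) \<bullet> i = - (1 / bump_mass TYPE('a) e) * (u y * partial_dir (\<lambda>y. bump e (y - x)) i y)"
      proof eventually_elim
        fix y assume fy: "indicator K y * u y = f y"
        \<comment> \<open>The gradient of the bump is odd. This sign turns differentiation in y into
          differentiation in x and cancels the minus sign of integration by parts.\<close>
        have "bump_grad e (y - x) = - bump_grad e (x - y)"
          by (simp add: bump_grad_def inner_diff_left inner_diff_right algebra_simps inner_commute flip: scaleR_minus_right)
        then have "- (1 / bump_mass TYPE('a) e) * (u y * partial_dir (\<lambda>y. bump e (y - x)) i y) = u y * (moll_grad e (x - y) \<bullet> i)"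
          by (simp add: partial_dir_bump moll_grad_def)
        then show "(f y *\<^sub>R moll_grad e (x - y)) \<bullet> i = - (1 / bump_mass TYPE('a) e) * (u y * partial_dir (\<lambda>y. bump e (y - x)) i y)"
          using fy moll_grad_eq_0[OF e, of "x - y"] out[of y] by (cases "y \<in> K") auto
      qed
      show 1: "(\<lambda>y. (f y *\<^sub>R moll_grad e (x - y)) \<bullet> i) \<in> borel_measurable lebesgue"
        by (rule measurable_completion[OF m1])
      show "(\<lambda>y. - (1 / bump_mass TYPE('a) e) * (u y * partial_dir (\<lambda>y. bump e (y - x)) i y)) \<in> borel_measurable lebesgue"
        by (rule borel_measurable_AE[OF 1]) fact
    qed
    also have "\<dots> = - (1 / bump_mass TYPE('a) e) * (\<integral>y. u y * partial_dir (\<lambda>y. bump e (y - x)) i y \<partial>lebesgue)"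
      by (rule integral_mult_right_zero)
    also have "(\<integral>y. u y * partial_dir (\<lambda>y. bump e (y - x)) i y \<partial>lebesgue) = - (\<integral>y. (g y \<bullet> i) * bump e (y - x) \<partial>lebesgue)"
      using w test_fun_bump[OF e ex] i unfolding weak_grad_punct_def by blast
    also have "- (1 / bump_mass TYPE('a) e) * - (\<integral>y. (g y \<bullet> i) * bump e (y - x) \<partial>lebesgue)
        = (\<integral>y. (1 / bump_mass TYPE('a) e) * ((g y \<bullet> i) * bump e (y - x)) \<partial>lebesgue)"
      by simp
    also have "\<dots> = (\<integral>y. (moll e (x - y) *\<^sub>R G y) \<bullet> i \<partial>lebesgue)"
    proof (rule integral_cong_AE)
      have "AE y in lebesgue. indicator K y *\<^sub>R g y = G y" using G(2) by (rule AE_completion)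
      then show *: "AE y in lebesgue. (1 / bump_mass TYPE('a) e) * ((g y \<bullet> i) * bump e (y - x)) = (moll e (x - y) *\<^sub>R G y) \<bullet> i"
      proof eventually_elim
        fix y assume Gy: "indicator K y *\<^sub>R g y = G y"
        have b: "bump e (y - x) = bump e (x - y)" using bump_minus[of e "x - y"] by simp
        show "(1 / bump_mass TYPE('a) e) * ((g y \<bullet> i) * bump e (y - x)) = (moll e (x - y) *\<^sub>R G y) \<bullet> i"
          using Gy bump_eq_0[OF e, of "x - y"] out[of y] unfolding moll_def b by (cases "y \<in> K") auto
      qed
      show 1: "(\<lambda>y. (moll e (x - y) *\<^sub>R G y) \<bullet> i) \<in> borel_measurable lebesgue"
        by (rule measurable_completion[OF m2])
      have "AE y in lebesgue. (moll e (x - y) *\<^sub>R G y) \<bullet> i = (1 / bump_mass TYPE('a) e) * ((g y \<bullet> i) * bump e (y - x))"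
        using * by eventually_elim simp
      then show "(\<lambda>y. (1 / bump_mass TYPE('a) e) * ((g y \<bullet> i) * bump e (y - x))) \<in> borel_measurable lebesgue"
        by (rule borel_measurable_AE[OF 1])
    qed
    also have "\<dots> = (\<integral>y. (moll e (x - y) *\<^sub>R G y) \<bullet> i \<partial>lborel)"
      by (rule integral_completion[OF m2])
    also have "\<dots> = (\<integral>y. moll e (x - y) *\<^sub>R G y \<partial>lborel) \<bullet> i"
      using iG by (intro integral_inner_left) auto
    finally show ?thesis .
  qed
  have "(\<integral>y. f y *\<^sub>R moll_grad e (x - y) \<partial>lborel) = (\<integral>y. moll e (x - y) *\<^sub>R G y \<partial>lborel)"
    by (rule euclidean_eqI) (rule comp)
  also have "norm \<dots> \<le> (\<integral>y. norm (moll e (x - y) *\<^sub>R G y) \<partial>lborel)" by (rule integral_norm_bound)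
  also have "\<dots> = (\<integral>y. norm (G y) * moll e (x - y) \<partial>lborel)"
    by (intro Bochner_Integration.integral_cong refl) (simp add: moll_nonneg[OF e] mult.commute)
  finally show ?thesis .
qed

text \<open>Mollification with radius below \<rho>/2 is controlled on the ball of radius \<rho> by u
  and g on the ball of radius 3\<rho>/2, and 3\<rho>/2 < |z| keeps the origin outside. The number m
  is a limit of medians of the mollifications; it is characterised by its three bounds
  alone.\<close>

lemma weak_cell_estimate:
  fixes u :: "'a::euclidean_space \<Rightarrow> real" and g :: "'a \<Rightarrow> 'a" and \<rho> :: real and z :: 'a
  assumes w: "weak_grad_punct u g" and \<rho>: "0 < \<rho>" "3 / 2 * \<rho> < norm z"
    and p: "1 \<le> p" "p \<le> r" and q: "1 \<le> q" "q \<le> r" and \<theta>: "0 \<le> \<theta>" "\<theta> \<le> 1"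
    and \<kappa>: "\<kappa> = r * (\<theta> * (1 / p - 1 / real DIM('a)) + (1 - \<theta>) / q)" "\<kappa> \<le> 1"
    and X: "(\<integral>\<^sup>+x. ennreal (norm (g x) powr p) * indicator (cball z (3 / 2 * \<rho>)) x \<partial>lebesgue) = ennreal X" "0 \<le> X"
    and Y: "(\<integral>\<^sup>+x. ennreal (\<bar>u x\<bar> powr q) * indicator (cball z (3 / 2 * \<rho>)) x \<partial>lebesgue) = ennreal Y" "0 \<le> Y"
  defines "b \<equiv> measure lborel (ball z \<rho>)"
  shows "\<exists>m. b * \<bar>m\<bar> powr q \<le> 2 * Y \<and>
    (\<integral>\<^sup>+x. ennreal (\<bar>u x - m\<bar> powr r) * indicator (ball z \<rho>) x \<partial>lebesgue)
      \<le> ennreal (2 * GN_const TYPE('a) r \<theta> * b powr (1 - \<kappa>) * (X powr (\<theta> * r / p) * (2 powr q * 3 * Y) powr ((1 - \<theta>) * r / q))) \<and>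
    (\<integral>\<^sup>+x. ennreal (\<bar>u x - m\<bar> powr p) * indicator (ball z \<rho>) x \<partial>lebesgue)
      \<le> ennreal (2 * GN_const TYPE('a) p 1 * b powr (p / real DIM('a)) * X)"
proof -
  let ?K = "cball z (3 / 2 * \<rho>)" and ?B = "ball z \<rho>"
  have r: "r \<ge> 1" using p by simp
  have K: "compact ?K" "0 \<notin> ?K" using \<rho> by auto
  have ui: "integrable lebesgue (\<lambda>x. indicator ?K x * u x)"
    using w K unfolding weak_grad_punct_def loc_int_punct_def set_integrable_def real_scaleR_def by blast
  have gi: "integrable lebesgue (\<lambda>x. indicator ?K x *\<^sub>R g x)"
    using w K unfolding weak_grad_punct_def loc_int_punct_def set_integrable_def by blast
  obtain f where fm[measurable]: "f \<in> borel_measurable lborel" and fae: "AE y in lborel. indicator ?K y * u y = f y"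
    using completion_ex_borel_measurable_real[OF borel_measurable_integrable[OF ui]] by blast
  obtain G where Gm[measurable]: "G \<in> borel_measurable lborel" and Gae: "AE y in lborel. indicator ?K y *\<^sub>R g y = G y"
    using completion_ex_borel_measurable_euclidean[OF borel_measurable_integrable[OF gi]] by blast
  have fae': "AE y in lebesgue. indicator ?K y * u y = f y" using fae by (rule AE_completion)
  have Gae': "AE y in lebesgue. indicator ?K y *\<^sub>R g y = G y" using Gae by (rule AE_completion)
  have "integrable lebesgue f"
    by (rule integrable_cong_AE_imp[OF ui measurable_completion[OF fm] fae'])
  then have f: "integrable lborel f" by (subst (asm) integrable_completion) auto
  have "integrable lebesgue G"
    by (rule integrable_cong_AE_imp[OF gi measurable_completion[OF Gm] Gae'])
  then have G: "integrable lborel G" by (subst (asm) integrable_completion) auto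
  have fq: "(\<integral>\<^sup>+x. ennreal (\<bar>f x\<bar> powr q) \<partial>lborel) = ennreal Y"
    unfolding Y(1)[symmetric] nn_integral_completion
    using fae by (intro nn_integral_cong_AE, eventually_elim) (auto simp: indicator_def split: if_splits)
  have Gp: "(\<integral>\<^sup>+x. ennreal (norm (G x) powr p) \<partial>lborel) = ennreal X"
    unfolding X(1)[symmetric] nn_integral_completion
    using Gae by (intro nn_integral_cong_AE, eventually_elim) (auto simp: indicator_def split: if_splits)
  have fqi: "integrable lborel (\<lambda>x. \<bar>f x\<bar> powr q)"
    using fq by (intro integrableI_bounded) auto
  have Gpi: "integrable lborel (\<lambda>x. norm (G x) powr p)"
    using Gp by (intro integrableI_bounded) auto
  obtain e where e: "\<And>n. 0 < e n" "\<And>n. e n < \<rho> / 2"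
    and lim: "AE x in lborel. (\<lambda>n. \<integral>y. f y * moll (e n) (x - y) \<partial>lborel) \<longlonglongrightarrow> f x"
    using mollification_AE_convergent[OF f, of "\<rho> / 2"] \<rho> by auto
  define v where "v n x = (\<integral>y. f y * moll (e n) (x - y) \<partial>lborel)" for n x
  define D where "D n x = (\<integral>y. f y *\<^sub>R moll_grad (e n) (x - y) \<partial>lborel)" for n x
  have der: "(v n has_derivative (\<lambda>h. D n x \<bullet> h)) (at x)" for n x
    unfolding v_def D_def by (rule mollification_smooth(1)[OF e(1) f])
  have Dc: "continuous_on UNIV (D n)" for n
    unfolding D_def by (rule mollification_smooth(2)[OF e(1) f])
  have vc: "continuous_on UNIV (v n)" for n
    using der by (meson continuous_at_imp_continuous_on has_derivative_continuous)
  have [measurable]: "v n \<in> borel_measurable borel" "D n \<in> borel_measurable borel" for n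
    by (intro borel_measurable_continuous_onI vc Dc)+
  have Bm[measurable]: "?B \<in> sets borel" by simp
  have intB: "integrable lborel (\<lambda>x. indicator ?B x * F x powr s)" if "continuous_on UNIV F" "s \<ge> 1" "\<And>x. 0 \<le> F x" for F :: "'a \<Rightarrow> real" and s
    using that by (intro integrable_indicator_mult_continuous continuous_on_powr' continuous_on_const) auto
  define Yn where "Yn n = (\<integral>x. indicator ?B x * \<bar>v n x\<bar> powr q \<partial>lborel)" for n
  define Xn where "Xn n = (\<integral>x. indicator ?B x * norm (D n x) powr p \<partial>lborel)" for n
  have Yn: "0 \<le> Yn n" "Yn n \<le> Y" for n
  proof -
    show "0 \<le> Yn n" unfolding Yn_def by (intro integral_nonneg_AE) auto
    have "ennreal (Yn n) = (\<integral>\<^sup>+x. ennreal (indicator ?B x * \<bar>v n x\<bar> powr q) \<partial>lborel)"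
      unfolding Yn_def using q by (intro nn_integral_eq_integral[symmetric] intB continuous_intros vc) auto
    also have "\<dots> \<le> (\<integral>\<^sup>+x. ennreal ((\<integral>y. \<bar>f y\<bar> * moll (e n) (x - y) \<partial>lborel) powr q) \<partial>lborel)"
    proof (intro nn_integral_mono ennreal_leI)
      fix x
      have "\<bar>v n x\<bar> \<le> (\<integral>y. \<bar>f y * moll (e n) (x - y)\<bar> \<partial>lborel)"
        unfolding v_def using integral_norm_bound[of lborel "\<lambda>y. f y * moll (e n) (x - y)"] by simp
      also have "\<dots> = (\<integral>y. \<bar>f y\<bar> * moll (e n) (x - y) \<partial>lborel)" by (simp add: abs_mult moll_nonneg[OF e(1)])
      finally have "\<bar>v n x\<bar> powr q \<le> (\<integral>y. \<bar>f y\<bar> * moll (e n) (x - y) \<partial>lborel) powr q" using q by (intro powr_mono2) auto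
      then show "indicator ?B x * \<bar>v n x\<bar> powr q \<le> (\<integral>y. \<bar>f y\<bar> * moll (e n) (x - y) \<partial>lborel) powr q"
        by (auto simp: indicator_def)
    qed
    also have "\<dots> \<le> (\<integral>\<^sup>+x. ennreal (\<bar>f x\<bar> powr q) \<partial>lborel)"
      using f fqi by (intro mollification_Lp[OF e(1) q(1)]) auto
    finally show "Yn n \<le> Y" using Y(2) by (simp add: fq)
  qed
  have Xn: "0 \<le> Xn n" "Xn n \<le> X" for n
  proof -
    show "0 \<le> Xn n" unfolding Xn_def by (intro integral_nonneg_AE) auto
    have "ennreal (Xn n) = (\<integral>\<^sup>+x. ennreal (indicator ?B x * norm (D n x) powr p) \<partial>lborel)"
      unfolding Xn_def using p by (intro nn_integral_eq_integral[symmetric] intB continuous_intros Dc) auto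
    also have "\<dots> \<le> (\<integral>\<^sup>+x. ennreal ((\<integral>y. norm (G y) * moll (e n) (x - y) \<partial>lborel) powr p) \<partial>lborel)"
    proof (intro nn_integral_mono ennreal_leI)
      fix x
      show "indicator ?B x * norm (D n x) powr p \<le> (\<integral>y. norm (G y) * moll (e n) (x - y) \<partial>lborel) powr p"
      proof (cases "x \<in> ?B")
        case True
        have "cball x (e n) \<subseteq> ?K"
        proof
          fix y assume "y \<in> cball x (e n)"
          then show "y \<in> ?K" using True e(2)[of n] dist_triangle[of z y x] by simp
        qed
        then have "norm (D n x) \<le> (\<integral>y. norm (G y) * moll (e n) (x - y) \<partial>lborel)"
          unfolding D_def by (rule mollified_gradient[OF w e(1) _ K(2) f fae G Gae])
        then show ?thesis using True p by (simp add: powr_mono2)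
      qed simp
    qed
    also have "\<dots> \<le> (\<integral>\<^sup>+x. ennreal (norm (G x) powr p) \<partial>lborel)"
      using G Gpi by (intro mollification_Lp[OF e(1) p(1)]) auto
    finally show "Xn n \<le> X" using X(2) by (simp add: Gp)
  qed
  define Kr where "Kr = 2 * GN_const TYPE('a) r \<theta> * b powr (1 - \<kappa>) * (X powr (\<theta> * r / p) * (2 powr q * 3 * Y) powr ((1 - \<theta>) * r / q))"
  define Kp where "Kp = 2 * GN_const TYPE('a) p 1 * b powr (p / real DIM('a)) * X"
  have GN0: "GN_const TYPE('a) s t \<ge> 0" for s t unfolding GN_const_def by simp
  have e1: "0 \<le> (1 - \<theta>) * r / q" "0 \<le> \<theta> * r / p" using \<theta> r q p by auto
  have ex: "\<exists>m. b * \<bar>m\<bar> powr q \<le> 2 * Y \<and> (\<integral>x. indicator ?B x * \<bar>v n x - m\<bar> powr r \<partial>lborel) \<le> Kr \<and> (\<integral>x. indicator ?B x * \<bar>v n x - m\<bar> powr p \<partial>lborel) \<le> Kp" for n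
  proof -
    obtain m where m: "b * \<bar>m\<bar> powr q \<le> 2 * Yn n"
      "(\<integral>x. indicator ?B x * \<bar>v n x - m\<bar> powr r \<partial>lborel) \<le> 2 * GN_const TYPE('a) r \<theta> * b powr (1 - \<kappa>) * (Xn n powr (\<theta> * r / p) * (2 powr q * 3 * Yn n) powr ((1 - \<theta>) * r / q))"
      "(\<integral>x. indicator ?B x * \<bar>v n x - m\<bar> powr p \<partial>lborel) \<le> 2 * GN_const TYPE('a) p 1 * b powr (p / real DIM('a)) * Xn n"
      using smooth_cell_estimate[OF der[of n] Dc[of n] \<rho>(1) p q \<theta> \<kappa>, where c=z]
      unfolding b_def Yn_def Xn_def by (elim exE conjE)
    have "2 * GN_const TYPE('a) r \<theta> * b powr (1 - \<kappa>) * (Xn n powr (\<theta> * r / p) * (2 powr q * 3 * Yn n) powr ((1 - \<theta>) * r / q)) \<le> Kr"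
      unfolding Kr_def using GN0 Xn[of n] Yn[of n] e1 by (intro mult_left_mono mult_mono powr_mono2) auto
    moreover have "2 * GN_const TYPE('a) p 1 * b powr (p / real DIM('a)) * Xn n \<le> Kp"
      unfolding Kp_def using GN0 Xn[of n] by (intro mult_left_mono) auto
    ultimately show ?thesis using m Yn[of n] by (intro exI[of _ m]) auto
  qed
  have "\<forall>n. \<exists>m. b * \<bar>m\<bar> powr q \<le> 2 * Y \<and> (\<integral>x. indicator ?B x * \<bar>v n x - m\<bar> powr r \<partial>lborel) \<le> Kr \<and>
      (\<integral>x. indicator ?B x * \<bar>v n x - m\<bar> powr p \<partial>lborel) \<le> Kp"
    by (intro allI ex)
  from choice[OF this] obtain m where m_all: "\<forall>n. b * \<bar>m n\<bar> powr q \<le> 2 * Y \<and>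
      (\<integral>x. indicator ?B x * \<bar>v n x - m n\<bar> powr r \<partial>lborel) \<le> Kr \<and> (\<integral>x. indicator ?B x * \<bar>v n x - m n\<bar> powr p \<partial>lborel) \<le> Kp"
    by (elim exE)
  then have m: "\<And>n. b * \<bar>m n\<bar> powr q \<le> 2 * Y"
      "\<And>n. (\<integral>x. indicator ?B x * \<bar>v n x - m n\<bar> powr r \<partial>lborel) \<le> Kr"
      "\<And>n. (\<integral>x. indicator ?B x * \<bar>v n x - m n\<bar> powr p \<partial>lborel) \<le> Kp"
    by simp_all
  have b: "b > 0" using \<rho> by (simp add: b_def content_ball)
  \<comment> \<open>The size bound with b > 0 confines the medians to a bounded interval, so a
    subsequence converges.\<close>
  have "bounded (range m)"
  proof (rule boundedI)
    fix t assume "t \<in> range m"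
    then obtain n where t: "t = m n" by auto
    have "\<bar>m n\<bar> powr q \<le> 2 * Y / b" using m(1)[of n] b by (simp add: field_simps)
    then have "(\<bar>m n\<bar> powr q) powr (1 / q) \<le> (2 * Y / b) powr (1 / q)" using q by (intro powr_mono2) auto
    then show "norm t \<le> (2 * Y / b) powr (1 / q)" using q t by (simp add: powr_powr)
  qed
  then obtain m0 s where s: "strict_mono s" and m0: "(m \<circ> s) \<longlonglongrightarrow> m0"
    using bounded_imp_convergent_subsequence by blast
  have m0': "(\<lambda>n. m (s n)) \<longlonglongrightarrow> m0" using m0 by (simp add: o_def)
  \<comment> \<open>Along the subsequence both the mollifications and their medians converge. The
    statement is applied with t = r and with t = p.\<close>
  have fatou: "(\<integral>\<^sup>+x. ennreal (\<bar>u x - m0\<bar> powr t) * indicator ?B x \<partial>lebesgue) \<le> ennreal C"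
    if t: "1 \<le> t" and C: "\<And>n. (\<integral>x. indicator ?B x * \<bar>v n x - m n\<bar> powr t \<partial>lborel) \<le> C" for t C
  proof -
    have "(\<integral>\<^sup>+x. ennreal (\<bar>u x - m0\<bar> powr t) * indicator ?B x \<partial>lebesgue) = (\<integral>\<^sup>+x. ennreal (indicator ?B x * \<bar>f x - m0\<bar> powr t) \<partial>lborel)"
      unfolding nn_integral_completion
    proof (rule nn_integral_cong_AE, use fae in eventually_elim)
      fix x assume "indicator ?K x * u x = f x"
      then show "ennreal (\<bar>u x - m0\<bar> powr t) * indicator ?B x = ennreal (indicator ?B x * \<bar>f x - m0\<bar> powr t)"
        using \<rho>(1) by (cases "x \<in> ?B") (auto simp: indicator_def split: if_splits)
    qed
    also have "\<dots> \<le> ennreal C"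
    proof (rule nn_integral_limit_le[where w="\<lambda>n x. indicator ?B x * \<bar>v (s n) x - m (s n)\<bar> powr t"])
      show "AE x in lborel. (\<lambda>n. indicator ?B x * \<bar>v (s n) x - m (s n)\<bar> powr t) \<longlonglongrightarrow> indicator ?B x * \<bar>f x - m0\<bar> powr t"
        using lim
      proof eventually_elim
        fix x assume "(\<lambda>n. \<integral>y. f y * moll (e n) (x - y) \<partial>lborel) \<longlonglongrightarrow> f x"
        then have "(\<lambda>n. v n x) \<longlonglongrightarrow> f x" by (simp add: v_def)
        from LIMSEQ_subseq_LIMSEQ[OF this s] have "(\<lambda>n. v (s n) x) \<longlonglongrightarrow> f x" by (simp add: o_def)
        then show "(\<lambda>n. indicator ?B x * \<bar>v (s n) x - m (s n)\<bar> powr t) \<longlonglongrightarrow> indicator ?B x * \<bar>f x - m0\<bar> powr t"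
          using t m0' by (intro tendsto_intros tendsto_powr') auto
      qed
      show "(\<integral>\<^sup>+x. ennreal (indicator ?B x * \<bar>v (s n) x - m (s n)\<bar> powr t) \<partial>lborel) \<le> ennreal C" for n
      proof -
        have "(\<integral>\<^sup>+x. ennreal (indicator ?B x * \<bar>v (s n) x - m (s n)\<bar> powr t) \<partial>lborel) = ennreal (\<integral>x. indicator ?B x * \<bar>v (s n) x - m (s n)\<bar> powr t \<partial>lborel)"
          using t by (intro nn_integral_eq_integral intB continuous_intros vc) auto
        also have "\<dots> \<le> ennreal C" by (intro ennreal_leI C)
        finally show ?thesis .
      qed
    qed measurable
    finally show ?thesis .
  qed
  have "b * \<bar>m0\<bar> powr q \<le> 2 * Y"
  proof (rule LIMSEQ_le_const2)
    show "(\<lambda>n. b * \<bar>m (s n)\<bar> powr q) \<longlonglongrightarrow> b * \<bar>m0\<bar> powr q"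
      using q m0' by (intro tendsto_intros tendsto_powr') auto
  qed (use m(1) in auto)
  then show ?thesis
    using fatou[OF r m(2)] fatou[OF p(1) m(3)] unfolding Kr_def Kp_def by blast
qed

subsection \<open>Dyadic cells\<close>

text \<open>Summation over the scales, free of measure theory: \<open>X k\<close> and
  \<open>Y k\<close> stand for the integrals of |g|^p and |u|^q over an enlarged cell,
  \<open>I k\<close> for that of |u - m k|^r over the cell. The identity for c is the scaling
  condition that splits the weight 2^(ck) into the powers of 2^(bk) and 2^(ak) attached to
  \<open>X k\<close> and \<open>Y k\<close>.\<close>

lemma cells_sum_bound:
  fixes a b c p q r \<theta> \<kappa> N C1 C2 C3 :: real
  assumes emb: "seq_embed q p r ((a + N) / q) ((b - p + N) / p) ((c + N) / r)"
    and p: "1 \<le> p" "p \<le> r" and q: "1 \<le> q" "q \<le> r" and \<theta>: "0 \<le> \<theta>" "\<theta> \<le> 1" and N: "1 \<le> N"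
    and c: "(c + N) / r = (1 - \<theta>) * ((a + N) / q) + \<theta> * ((b - p + N) / p)"
    and \<kappa>: "\<kappa> = r * (\<theta> * (1 / p - 1 / N) + (1 - \<theta>) / q)"
    and C: "0 \<le> C1" "0 \<le> C2" "0 \<le> C3"
  shows "\<exists>K\<ge>0. \<forall>(X::int \<Rightarrow> real) Y m I P.
    0 \<le> P \<longrightarrow> (\<forall>k. 0 \<le> X k \<and> 0 \<le> Y k \<and> 0 \<le> I k) \<longrightarrow>
    (\<forall>F. finite F \<longrightarrow> (\<Sum>k\<in>F. 2 powr (a * of_int k) * Y k) \<le> P powr q) \<longrightarrow>
    (\<forall>F. finite F \<longrightarrow> (\<Sum>k\<in>F. 2 powr (b * of_int k) * X k) \<le> P powr p) \<longrightarrow>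
    (\<forall>k. 2 powr (N * of_int k) * \<bar>m k\<bar> powr q \<le> C1 * Y k) \<longrightarrow>
    (\<forall>k. 2 powr (N * of_int k) * \<bar>m k - m (k + 1)\<bar> powr p \<le> C2 * (2 powr (p * of_int k) * X k + 2 powr (p * of_int (k + 1)) * X (k + 1))) \<longrightarrow>
    (\<forall>k. I k \<le> C3 * 2 powr (N * (1 - \<kappa>) * of_int k) * (X k powr (\<theta> * r / p) * Y k powr ((1 - \<theta>) * r / q))) \<longrightarrow>
    (\<forall>F. finite F \<longrightarrow> (\<Sum>k\<in>F. 2 powr (c * of_int k) * (I k + 2 powr (N * of_int k) * \<bar>m k\<bar> powr r)) \<le> K * P powr r)"
proof -
  have r: "1 \<le> r" using p by simp
  have pw: "(2 powr (s / t * x) * \<bar>y\<bar>) powr t = 2 powr (s * x) * \<bar>y\<bar> powr t" if "t \<ge> 1" for s t x y :: real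
    using that by (simp add: powr_mult powr_powr)
  have pa: "2 powr ((s + t) * x) = 2 powr (s * x) * 2 powr (t * x)" for s t x :: real
    by (simp only: distrib_right powr_add)
  from emb obtain K where K: "K \<ge> 0" and
    H': "\<forall>(m::int \<Rightarrow> real) M. 0 \<le> M \<longrightarrow>
     (\<forall>F. finite F \<longrightarrow> (\<Sum>k\<in>F. (2 powr ((a + N) / q * real_of_int k) * \<bar>m k\<bar>) powr q) \<le> M powr q) \<longrightarrow>
     (\<forall>F. finite F \<longrightarrow> (\<Sum>k\<in>F. (2 powr ((b - p + N) / p * real_of_int k) * \<bar>m k - m (k + 1)\<bar>) powr p) \<le> M powr p) \<longrightarrow>
     (\<forall>F. finite F \<longrightarrow> (\<Sum>k\<in>F. (2 powr ((c + N) / r * real_of_int k) * \<bar>m k\<bar>) powr r) \<le> K * M powr r)"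
    unfolding seq_embed_def by (elim exE conjE)
  note H = H'[THEN spec, THEN spec, THEN mp, THEN mp, THEN mp, THEN spec, THEN mp]
  \<comment> \<open>The increment bound involves X at k and at k+1; reindexing the second term costs
    2^(p-b).\<close>
  define C2' where "C2' = C2 * (1 + 2 powr (p - b))"
  have C2': "C2' \<ge> 0" using C by (simp add: C2'_def)
  \<comment> \<open>T moves both constants into one bound M = T P; T >= 1 gives T <= T^q and T <=
    T^p.\<close>
  define T where "T = max 1 (max C1 C2')"
  have T: "T \<ge> 1" "C1 \<le> T" "C2' \<le> T" by (auto simp: T_def)
  have Tp: "C1 \<le> T powr q" "C2' \<le> T powr p"
    using T powr_mono[of 1 q T] powr_mono[of 1 p T] p q by auto
  show ?thesis
  proof (intro exI[of _ "2 * C3 + K * T powr r"] conjI allI impI)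
    show "0 \<le> 2 * C3 + K * T powr r" using C K by simp
    fix X Y m I :: "int \<Rightarrow> real" and P :: real and F :: "int set"
    assume P: "0 \<le> P" and nn: "\<forall>k. 0 \<le> X k \<and> 0 \<le> Y k \<and> 0 \<le> I k"
      and sY: "\<forall>F. finite F \<longrightarrow> (\<Sum>k\<in>F. 2 powr (a * real_of_int k) * Y k) \<le> P powr q"
      and sX: "\<forall>F. finite F \<longrightarrow> (\<Sum>k\<in>F. 2 powr (b * real_of_int k) * X k) \<le> P powr p"
      and mY: "\<forall>k. 2 powr (N * real_of_int k) * \<bar>m k\<bar> powr q \<le> C1 * Y k"
      and mX: "\<forall>k. 2 powr (N * real_of_int k) * \<bar>m k - m (k + 1)\<bar> powr p \<le> C2 * (2 powr (p * of_int k) * X k + 2 powr (p * of_int (k + 1)) * X (k + 1))"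
      and IXY: "\<forall>k. I k \<le> C3 * 2 powr (N * (1 - \<kappa>) * of_int k) * (X k powr (\<theta> * r / p) * Y k powr ((1 - \<theta>) * r / q))"
      and F: "finite F"
    define M where "M = T * P"
    have M: "0 \<le> M" using T P by (simp add: M_def)
    have Mp: "T powr s * P powr s = M powr s" for s using T P by (simp add: M_def powr_mult)
    have 1: "\<forall>F. finite F \<longrightarrow> (\<Sum>k\<in>F. (2 powr ((a + N) / q * real_of_int k) * \<bar>m k\<bar>) powr q) \<le> M powr q"
    proof (intro allI impI)
      fix F :: "int set" assume F: "finite F"
      have "(\<Sum>k\<in>F. (2 powr ((a + N) / q * real_of_int k) * \<bar>m k\<bar>) powr q) \<le> (\<Sum>k\<in>F. C1 * (2 powr (a * of_int k) * Y k))"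
      proof (rule sum_mono)
        fix k
        have "(2 powr ((a + N) / q * real_of_int k) * \<bar>m k\<bar>) powr q = 2 powr (a * of_int k) * (2 powr (N * of_int k) * \<bar>m k\<bar> powr q)"
          by (simp only: pw[OF q(1)] pa mult.assoc)
        also have "\<dots> \<le> 2 powr (a * of_int k) * (C1 * Y k)" using mY by (intro mult_left_mono) auto
        finally show "(2 powr ((a + N) / q * real_of_int k) * \<bar>m k\<bar>) powr q \<le> C1 * (2 powr (a * of_int k) * Y k)" by (simp add: mult_ac)
      qed
      also have "\<dots> = C1 * (\<Sum>k\<in>F. 2 powr (a * of_int k) * Y k)" by (simp only: sum_distrib_left)
      also have "\<dots> \<le> C1 * P powr q" by (rule mult_left_mono[OF sY[rule_format, OF F] C(1)])
      also have "\<dots> \<le> T powr q * P powr q" using Tp by (intro mult_right_mono) auto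
      finally show "(\<Sum>k\<in>F. (2 powr ((a + N) / q * real_of_int k) * \<bar>m k\<bar>) powr q) \<le> M powr q" by (simp only: Mp)
    qed
    have 2: "\<forall>F. finite F \<longrightarrow> (\<Sum>k\<in>F. (2 powr ((b - p + N) / p * real_of_int k) * \<bar>m k - m (k + 1)\<bar>) powr p) \<le> M powr p"
    proof (intro allI impI)
      fix F :: "int set" assume F: "finite F"
      define B where "B k = 2 powr (b * real_of_int k) * X k" for k
      have "(\<Sum>k\<in>F. (2 powr ((b - p + N) / p * real_of_int k) * \<bar>m k - m (k + 1)\<bar>) powr p) \<le> (\<Sum>k\<in>F. C2 * (B k + 2 powr (p - b) * B (k + 1)))"
      proof (rule sum_mono)
        fix k
        have "(2 powr ((b - p + N) / p * real_of_int k) * \<bar>m k - m (k + 1)\<bar>) powr p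
            = 2 powr ((b - p) * of_int k) * (2 powr (N * of_int k) * \<bar>m k - m (k + 1)\<bar> powr p)"
          by (simp only: pw[OF p(1)] pa mult.assoc)
        also have "\<dots> \<le> 2 powr ((b - p) * of_int k) * (C2 * (2 powr (p * of_int k) * X k + 2 powr (p * of_int (k + 1)) * X (k + 1)))"
          using mX by (intro mult_left_mono) auto
        also have "\<dots> = C2 * ((2 powr ((b - p) * of_int k) * 2 powr (p * of_int k)) * X k + (2 powr ((b - p) * of_int k) * 2 powr (p * of_int (k + 1))) * X (k + 1))"
          by (simp add: algebra_simps)
        also have "2 powr ((b - p) * real_of_int k) * 2 powr (p * real_of_int k) = 2 powr (b * real_of_int k)"
          by (simp flip: powr_add add: algebra_simps)
        also have "2 powr ((b - p) * real_of_int k) * 2 powr (p * real_of_int (k + 1)) = 2 powr (p - b) * 2 powr (b * real_of_int (k + 1))"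
          by (simp flip: powr_add add: algebra_simps)
        finally show "(2 powr ((b - p + N) / p * real_of_int k) * \<bar>m k - m (k + 1)\<bar>) powr p \<le> C2 * (B k + 2 powr (p - b) * B (k + 1))"
          by (simp only: B_def mult.assoc)
      qed
      also have "\<dots> = C2 * ((\<Sum>k\<in>F. B k) + 2 powr (p - b) * (\<Sum>k\<in>F. B (k + 1)))"
        by (simp only: sum_distrib_left[symmetric] sum.distrib)
      also have "(\<Sum>k\<in>F. B (k + 1)) = (\<Sum>k\<in>(\<lambda>k. k + 1) ` F. B k)" by (subst sum.reindex) (auto simp: inj_on_def)
      also have "C2 * ((\<Sum>k\<in>F. B k) + 2 powr (p - b) * (\<Sum>k\<in>(\<lambda>k. k + 1) ` F. B k)) \<le> C2 * (P powr p + 2 powr (p - b) * P powr p)"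
        unfolding B_def using C sX F by (intro mult_left_mono add_mono) auto
      also have "\<dots> = C2' * P powr p" by (simp add: C2'_def algebra_simps)
      also have "\<dots> \<le> T powr p * P powr p" using Tp by (intro mult_right_mono) auto
      finally show "(\<Sum>k\<in>F. (2 powr ((b - p + N) / p * real_of_int k) * \<bar>m k - m (k + 1)\<bar>) powr p) \<le> M powr p" by (simp only: Mp)
    qed
    have 3: "(\<Sum>k\<in>F. (2 powr ((c + N) / r * real_of_int k) * \<bar>m k\<bar>) powr r) \<le> K * M powr r"
      by (rule H[OF M 1 2 F])
    have 4: "(\<Sum>k\<in>F. 2 powr (c * of_int k) * I k) \<le> C3 * (2 * P powr r)"
    proof -
      have "(\<Sum>k\<in>F. 2 powr (c * of_int k) * I k)
        \<le> (\<Sum>k\<in>F. C3 * ((2 powr (b * of_int k) * X k) powr (\<theta> * r / p) * (2 powr (a * of_int k) * Y k) powr ((1 - \<theta>) * r / q)))"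
      proof (rule sum_mono)
        fix k
        \<comment> \<open>Exact cancellation of scales: the -p in b - p is balanced by the -1/N in
          \<kappa>. With reciprocals as separate variables the identity is polynomial.\<close>
        have ex: "c + N * (1 - \<kappa>) = b * (\<theta> * r / p) + a * ((1 - \<theta>) * r / q)"
        proof -
          define p' q' N' where "p' = 1 / p" and "q' = 1 / q" and "N' = 1 / N"
          have inv: "p * p' = 1" "N * N' = 1" using p N by (auto simp: p'_def N'_def)
          have "c + N = r * ((c + N) / r)" using r by simp
          then have "c + N = r * ((1 - \<theta>) * ((a + N) * q') + \<theta> * ((b - p + N) * p'))"
            by (simp only: c p'_def q'_def) simp
          moreover have "\<kappa> = r * (\<theta> * (p' - N') + (1 - \<theta>) * q')" by (simp add: \<kappa> p'_def q'_def N'_def)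
          ultimately have "c + N * (1 - \<kappa>) = b * (\<theta> * r * p') + a * ((1 - \<theta>) * r * q')"
            using inv by algebra
          then show ?thesis by (simp add: p'_def q'_def)
        qed
        have "2 powr (c * of_int k) * I k \<le> 2 powr (c * of_int k) * (C3 * 2 powr (N * (1 - \<kappa>) * of_int k) * (X k powr (\<theta> * r / p) * Y k powr ((1 - \<theta>) * r / q)))"
          using IXY by (intro mult_left_mono) auto
        also have "\<dots> = C3 * ((2 powr (c * of_int k) * 2 powr (N * (1 - \<kappa>) * of_int k)) * (X k powr (\<theta> * r / p) * Y k powr ((1 - \<theta>) * r / q)))"
          by (simp only: mult_ac)
        also have "2 powr (c * of_int k) * 2 powr (N * (1 - \<kappa>) * of_int k) = 2 powr ((c + N * (1 - \<kappa>)) * of_int k)"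
          by (simp only: powr_add distrib_right)
        also have "\<dots> = 2 powr (b * of_int k * (\<theta> * r / p)) * 2 powr (a * of_int k * ((1 - \<theta>) * r / q))"
          unfolding ex pa by (simp only: mult_ac)
        also have "C3 * (\<dots> * (X k powr (\<theta> * r / p) * Y k powr ((1 - \<theta>) * r / q)))
          = C3 * ((2 powr (b * of_int k) * X k) powr (\<theta> * r / p) * (2 powr (a * of_int k) * Y k) powr ((1 - \<theta>) * r / q))"
          using nn by (simp add: powr_mult powr_powr mult_ac)
        finally show "2 powr (c * of_int k) * I k \<le> C3 * ((2 powr (b * of_int k) * X k) powr (\<theta> * r / p) * (2 powr (a * of_int k) * Y k) powr ((1 - \<theta>) * r / q))" .
      qed
      also have "\<dots> = C3 * (\<Sum>k\<in>F. (2 powr (b * of_int k) * X k) powr (\<theta> * r / p) * (2 powr (a * of_int k) * Y k) powr ((1 - \<theta>) * r / q))"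
        by (simp only: sum_distrib_left)
      also have "\<dots> \<le> C3 * (2 * ((P powr p) powr (\<theta> * r / p) * (P powr q) powr ((1 - \<theta>) * r / q)))"
      proof (intro mult_left_mono sum_powr_mult_le F)
        show "0 \<le> \<theta> * r / p" "0 \<le> (1 - \<theta>) * r / q" using \<theta> r p q by auto
        have "\<theta> * 1 \<le> \<theta> * (r / p)" "(1 - \<theta>) * 1 \<le> (1 - \<theta>) * (r / q)" using \<theta> p q by (intro mult_left_mono; simp)+
        then show "1 \<le> \<theta> * r / p + (1 - \<theta>) * r / q" by simp
      qed (use nn sX sY F C in auto)
      also have "(P powr p) powr (\<theta> * r / p) * (P powr q) powr ((1 - \<theta>) * r / q) = P powr (\<theta> * r) * P powr ((1 - \<theta>) * r)"
        using p q by (simp add: powr_powr)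
      also have "\<dots> = P powr r" by (simp flip: powr_add add: algebra_simps)
      finally show ?thesis .
    qed
    have "(\<Sum>k\<in>F. 2 powr (c * of_int k) * (I k + 2 powr (N * of_int k) * \<bar>m k\<bar> powr r))
       = (\<Sum>k\<in>F. 2 powr (c * of_int k) * I k) + (\<Sum>k\<in>F. (2 powr ((c + N) / r * real_of_int k) * \<bar>m k\<bar>) powr r)"
      unfolding sum.distrib[symmetric]
      by (intro sum.cong refl) (simp only: pw[OF r] pa distrib_left mult.assoc)
    also have "\<dots> \<le> C3 * (2 * P powr r) + K * M powr r" by (rule add_mono[OF 4 3])
    finally show "(\<Sum>k\<in>F. 2 powr (c * of_int k) * (I k + 2 powr (N * of_int k) * \<bar>m k\<bar> powr r)) \<le> (2 * C3 + K * T powr r) * P powr r"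
      by (simp add: algebra_simps Mp[symmetric])
  qed
qed

section \<open>Geometry of the dyadic cells\<close>

definition dyadic_cell :: "'a::euclidean_space \<Rightarrow> int \<Rightarrow> 'a set" where
  "dyadic_cell e k = ball ((2 powr of_int k) *\<^sub>R e) (2 powr of_int k)"

text \<open>The enlargement provides room for mollification. For |e| = 2 the radius 3/2, in units of
  2^k, still leaves distance 1/2 to the origin.\<close>

definition dyadic_ecell :: "'a::euclidean_space \<Rightarrow> int \<Rightarrow> 'a set" where
  "dyadic_ecell e k = cball ((2 powr of_int k) *\<^sub>R e) (3 / 2 * 2 powr of_int k)"

lemma dyadic_cell_subset: "dyadic_cell e k \<subseteq> dyadic_ecell e k"
proof -
  have "2 powr real_of_int k \<le> 3 / 2 * 2 powr real_of_int k" by simp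
  then have "ball c (2 powr real_of_int k) \<subseteq> cball c (3 / 2 * 2 powr real_of_int k)" for c :: 'a
    by (meson ball_subset_cball order_trans subset_cball)
  then show ?thesis unfolding dyadic_cell_def dyadic_ecell_def .
qed

lemma norm_dyadic_ecell:
  assumes e: "norm e = 2" and x: "x \<in> dyadic_ecell e k"
  shows "1 / 2 * 2 powr of_int k \<le> norm x" "norm x \<le> 7 / 2 * 2 powr of_int k"
proof -
  define w where "w = (2::real) powr of_int k"
  have w: "w > 0" by (simp add: w_def)
  have d: "norm (w *\<^sub>R e - x) \<le> 3 / 2 * w" using x by (simp add: dyadic_ecell_def dist_norm w_def)
  have n: "norm (w *\<^sub>R e) = 2 * w" using e w by simp
  show "1 / 2 * 2 powr of_int k \<le> norm x" "norm x \<le> 7 / 2 * 2 powr of_int k"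
    using norm_triangle_ineq2[of "w *\<^sub>R e" x] norm_triangle_ineq3[of "w *\<^sub>R e" x] d n by (auto simp: w_def)
qed

text \<open>On an enlarged cell |x|/2^k ranges within [1/2, 7/2]. Since d may have either sign, its
  extreme powers can occur at either end.\<close>

definition lo_const :: "real \<Rightarrow> real" where "lo_const d = min ((1 / 2) powr d) ((7 / 2) powr d)"
definition hi_const :: "real \<Rightarrow> real" where "hi_const d = max ((1 / 2) powr d) ((7 / 2) powr d)"

lemma lo_const_pos: "lo_const d > 0" by (simp add: lo_const_def)
lemma hi_const_pos: "hi_const d > 0" by (simp add: hi_const_def less_max_iff_disj)

lemma norm_powr_dyadic_ecell:
  assumes e: "norm e = 2" and x: "x \<in> dyadic_ecell e k"
  shows "lo_const d * 2 powr (d * of_int k) \<le> norm x powr d" "norm x powr d \<le> hi_const d * 2 powr (d * of_int k)"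
proof -
  define w where "w = (2::real) powr of_int k"
  have w: "w > 0" by (simp add: w_def)
  define t where "t = norm x / w"
  have t: "1 / 2 \<le> t" "t \<le> 7 / 2" using norm_dyadic_ecell[OF e x] w by (auto simp: t_def w_def[symmetric] field_simps)
  have "norm x powr d = t powr d * w powr d" using w t by (simp add: t_def flip: powr_mult)
  also have "w powr d = 2 powr (d * of_int k)" by (simp add: w_def powr_powr mult.commute)
  finally have eq: "norm x powr d = t powr d * 2 powr (d * of_int k)" .
  have "lo_const d \<le> t powr d \<and> t powr d \<le> hi_const d"
  proof (cases "d \<ge> 0")
    case True
    have "(1 / 2) powr d \<le> t powr d" "t powr d \<le> (7 / 2) powr d" using t True by (intro powr_mono2; simp)+
    then show ?thesis by (auto simp: lo_const_def hi_const_def)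
  next
    case False
    have "(7 / 2) powr d \<le> t powr d" "t powr d \<le> (1 / 2) powr d" using t False by (intro powr_mono2'; simp)+
    then show ?thesis by (auto simp: lo_const_def hi_const_def)
  qed
  then show "lo_const d * 2 powr (d * of_int k) \<le> norm x powr d" "norm x powr d \<le> hi_const d * 2 powr (d * of_int k)"
    unfolding eq by (auto intro: mult_right_mono)
qed

text \<open>If the cells with indices i < k share a point, comparing the two ranges of |x| gives
  2^(k-i) <= 7 < 8, so k - i <= 2. Hence all cells through a point have indices within 2 of a fixed
  one, which leaves 5.\<close>

lemma dyadic_ecell_overlap:
  assumes e: "norm e = 2" and F: "finite F"
  shows "(\<Sum>k\<in>F. indicator (dyadic_ecell e k) x) \<le> (5::ennreal)"
proof (cases "\<exists>j\<in>F. x \<in> dyadic_ecell e j")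
  case True
  then obtain j where j: "x \<in> dyadic_ecell e j" by blast
  have close: "k - i \<le> 2" if "x \<in> dyadic_ecell e k" "x \<in> dyadic_ecell e i" for k i
  proof (rule ccontr)
    assume "\<not> k - i \<le> 2"
    then have "2 powr (real_of_int i + 3) \<le> 2 powr (real_of_int k)" by (intro powr_mono) linarith+
    then have "8 * 2 powr (real_of_int i) \<le> 2 powr (real_of_int k)" by (simp add: powr_add powr_numeral)
    moreover have "1 / 2 * 2 powr real_of_int k \<le> 7 / 2 * 2 powr real_of_int i"
      using norm_dyadic_ecell(1)[OF e that(1)] norm_dyadic_ecell(2)[OF e that(2)] by linarith
    ultimately have "2 powr (real_of_int i) \<le> (0::real)" by linarith
    then show False by (simp add: not_le[symmetric])
  qed
  have "(\<Sum>k\<in>F. indicator (dyadic_ecell e k) x) = (\<Sum>k\<in>F \<inter> {j - 2..j + 2}. indicator (dyadic_ecell e k) x :: ennreal)"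
  proof (rule sum.mono_neutral_right[OF F])
    show "\<forall>k\<in>F - F \<inter> {j - 2..j + 2}. indicator (dyadic_ecell e k) x = (0::ennreal)"
    proof
      fix k assume k: "k \<in> F - F \<inter> {j - 2..j + 2}"
      show "indicator (dyadic_ecell e k) x = (0::ennreal)"
      proof (cases "x \<in> dyadic_ecell e k")
        case True
        then show ?thesis using k close[OF True j] close[OF j True] by auto
      qed simp
    qed
  qed auto
  also have "\<dots> \<le> (\<Sum>k\<in>F \<inter> {j - 2..j + 2}. 1)" by (intro sum_mono) (auto simp: indicator_def)
  also have "\<dots> = of_nat (card (F \<inter> {j - 2..j + 2}))" by simp
  also have "\<dots> \<le> of_nat (card {j - 2..j + 2})" by (intro of_nat_mono card_mono) auto
  also have "\<dots> = 5" by simp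
  finally show ?thesis .
next
  case False
  then have "(\<Sum>k\<in>F. indicator (dyadic_ecell e k) x) = (0::ennreal)" by (intro sum.neutral) auto
  then show ?thesis by simp
qed

text \<open>On each cell |x|^d is replaced by 2^(dk) at the cost of \<open>lo_const d\<close>, and
  bounded overlap counts every point at most 5 times.\<close>

lemma dyadic_ecell_sums:
  fixes h :: "'a::euclidean_space \<Rightarrow> real" and e :: 'a
  assumes e: "norm e = 2" and h[measurable]: "h \<in> borel_measurable lebesgue" and h0: "\<And>x. 0 \<le> h x"
    and fin: "(\<integral>\<^sup>+x. ennreal (norm x powr d * h x) \<partial>lebesgue) = ennreal W" "0 \<le> W"
  shows "(\<integral>\<^sup>+x. ennreal (h x) * indicator (dyadic_ecell e k) x \<partial>lebesgue) < \<infinity>"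
    and "finite F \<Longrightarrow> (\<Sum>k\<in>F. 2 powr (d * of_int k) * enn2real (\<integral>\<^sup>+x. ennreal (h x) * indicator (dyadic_ecell e k) x \<partial>lebesgue)) \<le> 5 / lo_const d * W"
proof -
  define J where "J k = (\<integral>\<^sup>+x. ennreal (h x) * indicator (dyadic_ecell e k) x \<partial>lebesgue)" for k
  have cm[measurable]: "dyadic_ecell e k \<in> sets lebesgue" for k by (simp add: dyadic_ecell_def)
  have nm[measurable]: "norm \<in> borel_measurable (lebesgue :: 'a measure)" by (intro measurable_completion) simp
  have main: "(\<Sum>k\<in>F. ennreal (lo_const d * 2 powr (d * of_int k)) * J k) \<le> 5 * ennreal W" if F: "finite F" for F
  proof -
    have "(\<Sum>k\<in>F. ennreal (lo_const d * 2 powr (d * of_int k)) * J k) = (\<Sum>k\<in>F. \<integral>\<^sup>+x. ennreal (lo_const d * 2 powr (d * of_int k)) * (ennreal (h x) * indicator (dyadic_ecell e k) x) \<partial>lebesgue)"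
      unfolding J_def by (intro sum.cong refl nn_integral_cmult[symmetric]) measurable
    also have "\<dots> = (\<integral>\<^sup>+x. (\<Sum>k\<in>F. ennreal (lo_const d * 2 powr (d * of_int k)) * (ennreal (h x) * indicator (dyadic_ecell e k) x)) \<partial>lebesgue)"
      by (intro nn_integral_sum[symmetric]) measurable
    also have "\<dots> \<le> (\<integral>\<^sup>+x. 5 * ennreal (norm x powr d * h x) \<partial>lebesgue)"
    proof (rule nn_integral_mono)
      fix x
      have "(\<Sum>k\<in>F. ennreal (lo_const d * 2 powr (d * of_int k)) * (ennreal (h x) * indicator (dyadic_ecell e k) x))
        \<le> (\<Sum>k\<in>F. ennreal (norm x powr d * h x) * indicator (dyadic_ecell e k) x)"
      proof (rule sum_mono)
        fix k
        show "ennreal (lo_const d * 2 powr (d * of_int k)) * (ennreal (h x) * indicator (dyadic_ecell e k) x) \<le> ennreal (norm x powr d * h x) * indicator (dyadic_ecell e k) x"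
        proof (cases "x \<in> dyadic_ecell e k")
          case True
          have "ennreal (lo_const d * 2 powr (d * of_int k)) * ennreal (h x) = ennreal (lo_const d * 2 powr (d * of_int k) * h x)"
            using lo_const_pos[of d] h0 by (intro ennreal_mult[symmetric]) auto
          also have "\<dots> \<le> ennreal (norm x powr d * h x)"
            using norm_powr_dyadic_ecell(1)[OF e True] h0 by (intro ennreal_leI mult_right_mono) auto
          finally show ?thesis using True by simp
        qed simp
      qed
      also have "\<dots> = ennreal (norm x powr d * h x) * (\<Sum>k\<in>F. indicator (dyadic_ecell e k) x)"
        by (simp only: sum_distrib_left)
      also have "\<dots> \<le> ennreal (norm x powr d * h x) * 5"
        by (intro mult_left_mono dyadic_ecell_overlap e F) simp
      finally show "(\<Sum>k\<in>F. ennreal (lo_const d * 2 powr (d * of_int k)) * (ennreal (h x) * indicator (dyadic_ecell e k) x)) \<le> 5 * ennreal (norm x powr d * h x)"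
        by (simp add: mult.commute)
    qed
    also have "\<dots> = 5 * ennreal W" unfolding fin(1)[symmetric] by (rule nn_integral_cmult) measurable
    finally show ?thesis .
  qed
  have fin5: "5 * ennreal W < \<infinity>" by (simp add: ennreal_mult_less_top)
  have Jfin: "J k < \<infinity>" for k
  proof -
    have "ennreal (lo_const d * 2 powr (d * of_int k)) * J k < \<infinity>"
      using main[of "{k}"] fin5 by (simp add: order.strict_trans1)
    moreover have "0 < lo_const d * 2 powr (d * of_int k)" using lo_const_pos by simp
    ultimately show ?thesis by (auto simp: ennreal_mult_less_top)
  qed
  then show "(\<integral>\<^sup>+x. ennreal (h x) * indicator (dyadic_ecell e k) x \<partial>lebesgue) < \<infinity>" by (simp add: J_def)
  assume F: "finite F"
  have "ennreal (\<Sum>k\<in>F. lo_const d * 2 powr (d * of_int k) * enn2real (J k)) = (\<Sum>k\<in>F. ennreal (lo_const d * 2 powr (d * of_int k)) * J k)"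
    using lo_const_pos[of d] Jfin by (subst sum_ennreal[symmetric]) (auto simp: ennreal_mult less_top[symmetric])
  also have "\<dots> \<le> 5 * ennreal W" by (rule main[OF F])
  also have "\<dots> = ennreal (5 * W)" using fin(2) by (simp add: ennreal_mult)
  finally have "(\<Sum>k\<in>F. lo_const d * 2 powr (d * of_int k) * enn2real (J k)) \<le> 5 * W"
    using fin(2) by (subst (asm) ennreal_le_iff) auto
  then have "lo_const d * (\<Sum>k\<in>F. 2 powr (d * of_int k) * enn2real (J k)) \<le> 5 * W"
    by (simp add: sum_distrib_left mult.assoc)
  then show "(\<Sum>k\<in>F. 2 powr (d * of_int k) * enn2real (\<integral>\<^sup>+x. ennreal (h x) * indicator (dyadic_ecell e k) x \<partial>lebesgue)) \<le> 5 / lo_const d * W"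
    using lo_const_pos[of d] by (simp add: J_def field_simps)
qed

text \<open>The tolerances 1/3 and 3/4 are matched. With w = 2^k the choice of k gives 4w/3 <= |x| <
  8w/3, so x is within 2w/3 of the point 2w x/|x|; the error in the direction adds less than w/3,
  and the total stays below the cell radius w.\<close>

lemma dyadic_cells_cover:
  "\<exists>S. finite S \<and> (\<forall>e\<in>S. norm e = 2) \<and> (\<forall>x::'a::euclidean_space. x \<noteq> 0 \<longrightarrow> (\<exists>e\<in>S. \<exists>k. x \<in> dyadic_cell e k))"
proof -
  have cp: "compact (sphere (0::'a) 2)" by simp
  have cov: "sphere (0::'a) 2 \<subseteq> (\<Union>e\<in>sphere 0 2. ball e (1 / 3))"
  proof
    fix x :: 'a assume "x \<in> sphere 0 2"
    then show "x \<in> (\<Union>e\<in>sphere 0 2. ball e (1 / 3))" by (intro UN_I[of x]) auto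
  qed
  obtain S where S: "S \<subseteq> sphere 0 2" "finite S" "sphere (0::'a) 2 \<subseteq> (\<Union>e\<in>S. ball e (1 / 3))"
    by (rule compactE_image[OF cp _ cov]) auto
  show ?thesis
  proof (intro exI[of _ S] conjI ballI allI impI S(2))
    show "norm e = 2" if "e \<in> S" for e using S(1) that by auto
    fix x :: 'a assume x: "x \<noteq> 0"
    define k where "k = \<lfloor>log 2 (3 / 4 * norm x)\<rfloor>"
    define w where "w = (2::real) powr of_int k"
    have w: "w > 0" by (simp add: w_def)
    have "of_int k \<le> log 2 (3 / 4 * norm x)" "log 2 (3 / 4 * norm x) < of_int k + 1"
      unfolding k_def by linarith+
    then have "w \<le> 3 / 4 * norm x" "3 / 4 * norm x < 2 powr (of_int k + 1)"
      using x by (auto simp: w_def le_log_iff less_log_iff log_less_iff)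
    then have nx: "w \<le> 3 / 4 * norm x" "3 / 4 * norm x < 2 * w" by (auto simp: w_def powr_add)
    define y where "y = (2 / norm x) *\<^sub>R x"
    have "norm y = 2" using x by (simp add: y_def)
    then obtain e where e: "e \<in> S" "dist e y < 1 / 3" using S(3) by (force simp: dist_norm)
    have "norm (w *\<^sub>R e - x) \<le> norm (w *\<^sub>R e - w *\<^sub>R y) + norm (w *\<^sub>R y - x)"
      using norm_triangle_ineq[of "w *\<^sub>R e - w *\<^sub>R y" "w *\<^sub>R y - x"] by simp
    also have "norm (w *\<^sub>R e - w *\<^sub>R y) = w * dist e y" using w by (simp add: dist_norm flip: scaleR_diff_right)
    also have "\<dots> < w * (1 / 3)" using e w by (intro mult_strict_left_mono)
    also have "w *\<^sub>R y - x = ((2 * w - norm x) / norm x) *\<^sub>R x" using x by (simp add: y_def algebra_simps diff_divide_distrib)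
    also have "norm \<dots> = \<bar>2 * w - norm x\<bar>" using x by simp
    also have "\<bar>2 * w - norm x\<bar> \<le> w * (2 / 3)" using nx by (auto simp: abs_if)
    finally have "norm (w *\<^sub>R e - x) < w" by simp
    then show "\<exists>e\<in>S. \<exists>k. x \<in> dyadic_cell e k"
      using e by (intro bexI[of _ e] exI[of _ k]) (auto simp: dyadic_cell_def w_def dist_norm)
  qed
qed

text \<open>For g, measurability has to be extracted from local integrability: g is the limit of its
  restrictions to compact annuli exhausting the punctured space, except at 0, which is a null
  set.\<close>

lemma weak_grad_measurable:
  assumes w: "weak_grad_punct u (g :: 'a::euclidean_space \<Rightarrow> 'a)"
  shows "g \<in> borel_measurable lebesgue"
proof -
  define K where "K n = cball (0::'a) (real n) - ball 0 (1 / real (Suc n))" for n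
  have K: "compact (K n)" "0 \<notin> K n" for n
    by (auto simp: K_def intro: compact_diff)
  from w have lg: "\<forall>S. compact S \<and> 0 \<notin> S \<longrightarrow> set_integrable lebesgue S g"
    unfolding weak_grad_punct_def loc_int_punct_def by (elim conjE)
  have m: "(\<lambda>x. indicator (K n) x *\<^sub>R g x) \<in> borel_measurable lebesgue" for n
  proof -
    have "set_integrable lebesgue (K n) g" by (rule mp[OF spec[OF lg]]) (intro conjI K)
    then show ?thesis unfolding set_integrable_def by (rule borel_measurable_integrable)
  qed
  have lim: "(\<lambda>n. indicator (K n) x *\<^sub>R g x) \<longlonglongrightarrow> (if x = 0 then 0 else g x)" for x
  proof (cases "x = 0")
    case False
    obtain n1 where n1: "norm x \<le> real n1" using real_arch_simple by blast
    obtain n2 where n2: "1 / real (Suc n2) < norm x" using nat_approx_posE[of "norm x"] False by auto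
    have "x \<in> K n" if "n \<ge> max n1 n2" for n
    proof -
      have "1 / real (Suc n) \<le> 1 / real (Suc n2)" using that by (intro divide_left_mono) auto
      then show ?thesis using that n1 n2 by (auto simp: K_def)
    qed
    then have "\<forall>\<^sub>F n in sequentially. indicator (K n) x *\<^sub>R g x = g x"
      unfolding eventually_sequentially by (intro exI[of _ "max n1 n2"]) auto
    then show ?thesis using False by (simp add: tendsto_eventually)
  qed (use K in simp)
  have "(\<lambda>x. if x = 0 then 0 else g x) \<in> borel_measurable lebesgue"
    by (rule borel_measurable_LIMSEQ_metric[OF m lim])
  moreover have "AE x in lebesgue. (if x = 0 then 0 else g x) = g x"
    by (rule AE_mp[OF AE_completion[OF AE_lborel_singleton[of 0]]]) auto
  ultimately show ?thesis by (rule borel_measurable_AE)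
qed

section \<open>Estimate along one ray and assembly of the rays\<close>

lemma nn_integral_cmult_add:
  assumes "f \<in> borel_measurable M" "g \<in> borel_measurable M"
  shows "(\<integral>\<^sup>+x. c * (f x + g x) \<partial>M) = c * ((\<integral>\<^sup>+x. f x \<partial>M) + (\<integral>\<^sup>+x. g x \<partial>M))"
  using assms by (simp add: nn_integral_cmult nn_integral_add)

text \<open>The bound is uniform in the finite set F of scales, so that monotone convergence can
  later exhaust all of them.\<close>

lemma direction_estimate:
  fixes a b c p q r \<theta> \<kappa> :: real and e :: "'a::euclidean_space"
  defines "N \<equiv> real DIM('a)"
  assumes e: "norm e = 2"
    and emb: "seq_embed q p r ((a + N) / q) ((b - p + N) / p) ((c + N) / r)"
    and p: "1 \<le> p" "p \<le> r" and q: "1 \<le> q" "q \<le> r" and \<theta>: "0 \<le> \<theta>" "\<theta> \<le> 1"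
    and c: "(c + N) / r = (1 - \<theta>) * ((a + N) / q) + \<theta> * ((b - p + N) / p)"
    and \<kappa>: "\<kappa> = r * (\<theta> * (1 / p - 1 / N) + (1 - \<theta>) / q)" "\<kappa> \<le> 1"
  shows "\<exists>K\<ge>0. \<forall>(u::'a \<Rightarrow> real) g F. u \<in> borel_measurable lebesgue \<and> weak_grad_punct u g
      \<and> wint a q u < \<infinity> \<and> wint b p g < \<infinity> \<and> finite F \<longrightarrow>
    (\<Sum>k\<in>F. \<integral>\<^sup>+x. ennreal (norm x powr c * \<bar>u x\<bar> powr r) * indicator (dyadic_cell e k) x \<partial>lebesgue)
      \<le> ennreal (K * (wnorm a q u + wnorm b p g) powr r)"
proof -
  have N: "N \<ge> 1" using DIM_positive[where 'a='a] unfolding N_def by linarith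
  have r: "r \<ge> 1" using p by simp
  define \<omega> where "\<omega> = unit_ball_vol N"
  have \<omega>: "\<omega> > 0" using N by (simp add: \<omega>_def)
  have GN0: "GN_const TYPE('a) s t \<ge> 0" for s t unfolding GN_const_def by simp
  \<comment> \<open>Constants of the cell estimates after inserting the cell volume \<omega> 2^(Nk):
    Cp for the Poincare inequality, C1 for the size of the median, C3 for the oscillation. The
    factor 2^N/\<omega> in C2 is the inverse volume, up to 2^(Nk), of the ball on which neighbouring
    medians are compared.\<close>
  define Cp where "Cp = 2 * GN_const TYPE('a) p 1 * \<omega> powr (p / N)"
  define C1 where "C1 = 2 / \<omega>"
  define C2 where "C2 = 2 powr p * Cp * (2 powr N / \<omega>)"
  define C3 where "C3 = 2 * GN_const TYPE('a) r \<theta> * \<omega> powr (1 - \<kappa>) * (2 powr q * 3) powr ((1 - \<theta>) * r / q)"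
  have C: "0 \<le> Cp" "0 \<le> C1" "0 \<le> C2" "0 \<le> C3" using \<omega> GN0 by (auto simp: Cp_def C1_def C2_def C3_def)
  obtain K where K: "K \<ge> 0" and KH: "\<forall>(X::int \<Rightarrow> real) Y m I P.
    0 \<le> P \<longrightarrow> (\<forall>k. 0 \<le> X k \<and> 0 \<le> Y k \<and> 0 \<le> I k) \<longrightarrow>
    (\<forall>F. finite F \<longrightarrow> (\<Sum>k\<in>F. 2 powr (a * of_int k) * Y k) \<le> P powr q) \<longrightarrow>
    (\<forall>F. finite F \<longrightarrow> (\<Sum>k\<in>F. 2 powr (b * of_int k) * X k) \<le> P powr p) \<longrightarrow>
    (\<forall>k. 2 powr (N * of_int k) * \<bar>m k\<bar> powr q \<le> C1 * Y k) \<longrightarrow>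
    (\<forall>k. 2 powr (N * of_int k) * \<bar>m k - m (k + 1)\<bar> powr p \<le> C2 * (2 powr (p * of_int k) * X k + 2 powr (p * of_int (k + 1)) * X (k + 1))) \<longrightarrow>
    (\<forall>k. I k \<le> C3 * 2 powr (N * (1 - \<kappa>) * of_int k) * (X k powr (\<theta> * r / p) * Y k powr ((1 - \<theta>) * r / q))) \<longrightarrow>
    (\<forall>F. finite F \<longrightarrow> (\<Sum>k\<in>F. 2 powr (c * of_int k) * (I k + 2 powr (N * of_int k) * \<bar>m k\<bar> powr r)) \<le> K * P powr r)"
    using cells_sum_bound[OF emb p q \<theta> N c \<kappa>(1) C(2,3,4)] by (elim exE conjE)
  note KH' = KH[THEN spec, THEN spec, THEN spec, THEN spec, THEN spec, THEN mp, THEN mp, THEN mp, THEN mp, THEN mp, THEN mp, THEN mp, THEN spec, THEN mp]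
  define T where "T = max 1 (max (5 / lo_const a) (5 / lo_const b))"
  have T: "T \<ge> 1" "5 / lo_const a \<le> T" "5 / lo_const b \<le> T" by (auto simp: T_def)
  have Tp: "5 / lo_const a \<le> T powr q" "5 / lo_const b \<le> T powr p"
    using T powr_mono[of 1 q T] powr_mono[of 1 p T] p q by auto
  \<comment> \<open>\<open>hi_const c\<close> replaces the weight, 2^r splits |u|^r into oscillation
    and median, and 1 + \<omega> covers the volume in the median term.\<close>
  define L where "L = hi_const c * 2 powr r * (1 + \<omega>)"
  have L: "L \<ge> 0" using hi_const_pos[of c] \<omega> by (simp add: L_def)
  have cellm[measurable]: "dyadic_cell e k \<in> sets lebesgue" for k by (simp add: dyadic_cell_def)
  have vol: "measure lborel (dyadic_cell e k) = \<omega> * 2 powr (N * of_int k)" for k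
    by (simp add: dyadic_cell_def content_ball \<omega>_def N_def powr_powr mult.commute flip: powr_realpow)
  have evol: "emeasure lebesgue (dyadic_cell e k) = ennreal (\<omega> * 2 powr (N * of_int k))" for k
    by (simp add: dyadic_cell_def emeasure_ball \<omega>_def N_def powr_powr mult.commute flip: powr_realpow)
  show ?thesis
  proof (intro exI[of _ "L * K * T powr r"] conjI allI impI)
    show "0 \<le> L * K * T powr r" using L K by simp
    fix u :: "'a \<Rightarrow> real" and g :: "'a \<Rightarrow> 'a" and F :: "int set"
    assume asm: "u \<in> borel_measurable lebesgue \<and> weak_grad_punct u g \<and> wint a q u < \<infinity> \<and> wint b p g < \<infinity> \<and> finite F"
    then have um[measurable]: "u \<in> borel_measurable lebesgue" and w: "weak_grad_punct u g" and F: "finite F"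
      and fin: "wint a q u < \<infinity>" "wint b p g < \<infinity>" by auto
    have gm[measurable]: "g \<in> borel_measurable lebesgue" by (rule weak_grad_measurable[OF w])
    define U where "U = enn2real (wint a q u)"
    define V where "V = enn2real (wint b p g)"
    have UV0: "0 \<le> U" "0 \<le> V" by (auto simp: U_def V_def)
    have U: "(\<integral>\<^sup>+x. ennreal (norm x powr a * \<bar>u x\<bar> powr q) \<partial>lebesgue) = ennreal U"
      using fin(1) by (simp add: U_def wint_def)
    have V: "(\<integral>\<^sup>+x. ennreal (norm x powr b * norm (g x) powr p) \<partial>lebesgue) = ennreal V"
      using fin(2) by (simp add: V_def wint_def)
    have Uq: "U = wnorm a q u powr q" and Vp: "V = wnorm b p g powr p"
      using p q UV0 by (simp_all add: wnorm_def U_def V_def powr_powr)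
    define P where "P = T * (wnorm a q u + wnorm b p g)"
    have wn0: "0 \<le> wnorm a q u" "0 \<le> wnorm b p g" by (auto simp: wnorm_def)
    have P: "P \<ge> 0" using T wn0 by (simp add: P_def)
    have PU: "5 / lo_const a * U \<le> P powr q"
    proof -
      have "5 / lo_const a * U \<le> T powr q * (wnorm a q u + wnorm b p g) powr q"
        unfolding Uq using Tp wn0 q lo_const_pos[of a] by (intro mult_mono powr_mono2) auto
      then show ?thesis using T wn0 by (simp add: P_def powr_mult)
    qed
    have PV: "5 / lo_const b * V \<le> P powr p"
    proof -
      have "5 / lo_const b * V \<le> T powr p * (wnorm a q u + wnorm b p g) powr p"
        unfolding Vp using Tp wn0 p lo_const_pos[of b] by (intro mult_mono powr_mono2) auto
      then show ?thesis using T wn0 by (simp add: P_def powr_mult)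
    qed
    define Y where "Y k = enn2real (\<integral>\<^sup>+x. ennreal (\<bar>u x\<bar> powr q) * indicator (dyadic_ecell e k) x \<partial>lebesgue)" for k
    define X where "X k = enn2real (\<integral>\<^sup>+x. ennreal (norm (g x) powr p) * indicator (dyadic_ecell e k) x \<partial>lebesgue)" for k
    have XY0: "0 \<le> X k" "0 \<le> Y k" for k by (auto simp: X_def Y_def)
    have um': "(\<lambda>x. \<bar>u x\<bar> powr q) \<in> borel_measurable lebesgue" and gm': "(\<lambda>x. norm (g x) powr p) \<in> borel_measurable lebesgue"
      by measurable
    note Ysums = dyadic_ecell_sums[OF e um' _ U UV0(1), simplified]
    note Xsums = dyadic_ecell_sums[OF e gm' _ V UV0(2), simplified]
    have Yk: "(\<integral>\<^sup>+x. ennreal (\<bar>u x\<bar> powr q) * indicator (dyadic_ecell e k) x \<partial>lebesgue) = ennreal (Y k)" for k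
      using Ysums(1)[of k] by (simp add: Y_def)
    have Xk: "(\<integral>\<^sup>+x. ennreal (norm (g x) powr p) * indicator (dyadic_ecell e k) x \<partial>lebesgue) = ennreal (X k)" for k
      using Xsums(1)[of k] by (simp add: X_def)
    have sY: "\<forall>F. finite F \<longrightarrow> (\<Sum>k\<in>F. 2 powr (a * of_int k) * Y k) \<le> P powr q"
      using Ysums(2) PU unfolding Y_def by (auto intro: order_trans)
    have sX: "\<forall>F. finite F \<longrightarrow> (\<Sum>k\<in>F. 2 powr (b * of_int k) * X k) \<le> P powr p"
      using Xsums(2) PV unfolding X_def by (auto intro: order_trans)
    have "\<forall>k. \<exists>m. measure lborel (dyadic_cell e k) * \<bar>m\<bar> powr q \<le> 2 * Y k \<and>
      (\<integral>\<^sup>+x. ennreal (\<bar>u x - m\<bar> powr r) * indicator (dyadic_cell e k) x \<partial>lebesgue)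
        \<le> ennreal (2 * GN_const TYPE('a) r \<theta> * measure lborel (dyadic_cell e k) powr (1 - \<kappa>) * (X k powr (\<theta> * r / p) * (2 powr q * 3 * Y k) powr ((1 - \<theta>) * r / q))) \<and>
      (\<integral>\<^sup>+x. ennreal (\<bar>u x - m\<bar> powr p) * indicator (dyadic_cell e k) x \<partial>lebesgue)
        \<le> ennreal (2 * GN_const TYPE('a) p 1 * measure lborel (dyadic_cell e k) powr (p / N) * X k)"
    proof
      fix k
      have \<rho>: "0 < (2::real) powr of_int k" "3 / 2 * 2 powr of_int k < norm ((2 powr of_int k) *\<^sub>R e)"
        using e by auto
      show "\<exists>m. measure lborel (dyadic_cell e k) * \<bar>m\<bar> powr q \<le> 2 * Y k \<and>
      (\<integral>\<^sup>+x. ennreal (\<bar>u x - m\<bar> powr r) * indicator (dyadic_cell e k) x \<partial>lebesgue)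
        \<le> ennreal (2 * GN_const TYPE('a) r \<theta> * measure lborel (dyadic_cell e k) powr (1 - \<kappa>) * (X k powr (\<theta> * r / p) * (2 powr q * 3 * Y k) powr ((1 - \<theta>) * r / q))) \<and>
      (\<integral>\<^sup>+x. ennreal (\<bar>u x - m\<bar> powr p) * indicator (dyadic_cell e k) x \<partial>lebesgue)
        \<le> ennreal (2 * GN_const TYPE('a) p 1 * measure lborel (dyadic_cell e k) powr (p / N) * X k)"
        unfolding dyadic_cell_def N_def
        by (rule weak_cell_estimate[OF w \<rho> p q \<theta> \<kappa>[unfolded N_def] Xk[unfolded dyadic_ecell_def] XY0(1) Yk[unfolded dyadic_ecell_def] XY0(2)])
    qed
    from choice[OF this] obtain m where m: "\<forall>k. measure lborel (dyadic_cell e k) * \<bar>m k\<bar> powr q \<le> 2 * Y k \<and>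
      (\<integral>\<^sup>+x. ennreal (\<bar>u x - m k\<bar> powr r) * indicator (dyadic_cell e k) x \<partial>lebesgue)
        \<le> ennreal (2 * GN_const TYPE('a) r \<theta> * measure lborel (dyadic_cell e k) powr (1 - \<kappa>) * (X k powr (\<theta> * r / p) * (2 powr q * 3 * Y k) powr ((1 - \<theta>) * r / q))) \<and>
      (\<integral>\<^sup>+x. ennreal (\<bar>u x - m k\<bar> powr p) * indicator (dyadic_cell e k) x \<partial>lebesgue)
        \<le> ennreal (2 * GN_const TYPE('a) p 1 * measure lborel (dyadic_cell e k) powr (p / N) * X k)"
      by (elim exE)
    note m1 = m[THEN spec, THEN conjunct1] and m2 = m[THEN spec, THEN conjunct2, THEN conjunct1]
      and m3 = m[THEN spec, THEN conjunct2, THEN conjunct2]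
    define I where "I k = enn2real (\<integral>\<^sup>+x. ennreal (\<bar>u x - m k\<bar> powr r) * indicator (dyadic_cell e k) x \<partial>lebesgue)" for k
    have Ik: "(\<integral>\<^sup>+x. ennreal (\<bar>u x - m k\<bar> powr r) * indicator (dyadic_cell e k) x \<partial>lebesgue) = ennreal (I k)" for k
    proof -
      have "(\<integral>\<^sup>+x. ennreal (\<bar>u x - m k\<bar> powr r) * indicator (dyadic_cell e k) x \<partial>lebesgue) < \<infinity>"
        by (rule order.strict_trans1[OF m2]) simp
      then show ?thesis by (simp add: I_def)
    qed
    have I0: "0 \<le> I k" for k by (simp add: I_def)
    have h2: "\<forall>k. 2 powr (N * of_int k) * \<bar>m k\<bar> powr q \<le> C1 * Y k"
    proof
      fix k
      have "\<omega> * (2 powr (N * of_int k) * \<bar>m k\<bar> powr q) \<le> 2 * Y k" using m1[of k] by (simp add: vol mult.assoc)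
      then show "2 powr (N * of_int k) * \<bar>m k\<bar> powr q \<le> C1 * Y k" using \<omega> by (simp add: C1_def field_simps)
    qed
    have h4: "\<forall>k. I k \<le> C3 * 2 powr (N * (1 - \<kappa>) * of_int k) * (X k powr (\<theta> * r / p) * Y k powr ((1 - \<theta>) * r / q))"
    proof
      fix k
      have "ennreal (I k) \<le> ennreal (2 * GN_const TYPE('a) r \<theta> * measure lborel (dyadic_cell e k) powr (1 - \<kappa>) * (X k powr (\<theta> * r / p) * (2 powr q * 3 * Y k) powr ((1 - \<theta>) * r / q)))"
        using m2[of k] unfolding Ik .
      then have "I k \<le> 2 * GN_const TYPE('a) r \<theta> * measure lborel (dyadic_cell e k) powr (1 - \<kappa>) * (X k powr (\<theta> * r / p) * (2 powr q * 3 * Y k) powr ((1 - \<theta>) * r / q))"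
        using GN0 by (subst (asm) ennreal_le_iff) auto
      also have "\<dots> = C3 * 2 powr (N * (1 - \<kappa>) * of_int k) * (X k powr (\<theta> * r / p) * Y k powr ((1 - \<theta>) * r / q))"
        using \<omega> XY0 unfolding vol C3_def by (simp add: powr_mult powr_powr mult_ac)
      finally show "I k \<le> C3 * 2 powr (N * (1 - \<kappa>) * of_int k) * (X k powr (\<theta> * r / p) * Y k powr ((1 - \<theta>) * r / q))" .
    qed
    have osc: "(\<integral>\<^sup>+x. ennreal (\<bar>u x - m k\<bar> powr p) * indicator (dyadic_cell e k) x \<partial>lebesgue) \<le> ennreal (Cp * (2 powr (p * of_int k) * X k))" for k
    proof -
      have eq: "2 * GN_const TYPE('a) p 1 * measure lborel (dyadic_cell e k) powr (p / N) * X k = Cp * (2 powr (p * of_int k) * X k)"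
        using \<omega> N unfolding vol Cp_def by (simp add: powr_mult powr_powr mult_ac)
      show ?thesis using m3[of k] unfolding eq .
    qed
    have h3: "\<forall>k. 2 powr (N * of_int k) * \<bar>m k - m (k + 1)\<bar> powr p \<le> C2 * (2 powr (p * of_int k) * X k + 2 powr (p * of_int (k + 1)) * X (k + 1))"
    proof
      fix k
      define w where "w = (2::real) powr of_int k"
      have w0: "w > 0" by (simp add: w_def)
      have w1: "2 powr of_int (k + 1) = 2 * w" by (simp add: w_def powr_add)
      \<comment> \<open>A ball inside both neighbouring cells: its centre has distance w/2 from the
        centre w e and 3w/2 from the centre 2w e, so radius w/2 just fits into the radii w and
        2w.\<close>
      define O' where "O' = ball ((5 / 4 * w) *\<^sub>R e) (w / 2)"
      have O'm[measurable]: "O' \<in> sets lebesgue" by (simp add: O'_def)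
      have sub: "O' \<subseteq> dyadic_cell e k" "O' \<subseteq> dyadic_cell e (k + 1)"
      proof -
        have "dist (w *\<^sub>R e) x < w" "dist ((2 * w) *\<^sub>R e) x < 2 * w" if "x \<in> O'" for x
        proof -
          have d: "dist ((5 / 4 * w) *\<^sub>R e) x < w / 2" using that by (simp add: O'_def)
          have "dist (w *\<^sub>R e) ((5 / 4 * w) *\<^sub>R e) = w / 2"
            using e w0 by (simp add: dist_norm flip: scaleR_diff_left)
          moreover have "dist ((2 * w) *\<^sub>R e) ((5 / 4 * w) *\<^sub>R e) = 3 / 2 * w"
            using e w0 by (simp add: dist_norm flip: scaleR_diff_left)
          ultimately show "dist (w *\<^sub>R e) x < w" "dist ((2 * w) *\<^sub>R e) x < 2 * w"
            using d dist_triangle[of "w *\<^sub>R e" x "(5 / 4 * w) *\<^sub>R e"] dist_triangle[of "(2 * w) *\<^sub>R e" x "(5 / 4 * w) *\<^sub>R e"] by linarith+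
        qed
        then show "O' \<subseteq> dyadic_cell e k" "O' \<subseteq> dyadic_cell e (k + 1)"
          unfolding dyadic_cell_def w1 by (auto simp: w_def)
      qed
      have volO: "emeasure lebesgue O' = ennreal (\<omega> * 2 powr (N * of_int k) / 2 powr N)"
        using w0 by (simp add: O'_def emeasure_ball \<omega>_def N_def power_divide w_def powr_powr powr_realpow mult.commute flip: powr_realpow)
      define d where "d = \<bar>m k - m (k + 1)\<bar> powr p"
      \<comment> \<open>On the common ball |m k - m (k+1)| is at most |u - m k| + |u - m (k+1)|;
        integrating p-th powers bounds the increment by the two Poincare terms.\<close>
      have "ennreal (d * (\<omega> * 2 powr (N * of_int k) / 2 powr N)) = (\<integral>\<^sup>+x. ennreal d * indicator O' x \<partial>lebesgue)"
        unfolding nn_integral_cmult_indicator[OF O'm] volO using \<omega> by (intro ennreal_mult) (auto simp: d_def)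
      also have "\<dots> \<le> (\<integral>\<^sup>+x. ennreal (2 powr p) * (ennreal (\<bar>u x - m k\<bar> powr p) * indicator (dyadic_cell e k) x
          + ennreal (\<bar>u x - m (k + 1)\<bar> powr p) * indicator (dyadic_cell e (k + 1)) x) \<partial>lebesgue)"
      proof (rule nn_integral_mono)
        fix x
        show "ennreal d * indicator O' x \<le> ennreal (2 powr p) * (ennreal (\<bar>u x - m k\<bar> powr p) * indicator (dyadic_cell e k) x
          + ennreal (\<bar>u x - m (k + 1)\<bar> powr p) * indicator (dyadic_cell e (k + 1)) x)"
        proof (cases "x \<in> O'")
          case True
          have "d \<le> (\<bar>u x - m k\<bar> + \<bar>u x - m (k + 1)\<bar>) powr p" unfolding d_def using p by (intro powr_mono2) auto
          also have "\<dots> \<le> 2 powr p * (\<bar>u x - m k\<bar> powr p + \<bar>u x - m (k + 1)\<bar> powr p)" using p by (intro powr_add_le) auto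
          finally have "ennreal d \<le> ennreal (2 powr p * (\<bar>u x - m k\<bar> powr p + \<bar>u x - m (k + 1)\<bar> powr p))" by (rule ennreal_leI)
          also have "\<dots> = ennreal (2 powr p) * (ennreal (\<bar>u x - m k\<bar> powr p) + ennreal (\<bar>u x - m (k + 1)\<bar> powr p))"
            by (simp add: ennreal_mult)
          also have "\<dots> = ennreal (2 powr p) * (ennreal (\<bar>u x - m k\<bar> powr p) * indicator (dyadic_cell e k) x
              + ennreal (\<bar>u x - m (k + 1)\<bar> powr p) * indicator (dyadic_cell e (k + 1)) x)"
            using subsetD[OF sub(1) True] subsetD[OF sub(2) True] by simp
          finally show ?thesis using True by simp
        qed simp
      qed
      also have "\<dots> = ennreal (2 powr p) * ((\<integral>\<^sup>+x. ennreal (\<bar>u x - m k\<bar> powr p) * indicator (dyadic_cell e k) x \<partial>lebesgue)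
          + (\<integral>\<^sup>+x. ennreal (\<bar>u x - m (k + 1)\<bar> powr p) * indicator (dyadic_cell e (k + 1)) x \<partial>lebesgue))"
        by (rule nn_integral_cmult_add) measurable
      also have "\<dots> \<le> ennreal (2 powr p) * (ennreal (Cp * (2 powr (p * of_int k) * X k)) + ennreal (Cp * (2 powr (p * of_int (k + 1)) * X (k + 1))))"
        by (intro mult_left_mono add_mono osc) simp
      also have "\<dots> = ennreal (2 powr p * (Cp * (2 powr (p * of_int k) * X k) + Cp * (2 powr (p * of_int (k + 1)) * X (k + 1))))"
        using C XY0 by (simp add: ennreal_mult ennreal_plus)
      finally have "d * (\<omega> * 2 powr (N * of_int k) / 2 powr N) \<le> 2 powr p * (Cp * (2 powr (p * of_int k) * X k) + Cp * (2 powr (p * of_int (k + 1)) * X (k + 1)))"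
        using C XY0 by (subst (asm) ennreal_le_iff) auto
      then have "(2 powr N / \<omega>) * (d * (\<omega> * 2 powr (N * of_int k) / 2 powr N))
          \<le> (2 powr N / \<omega>) * (2 powr p * (Cp * (2 powr (p * of_int k) * X k) + Cp * (2 powr (p * of_int (k + 1)) * X (k + 1))))"
        using \<omega> by (intro mult_left_mono) auto
      also have "(2 powr N / \<omega>) * (d * (\<omega> * 2 powr (N * of_int k) / 2 powr N)) = 2 powr (N * of_int k) * d" using \<omega> by simp
      also have "(2 powr N / \<omega>) * (2 powr p * (Cp * (2 powr (p * of_int k) * X k) + Cp * (2 powr (p * of_int (k + 1)) * X (k + 1))))
         = C2 * (2 powr (p * of_int k) * X k + 2 powr (p * of_int (k + 1)) * X (k + 1))"
        unfolding C2_def distrib_left by (simp only: mult_ac)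
      finally show "2 powr (N * of_int k) * \<bar>m k - m (k + 1)\<bar> powr p \<le> C2 * (2 powr (p * of_int k) * X k + 2 powr (p * of_int (k + 1)) * X (k + 1))"
        by (simp only: d_def)
    qed
    have "\<forall>k. 0 \<le> X k \<and> 0 \<le> Y k \<and> 0 \<le> I k" using XY0 I0 by blast
    note total = KH'[OF P this sY sX h2 h3 h4 F]
    have cell: "(\<integral>\<^sup>+x. ennreal (norm x powr c * \<bar>u x\<bar> powr r) * indicator (dyadic_cell e k) x \<partial>lebesgue)
        \<le> ennreal (L * (2 powr (c * of_int k) * (I k + 2 powr (N * of_int k) * \<bar>m k\<bar> powr r)))" for k
    proof -
      define H where "H = hi_const c * 2 powr (c * of_int k) * 2 powr r"
      have H: "H \<ge> 0" using hi_const_pos[of c] by (simp add: H_def)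
      have "(\<integral>\<^sup>+x. ennreal (norm x powr c * \<bar>u x\<bar> powr r) * indicator (dyadic_cell e k) x \<partial>lebesgue)
        \<le> (\<integral>\<^sup>+x. ennreal H * (ennreal (\<bar>u x - m k\<bar> powr r) * indicator (dyadic_cell e k) x + ennreal (\<bar>m k\<bar> powr r) * indicator (dyadic_cell e k) x) \<partial>lebesgue)"
      proof (rule nn_integral_mono)
        fix x
        show "ennreal (norm x powr c * \<bar>u x\<bar> powr r) * indicator (dyadic_cell e k) x
          \<le> ennreal H * (ennreal (\<bar>u x - m k\<bar> powr r) * indicator (dyadic_cell e k) x + ennreal (\<bar>m k\<bar> powr r) * indicator (dyadic_cell e k) x)"
        proof (cases "x \<in> dyadic_cell e k")
          case True
          have "\<bar>u x\<bar> powr r \<le> (\<bar>u x - m k\<bar> + \<bar>m k\<bar>) powr r" using r by (intro powr_mono2) auto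
          also have "\<dots> \<le> 2 powr r * (\<bar>u x - m k\<bar> powr r + \<bar>m k\<bar> powr r)" using r by (intro powr_add_le) auto
          finally have "norm x powr c * \<bar>u x\<bar> powr r \<le> hi_const c * 2 powr (c * of_int k) * (2 powr r * (\<bar>u x - m k\<bar> powr r + \<bar>m k\<bar> powr r))"
            using norm_powr_dyadic_ecell(2)[OF e subsetD[OF dyadic_cell_subset True]] hi_const_pos[of c] by (intro mult_mono) auto
          then have "ennreal (norm x powr c * \<bar>u x\<bar> powr r) \<le> ennreal (H * (\<bar>u x - m k\<bar> powr r + \<bar>m k\<bar> powr r))"
            by (intro ennreal_leI) (simp add: H_def mult.assoc)
          also have "\<dots> = ennreal H * (ennreal (\<bar>u x - m k\<bar> powr r) + ennreal (\<bar>m k\<bar> powr r))" using H by (simp add: ennreal_mult)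
          finally show ?thesis using True by simp
        qed simp
      qed
      also have "\<dots> = ennreal H * ((\<integral>\<^sup>+x. ennreal (\<bar>u x - m k\<bar> powr r) * indicator (dyadic_cell e k) x \<partial>lebesgue)
          + (\<integral>\<^sup>+x. ennreal (\<bar>m k\<bar> powr r) * indicator (dyadic_cell e k) x \<partial>lebesgue))"
        by (rule nn_integral_cmult_add) measurable
      also have "(\<integral>\<^sup>+x. ennreal (\<bar>m k\<bar> powr r) * indicator (dyadic_cell e k) x \<partial>lebesgue) = ennreal (\<bar>m k\<bar> powr r * (\<omega> * 2 powr (N * of_int k)))"
        using \<omega> by (simp add: nn_integral_cmult_indicator evol ennreal_mult)
      also have "ennreal H * ((\<integral>\<^sup>+x. ennreal (\<bar>u x - m k\<bar> powr r) * indicator (dyadic_cell e k) x \<partial>lebesgue) + ennreal (\<bar>m k\<bar> powr r * (\<omega> * 2 powr (N * of_int k))))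
          = ennreal (H * (I k + \<bar>m k\<bar> powr r * (\<omega> * 2 powr (N * of_int k))))"
        unfolding Ik using H I0 \<omega> by (simp add: ennreal_mult ennreal_plus)
      also have "\<dots> \<le> ennreal (L * (2 powr (c * of_int k) * (I k + 2 powr (N * of_int k) * \<bar>m k\<bar> powr r)))"
      proof (rule ennreal_leI)
        let ?t = "2 powr (N * of_int k) * \<bar>m k\<bar> powr r"
        have "I k + \<bar>m k\<bar> powr r * (\<omega> * 2 powr (N * of_int k)) = I k + \<omega> * ?t" by simp
        also have "\<dots> \<le> (1 + \<omega>) * (I k + ?t)" using I0[of k] \<omega> by (simp add: algebra_simps)
        finally have "H * (I k + \<bar>m k\<bar> powr r * (\<omega> * 2 powr (N * of_int k))) \<le> H * ((1 + \<omega>) * (I k + ?t))"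
          using H by (rule mult_left_mono)
        also have "\<dots> = L * (2 powr (c * of_int k) * (I k + ?t))" unfolding H_def L_def by (simp only: mult_ac)
        finally show "H * (I k + \<bar>m k\<bar> powr r * (\<omega> * 2 powr (N * of_int k))) \<le> L * (2 powr (c * of_int k) * (I k + ?t))" .
      qed
      finally show ?thesis .
    qed
    have "(\<Sum>k\<in>F. \<integral>\<^sup>+x. ennreal (norm x powr c * \<bar>u x\<bar> powr r) * indicator (dyadic_cell e k) x \<partial>lebesgue)
      \<le> (\<Sum>k\<in>F. ennreal (L * (2 powr (c * of_int k) * (I k + 2 powr (N * of_int k) * \<bar>m k\<bar> powr r))))"
      by (rule sum_mono[OF cell])
    also have "\<dots> = ennreal (L * (\<Sum>k\<in>F. 2 powr (c * of_int k) * (I k + 2 powr (N * of_int k) * \<bar>m k\<bar> powr r)))"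
      using L I0 by (subst sum_ennreal) (auto simp: sum_distrib_left)
    also have "\<dots> \<le> ennreal (L * (K * P powr r))" using L total by (intro ennreal_leI mult_left_mono) auto
    also have "L * (K * P powr r) = L * K * T powr r * (wnorm a q u + wnorm b p g) powr r"
      using T wn0 by (simp add: P_def powr_mult)
    finally show "(\<Sum>k\<in>F. \<integral>\<^sup>+x. ennreal (norm x powr c * \<bar>u x\<bar> powr r) * indicator (dyadic_cell e k) x \<partial>lebesgue)
      \<le> ennreal (L * K * T powr r * (wnorm a q u + wnorm b p g) powr r)" .
  qed
qed

text \<open>Finitely many directions cover all nonzero points, so adding the one-ray bounds controls
  the full integral; overlaps of cells only enlarge the sum.\<close>

lemma embedding_of_seq_embed:
  fixes a b c p q r \<theta> \<kappa> :: real
  defines "N \<equiv> real DIM('a::euclidean_space)"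
  assumes emb: "seq_embed q p r ((a + N) / q) ((b - p + N) / p) ((c + N) / r)"
    and p: "1 \<le> p" "p \<le> r" and q: "1 \<le> q" "q \<le> r" and \<theta>: "0 \<le> \<theta>" "\<theta> \<le> 1"
    and c: "(c + N) / r = (1 - \<theta>) * ((a + N) / q) + \<theta> * ((b - p + N) / p)"
    and \<kappa>: "r * (\<theta> * (1 / p - 1 / N) + (1 - \<theta>) / q) \<le> 1"
  shows "\<exists>C. \<forall>(u::'a \<Rightarrow> real) (g::'a \<Rightarrow> 'a).
           u \<in> borel_measurable lebesgue \<and> weak_grad_punct u g
           \<and> wint a q u < \<infinity> \<and> wint b p g < \<infinity>
           \<longrightarrow> wint c r u < \<infinity> \<and> wnorm c r u \<le> C * (wnorm a q u + wnorm b p g)"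
proof -
  have r: "r \<ge> 1" using p by simp
  obtain S where S: "finite S" "\<And>e::'a. e \<in> S \<Longrightarrow> norm e = 2"
    and cover: "\<And>x::'a. x \<noteq> 0 \<Longrightarrow> \<exists>e\<in>S. \<exists>k. x \<in> dyadic_cell e k"
    using dyadic_cells_cover[where 'a='a] by (elim exE conjE) blast
  define Q where "Q e K \<longleftrightarrow> (\<forall>(u::'a \<Rightarrow> real) g F. u \<in> borel_measurable lebesgue \<and> weak_grad_punct u g
      \<and> wint a q u < \<infinity> \<and> wint b p g < \<infinity> \<and> finite F \<longrightarrow>
    (\<Sum>k\<in>F. \<integral>\<^sup>+x. ennreal (norm x powr c * \<bar>u x\<bar> powr r) * indicator (dyadic_cell e k) x \<partial>lebesgue)
      \<le> ennreal (K * (wnorm a q u + wnorm b p g) powr r))" for e K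
  have "\<forall>e\<in>S. \<exists>K\<ge>0. Q e K"
    unfolding Q_def using direction_estimate[OF S(2) emb[unfolded N_def] p q \<theta> c[unfolded N_def] refl \<kappa>[unfolded N_def]]
    by (intro ballI)
  then obtain K where K: "\<And>e. e \<in> S \<Longrightarrow> K e \<ge> 0" "\<And>e. e \<in> S \<Longrightarrow> Q e (K e)" by metis
  define K0 where "K0 = (\<Sum>e\<in>S. K e)"
  have K0: "K0 \<ge> 0" unfolding K0_def using K by (intro sum_nonneg)
  show ?thesis
  proof (intro exI[of _ "K0 powr (1 / r)"] allI impI)
    fix u :: "'a \<Rightarrow> real" and g :: "'a \<Rightarrow> 'a"
    assume asm: "u \<in> borel_measurable lebesgue \<and> weak_grad_punct u g \<and> wint a q u < \<infinity> \<and> wint b p g < \<infinity>"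
    then have um[measurable]: "u \<in> borel_measurable lebesgue" by blast
    define M where "M = wnorm a q u + wnorm b p g"
    have M: "M \<ge> 0" by (simp add: M_def wnorm_def)
    define dens where "dens x = ennreal (norm x powr c * \<bar>u x\<bar> powr r)" for x
    have nm[measurable]: "norm \<in> borel_measurable (lebesgue :: 'a measure)" by (intro measurable_completion) simp
    have densm[measurable]: "dens \<in> borel_measurable lebesgue" unfolding dens_def by measurable
    define cov where "cov n = (\<Union>e\<in>S. \<Union>k\<in>{- int n..int n}. dyadic_cell e k)" for n
    have cellm[measurable]: "dyadic_cell e k \<in> sets lebesgue" for e :: 'a and k by (simp add: dyadic_cell_def)
    have covm[measurable]: "cov n \<in> sets lebesgue" for n unfolding cov_def using S(1) by (intro sets.finite_UN) auto
    have bound: "(\<integral>\<^sup>+x. dens x * indicator (cov n) x \<partial>lebesgue) \<le> ennreal (K0 * M powr r)" for n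
    proof -
      have "(\<integral>\<^sup>+x. dens x * indicator (cov n) x \<partial>lebesgue) \<le> (\<integral>\<^sup>+x. (\<Sum>e\<in>S. \<Sum>k\<in>{- int n..int n}. dens x * indicator (dyadic_cell e k) x) \<partial>lebesgue)"
      proof (rule nn_integral_mono)
        fix x
        show "dens x * indicator (cov n) x \<le> (\<Sum>e\<in>S. \<Sum>k\<in>{- int n..int n}. dens x * indicator (dyadic_cell e k) x)"
        proof (cases "x \<in> cov n")
          case True
          then obtain e k where ek: "e \<in> S" "k \<in> {- int n..int n}" "x \<in> dyadic_cell e k" by (auto simp: cov_def)
          have "dens x = dens x * indicator (dyadic_cell e k) x" using ek by simp
          also have "\<dots> \<le> (\<Sum>k\<in>{- int n..int n}. dens x * indicator (dyadic_cell e k) x)"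
            using ek by (intro member_le_sum) auto
          also have "\<dots> \<le> (\<Sum>e\<in>S. \<Sum>k\<in>{- int n..int n}. dens x * indicator (dyadic_cell e k) x)"
            using ek S(1) by (intro member_le_sum[where f="\<lambda>e. \<Sum>k\<in>{- int n..int n}. dens x * indicator (dyadic_cell e k) x"]) auto
          finally show ?thesis using True by simp
        qed simp
      qed
      also have "\<dots> = (\<Sum>e\<in>S. \<Sum>k\<in>{- int n..int n}. \<integral>\<^sup>+x. dens x * indicator (dyadic_cell e k) x \<partial>lebesgue)"
        by (subst nn_integral_sum, measurable, intro sum.cong refl nn_integral_sum) measurable
      also have "\<dots> \<le> (\<Sum>e\<in>S. ennreal (K e * M powr r))"
      proof (rule sum_mono)
        fix e assume "e \<in> S"
        from K(2)[OF this] show "(\<Sum>k\<in>{- int n..int n}. \<integral>\<^sup>+x. dens x * indicator (dyadic_cell e k) x \<partial>lebesgue) \<le> ennreal (K e * M powr r)"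
          unfolding Q_def dens_def M_def using asm by blast
      qed
      also have "\<dots> = ennreal (K0 * M powr r)"
        using K(1) by (subst sum_ennreal) (auto simp: K0_def sum_distrib_right)
      finally show ?thesis .
    qed
    have "wint c r u = (\<integral>\<^sup>+x. (SUP n. dens x * indicator (cov n) x) \<partial>lebesgue)"
      unfolding wint_def
    proof (rule nn_integral_cong)
      fix x :: 'a
      show "ennreal (norm x powr c * norm (u x) powr r) = (SUP n. dens x * indicator (cov n) x)"
      \<comment> \<open>At the origin both sides are 0 because \<open>0 powr c = 0\<close>, in
        accordance with its being a null set.\<close>
      proof (cases "x = 0")
        case False
        then obtain e k where ek: "e \<in> S" "x \<in> dyadic_cell e k" using cover by blast
        then have "x \<in> cov (nat \<bar>k\<bar>)" unfolding cov_def by (intro UN_I[of e] UN_I[of k]) auto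
        then have "dens x \<le> (SUP n. dens x * indicator (cov n) x)" by (intro SUP_upper2[of "nat \<bar>k\<bar>"]) auto
        moreover have "(SUP n. dens x * indicator (cov n) x) \<le> dens x" by (intro SUP_least) (auto simp: indicator_def)
        ultimately show ?thesis by (simp add: dens_def antisym)
      qed (simp add: dens_def)
    qed
    also have "\<dots> = (SUP n. \<integral>\<^sup>+x. dens x * indicator (cov n) x \<partial>lebesgue)"
    proof (rule nn_integral_monotone_convergence_SUP)
      show "incseq (\<lambda>n x. dens x * indicator (cov n) x)"
      proof (rule incseq_SucI, rule le_funI)
        fix n x
        have "cov n \<subseteq> cov (Suc n)" unfolding cov_def by (intro UN_mono) auto
        then show "dens x * indicator (cov n) x \<le> dens x * indicator (cov (Suc n)) x" by (auto simp: indicator_def)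
      qed
    qed measurable
    also have "\<dots> \<le> ennreal (K0 * M powr r)" by (rule SUP_least[OF bound])
    finally have wi: "wint c r u \<le> ennreal (K0 * M powr r)" .
    then have fin: "wint c r u < \<infinity>" by (rule order.strict_trans1) simp
    have "enn2real (wint c r u) \<le> K0 * M powr r" using wi K0 M by (intro enn2real_leI) auto
    then have "wnorm c r u \<le> (K0 * M powr r) powr (1 / r)" unfolding wnorm_def using r by (intro powr_mono2) auto
    also have "\<dots> = K0 powr (1 / r) * M" using r K0 M by (simp add: powr_mult powr_powr)
    finally show "wint c r u < \<infinity> \<and> wnorm c r u \<le> K0 powr (1 / r) * (wnorm a q u + wnorm b p g)"
      using fin by (simp add: M_def)
  qed
qed

section \<open>The cases of the exponents\<close>

lemma seq_embed_interpolation: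
  assumes q: "1 \<le> q" "q \<le> r" and p: "1 \<le> p" "p \<le> r"
    and h: "(A \<le> 0 \<and> B \<le> 0 \<or> 0 \<le> A \<and> 0 \<le> B) \<and> min A B < C \<and> C < max A B
       \<or> (A < 0 \<and> 0 < B \<or> 0 < A \<and> B < 0) \<and> min A 0 < C \<and> C < max A 0"
  shows "seq_embed q p r A B C"
proof -
  \<comment> \<open>Two situations and their mirror images. For opposite signs the barrier is 0
    instead of B: if B < 0 < A, the sequence equal to 1 for k <= 0 and 0 otherwise has both norms
    finite, and its image is finite only for C > 0.\<close>
  consider "max B 0 < C" "C < A" | "0 \<le> A" "A < C" "C < B" | "max (- B) 0 < - C" "- C < - A" | "0 \<le> - A" "- A < - C" "- C < - B"
    using h by (auto simp: min_def max_def split: if_splits)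
  then show ?thesis
  proof cases
    case 1
    then show ?thesis by (rule seq_embed_below[OF q p(1)])
  next
    case 2
    then show ?thesis by (rule seq_embed_above[OF q p(1)])
  next
    case 3
    then show ?thesis using seq_embed_mirror[OF q(1) p(1) seq_embed_below[OF q p(1) 3]] by simp
  next
    case 4
    then show ?thesis using seq_embed_mirror[OF q(1) p(1) seq_embed_above[OF q p(1) 4]] by simp
  qed
qed

theorem theorem8p3:
  fixes a b c p q r :: real
  defines "N \<equiv> real DIM('a::euclidean_space)"
  assumes p: "1 \<le> p" and q: "1 \<le> q" and r: "1 \<le> r"
    and qr: "q < r" and rp: "p \<le> r"
  assumes cases:
    "( ((a \<le> -N \<and> b - p \<le> -N) \<or> (a \<ge> -N \<and> b - p \<ge> -N))
        \<and> (a + N) / q \<noteq> (b - p + N) / p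
        \<and> min (c0 N r a q) (c1 N r b p) < c \<and> c < max (c0 N r a q) (c1 N r b p)
        \<and> theta N r a b p q c * (1/p - 1/N - 1/q) \<le> 1/r - 1/q )
   \<or> ( ((a < -N \<and> b - p > -N) \<or> (a > -N \<and> b - p < -N))
        \<and> min (c0 N r a q) (-N) < c \<and> c < max (c0 N r a q) (-N)
        \<and> theta N r a b p q c * (1/p - 1/N - 1/q) \<le> 1/r - 1/q )
   \<or> ( ereal r \<le> pstar N p
        \<and> ((a \<le> -N \<and> b - p < -N) \<or> (a \<ge> -N \<and> b - p > -N))
        \<and> c = c1 N r b p )
   \<or> ( a = -N \<and> b = p - N \<and> q < r \<and> ereal r \<le> pstar N p \<and> c = -N )"
  shows "\<exists>C. \<forall>(u::'a \<Rightarrow> real) (g::'a \<Rightarrow> 'a).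
           u \<in> borel_measurable lebesgue \<and> weak_grad_punct u g
           \<and> wint a q u < \<infinity> \<and> wint b p g < \<infinity>
           \<longrightarrow> wint c r u < \<infinity> \<and> wnorm c r u \<le> C * (wnorm a q u + wnorm b p g)"
proof -
  \<comment> \<open>The increasing affine map x -> r x - N takes A, B, 0 and \<gamma> to c0, c1, -N
    and c, so every case can be read off from A, B and \<gamma>.\<close>
  define A B \<gamma> where "A = (a + N) / q" and "B = (b - p + N) / p" and "\<gamma> = (c + N) / r"
  have N: "N \<ge> 1" using DIM_positive[where 'a='a] unfolding N_def by linarith
  have c0: "c0 N r a q = r * A - N" and c1: "c1 N r b p = r * B - N" and c: "c = r * \<gamma> - N"
    using r by (simp_all add: c0_def c1_def A_def B_def \<gamma>_def)
  have sgn: "a \<le> - N \<longleftrightarrow> A \<le> 0" "a < - N \<longleftrightarrow> A < 0" "b - p \<le> - N \<longleftrightarrow> B \<le> 0" "b - p < - N \<longleftrightarrow> B < 0"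
    "a \<ge> - N \<longleftrightarrow> A \<ge> 0" "a > - N \<longleftrightarrow> A > 0" "b - p \<ge> - N \<longleftrightarrow> B \<ge> 0" "b - p > - N \<longleftrightarrow> B > 0"
    using p q by (auto simp: A_def B_def divide_le_0_iff divide_less_0_iff zero_le_divide_iff zero_less_divide_iff)
  have lt: "r * x - N < r * y - N \<longleftrightarrow> x < y" "- N < r * y - N \<longleftrightarrow> 0 < y" "r * x - N < - N \<longleftrightarrow> x < 0" for x y
    using r by (auto simp: zero_less_mult_iff mult_less_0_iff)
  \<comment> \<open>For \<theta> = 1 the exponent \<kappa> is r(1/p - 1/N): not positive if p >= N,
    and otherwise at most 1 exactly when r <= Np/(N-p).\<close>
  have crit: "r * (1 * (1 / p - 1 / N) + (1 - 1) / q) \<le> 1" if "ereal r \<le> pstar N p"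
  proof (cases "p \<ge> N")
    case True
    have "1 / p - 1 / N \<le> 0" using True N p by (simp add: frac_le)
    then have "r * (1 / p - 1 / N) \<le> 0" using r by (simp add: mult_nonneg_nonpos)
    then show ?thesis by simp
  next
    case False
    then have "r \<le> N * p / (N - p)" using that by (simp add: pstar_def)
    then have "r * (N - p) \<le> N * p" using False by (simp add: field_simps)
    moreover have "1 / p - 1 / N = (N - p) / (N * p)" using N p by (simp add: field_simps)
    ultimately show ?thesis using N p by (simp add: divide_le_eq_1)
  qed
  \<comment> \<open>The factor r cancels in \<open>theta\<close>, which is therefore the
    interpolation parameter of \<gamma> between A and B; its condition multiplied by r is \<kappa>
    <= 1.\<close>
  have between: "\<exists>\<theta>. 0 \<le> \<theta> \<and> \<theta> \<le> 1 \<and> \<gamma> = (1 - \<theta>) * A + \<theta> * B \<and> r * (\<theta> * (1 / p - 1 / N) + (1 - \<theta>) / q) \<le> 1 \<and> seq_embed q p r A B \<gamma>"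
    if AB: "A < \<gamma> \<and> \<gamma> < B \<or> B < \<gamma> \<and> \<gamma> < A" and th: "theta N r a b p q c * (1/p - 1/N - 1/q) \<le> 1/r - 1/q"
      and emb: "seq_embed q p r A B \<gamma>"
  proof -
    define \<theta> where "\<theta> = (\<gamma> - A) / (B - A)"
    have "theta N r a b p q c = (r * (\<gamma> - A)) / (r * (B - A))"
      unfolding theta_def c0 c1 c by (simp add: right_diff_distrib)
    then have "theta N r a b p q c = \<theta>" using r by (simp add: \<theta>_def)
    then have "\<theta> * (1/p - 1/N - 1/q) \<le> 1/r - 1/q" using th by simp
    then have "\<theta> * (1 / p - 1 / N) + (1 - \<theta>) / q \<le> 1 / r" by (simp add: algebra_simps diff_divide_distrib)
    then have "r * (\<theta> * (1 / p - 1 / N) + (1 - \<theta>) / q) \<le> r * (1 / r)" using r by (intro mult_left_mono) auto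
    moreover have "0 \<le> \<theta>" "\<theta> \<le> 1" using AB by (auto simp: \<theta>_def zero_le_divide_iff divide_le_eq_1)
    moreover have "\<theta> * (B - A) = \<gamma> - A" using AB by (auto simp: \<theta>_def)
    then have "\<gamma> = (1 - \<theta>) * A + \<theta> * B" by (simp add: algebra_simps)
    ultimately show ?thesis using emb r by (intro exI[of _ \<theta>]) auto
  qed
  have "\<exists>\<theta>. 0 \<le> \<theta> \<and> \<theta> \<le> 1 \<and> \<gamma> = (1 - \<theta>) * A + \<theta> * B \<and> r * (\<theta> * (1 / p - 1 / N) + (1 - \<theta>) / q) \<le> 1 \<and> seq_embed q p r A B \<gamma>"
    using cases
  proof (elim disjE)
    assume h: "((a \<le> -N \<and> b - p \<le> -N) \<or> (a \<ge> -N \<and> b - p \<ge> -N))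
        \<and> (a + N) / q \<noteq> (b - p + N) / p
        \<and> min (c0 N r a q) (c1 N r b p) < c \<and> c < max (c0 N r a q) (c1 N r b p)
        \<and> theta N r a b p q c * (1/p - 1/N - 1/q) \<le> 1/r - 1/q"
    then have AB: "min A B < \<gamma> \<and> \<gamma> < max A B"
      unfolding c0 c1 c using lt by (auto simp: min_def max_def split: if_splits)
    then have "A < \<gamma> \<and> \<gamma> < B \<or> B < \<gamma> \<and> \<gamma> < A" by (auto simp: min_def max_def split: if_splits)
    moreover have "seq_embed q p r A B \<gamma>"
      by (rule seq_embed_interpolation[OF q _ p rp]) (use h AB qr in \<open>auto simp: sgn\<close>)
    ultimately show ?thesis using between h by blast
  next
    assume h: "((a < -N \<and> b - p > -N) \<or> (a > -N \<and> b - p < -N))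
        \<and> min (c0 N r a q) (-N) < c \<and> c < max (c0 N r a q) (-N)
        \<and> theta N r a b p q c * (1/p - 1/N - 1/q) \<le> 1/r - 1/q"
    then have AB: "min A 0 < \<gamma> \<and> \<gamma> < max A 0"
      unfolding c0 c using lt by (auto simp: min_def max_def split: if_splits)
    have sg: "A < 0 \<and> 0 < B \<or> 0 < A \<and> B < 0" using h unfolding sgn by blast
    \<comment> \<open>0 lies strictly between A and B, so a \<gamma> between A and 0 also lies
      between A and B, and \<theta> stays in [0,1].\<close>
    then have "A < \<gamma> \<and> \<gamma> < B \<or> B < \<gamma> \<and> \<gamma> < A" using AB by (auto simp: min_def max_def split: if_splits)
    moreover have "seq_embed q p r A B \<gamma>"
      by (rule seq_embed_interpolation[OF q _ p rp]) (use sg AB qr in auto)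
    ultimately show ?thesis using between h by blast
  next
    assume h: "ereal r \<le> pstar N p
        \<and> ((a \<le> -N \<and> b - p < -N) \<or> (a \<ge> -N \<and> b - p > -N))
        \<and> c = c1 N r b p"
    \<comment> \<open>The endpoint \<theta> = 1, given by the Hardy inequality, with the scales
      reversed when B < 0.\<close>
    then have \<gamma>: "\<gamma> = B" using r c c1 by simp
    have "seq_embed q p r A B \<gamma>"
    proof (cases "0 < B")
      case True
      then show ?thesis using h qr q p rp unfolding \<gamma> sgn by (intro seq_embed_Hardy) auto
    next
      case False
      then have "seq_embed q p r (- A) (- B) (- B)" using h qr q p rp unfolding sgn by (intro seq_embed_Hardy) auto
      from seq_embed_mirror[OF q p this] show ?thesis by (simp add: \<gamma>)
    qed
    then show ?thesis using crit h \<gamma> by (intro exI[of _ 1]) auto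
  next
    assume h: "a = -N \<and> b = p - N \<and> q < r \<and> ereal r \<le> pstar N p \<and> c = -N"
    \<comment> \<open>All exponents vanish, so any \<theta> satisfies the interpolation identity;
      \<theta> = 1 is chosen because its \<kappa> <= 1 is what r <= \<open>pstar N p\<close>
      provides.\<close>
    then have "A = 0" "B = 0" "\<gamma> = 0" by (auto simp: A_def B_def \<gamma>_def)
    moreover have "seq_embed q p r 0 0 0" using q qr by (intro seq_embed_same) auto
    ultimately show ?thesis using crit h by (intro exI[of _ 1]) auto
  qed
  then obtain \<theta> where \<theta>: "0 \<le> \<theta>" "\<theta> \<le> 1" "\<gamma> = (1 - \<theta>) * A + \<theta> * B" "r * (\<theta> * (1 / p - 1 / N) + (1 - \<theta>) / q) \<le> 1" "seq_embed q p r A B \<gamma>"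
    by blast
  show ?thesis
    using \<theta> embedding_of_seq_embed[where 'a='a, of q p r a b c \<theta>] p q rp qr
    unfolding A_def B_def \<gamma>_def N_def by auto
qed

end
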